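(* Let $\rho_o,\sigma_o\in L^\infty(\mathbb{R},[0,1])$, $y\in W^{1,\infty}_{loc}((0,\infty),\mathbb{R})$ and $q,r\in L^\infty_{loc}((0,\infty),\mathbb{R})$, where both $q$ and $r$ satisfy assumption (Q) of the context. Let $\rho$ be a $\mathcal{G}_{\dot y}(q)$-entropy solution to the single trajectory problem with initial datum $\rho_o$ and constraint $q$, and let $\sigma$ be a $\mathcal{G}_{\dot y}(r)$-entropy solution to the single trajectory problem with initial datum $\sigma_o$ and constraint $r$ (same trajectory $y$). Then for all $T>0$, $$\|\rho(T)-\sigma(T)\|_{L^1(\mathbb{R})}\le\|\rho_o-\sigma_o\|_{L^1(\mathbb{R})}+2\int_0^T|q(t)-r(t)|\,dt .$$ In particular, the single trajectory problem admits at most one ($\mathcal{G}_{\dot y}(q)$-entropy) solution.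
   Context: Flux. $f\in C^2([0,1],[0,\infty))$ is concave, $f(0)=f(1)=0$, and there is a unique $\overline\rho\in(0,1)$ with $f'(\rho)(\overline\rho-\rho)>0$ for a.e. $\rho\in(0,1)$. For $s\in\mathbb{R}$, $a,b\in[0,1]$: $F_s(a)=f(a)-sa$, $\Phi_s(a,b)=\operatorname{sgn}(a-b)(F_s(a)-F_s(b))$, $\Phi:=\Phi_0$. $\Omega=\mathbb{R}\times(0,\infty)$, $\overline\Omega=\mathbb{R}\times[0,\infty)$, $\Gamma=\{(y(t),t):t\ge0\}$. The subscript "loc" means bounded on $(0,T)$ for every $T>0$. Single trajectory problem. $\partial_t\rho+\partial_xf(\rho)=0$ in $\Omega$, $\rho(\cdot,0)=\rho_o$, $(f(\rho)-\dot y(t)\rho)|_{x=y(t)}\le q(t)$ for $t>0$. (Q): for a.e. $t>0$, $q(t)\in[0,\max F_{\dot y(t)})$ if $\dot y(t)\ge0$ and $q(t)\in[-\dot y(t),\max F_{\dot y(t)})$ if $\dot y(t)<0$. Germ. For $s\ge0$, $q\in[0,\max F_s)$, or $s\le0$, $q\in[-s,\max F_s)$, let $\widehat\rho_s(q)>\check\rho_s(q)$ be the two solutions in $[0,1]$ of $F_s(\rho)=q$, and $$\mathcal{G}_s(q)=\{(\widehat\rho_s(q),\check\rho_s(q))\}\cup\{(\kappa,\kappa):F_s(\kappa)\le q\}\cup\{(k_l,k_r):k_l<k_r,\ F_s(k_l)=F_s(k_r)\le q\}\subset[0,1]^2.$$ Definition. $\rho\in L^\infty(\Omega,[0,1])$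 is a $\mathcal{G}_{\dot y}(q)$-entropy solution if: (i) for all $\varphi\in C_c^\infty(\overline\Omega\setminus\Gamma,[0,\infty))$ and $\kappa\in[0,1]$, $$\int_0^\infty\!\!\int_{\mathbb{R}}(|\rho-\kappa|\partial_t\varphi+\Phi(\rho,\kappa)\partial_x\varphi)\,dx\,dt+\int_{\mathbb{R}}|\rho_o(x)-\kappa|\varphi(x,0)\,dx\ge0;$$ (ii) for a.e. $t>0$, $(\rho(y(t)-,t),\rho(y(t)+,t))\in\mathcal{G}_{\dot y(t)}(q(t))$, where $\rho(y(t)\pm,t)$ are the one-sided strong ($L^1_{loc}$) traces of $\rho$ along $\Gamma$. It is a standing assumption that functions satisfying (i) admit such traces. $\rho(T)$ denotes $\rho(\cdot,T)$, for the representative of $\rho$ in $C([0,\infty);L^1_{loc}(\mathbb{R}))$. *)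

theory Defs
  imports "HOL-Analysis.Analysis"
begin

text \<open>Points of the \<open>x\<close>-\<open>t\<close>-plane are pairs \<^term>\<open>(x, t) :: real \<times> real\<close>; \<open>L\<^sup>\<infinity>\<close> classes are
  represented by Lebesgue measurable functions.\<close>

subsection \<open>Function spaces\<close>

primrec Ck :: "nat \<Rightarrow> ('a::euclidean_space \<Rightarrow> real) \<Rightarrow> bool" where
  "Ck 0 g \<longleftrightarrow> continuous_on UNIV g"
| "Ck (Suc k) g \<longleftrightarrow>
     (\<exists>D. (\<forall>z. (g has_derivative (\<lambda>h. D z \<bullet> h)) (at z)) \<and> (\<forall>i\<in>Basis. Ck k (\<lambda>z. D z \<bullet> i)))"

text \<open>Only the restriction of \<open>\<phi>\<close> to \<open>S\<close> matters: \<open>Cc_infty S\<close> describes the elements of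
  \<open>C\<^sub>c\<^sup>\<infinity>(S)\<close> as restrictions to \<open>S\<close> of functions that are smooth on the whole space. For the sets
  used below (relatively open in a closed half-space, so that \<open>S\<close> may contain boundary points)
  this agrees with smoothness up to the boundary, by Seeley's extension theorem.\<close>

definition Cc_infty :: "'a::euclidean_space set \<Rightarrow> ('a \<Rightarrow> real) set" where
  "Cc_infty S = {\<phi>. (\<forall>k. Ck k \<phi>) \<and> (\<exists>K. compact K \<and> K \<subseteq> S \<and> (\<forall>z\<in>S - K. \<phi> z = 0))}"

definition Linf01 :: "'a::euclidean_space set \<Rightarrow> ('a \<Rightarrow> real) \<Rightarrow> bool" where
  "Linf01 S u \<longleftrightarrow> u \<in> borel_measurable (lebesgue_on S) \<and> (AE z in lebesgue_on S. u z \<in> {0..1})"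

text \<open>The space \<open>L\<^sup>\<infinity>\<^sub>l\<^sub>o\<^sub>c((0,\<infinity>))\<close>, where ``loc'' means bounded on \<open>(0,T)\<close> for every \<open>T > 0\<close>; so a
  bound is required up to time \<open>0\<close>. Likewise for \<open>W\<^sup>1\<^sup>,\<^sup>\<infinity>\<^sub>l\<^sub>o\<^sub>c((0,\<infinity>))\<close>.\<close>

definition Linf_loc :: "(real \<Rightarrow> real) \<Rightarrow> bool" where
  "Linf_loc g \<longleftrightarrow> g \<in> borel_measurable (lebesgue_on {0<..}) \<and>
     (\<forall>T>0. \<exists>C. AE t in lebesgue_on {0<..<T}. \<bar>g t\<bar> \<le> C)"

text \<open>\<open>dy\<close> is the weak derivative of \<open>y\<close>, and \<open>y\<close> is the continuous representative, extended
  to \<open>t = 0\<close> by continuity.\<close>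

definition W1inf_loc :: "(real \<Rightarrow> real) \<Rightarrow> (real \<Rightarrow> real) \<Rightarrow> bool" where
  "W1inf_loc y dy \<longleftrightarrow> continuous_on {0..} y \<and> Linf_loc y \<and> Linf_loc dy \<and>
     (\<forall>\<psi> \<in> Cc_infty {0<..}.
        (LINT t:{0<..}|lebesgue. y t * deriv \<psi> t) = - (LINT t:{0<..}|lebesgue. dy t * \<psi> t))"

subsection \<open>Flux, constraint and germ\<close>

definition admissible_flux :: "(real \<Rightarrow> real) \<Rightarrow> bool" where
  "admissible_flux f \<longleftrightarrow>
     (\<exists>f1 f2. (\<forall>u\<in>{0..1}. (f has_real_derivative f1 u) (at u within {0..1})) \<and>
              (\<forall>u\<in>{0..1}. (f1 has_real_derivative f2 u) (at u within {0..1})) \<and>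
              continuous_on {0..1} f2) \<and>
     (\<forall>u\<in>{0..1}. 0 \<le> f u) \<and> concave_on {0..1} f \<and> f 0 = 0 \<and> f 1 = 0 \<and>
     (\<exists>!b. b \<in> {0<..<1} \<and> (AE u in lebesgue_on {0<..<1}. deriv f u * (b - u) > 0))"

definition F :: "(real \<Rightarrow> real) \<Rightarrow> real \<Rightarrow> real \<Rightarrow> real" where
  "F f s a = f a - s * a"

definition Phi :: "(real \<Rightarrow> real) \<Rightarrow> real \<Rightarrow> real \<Rightarrow> real \<Rightarrow> real" where
  "Phi f s a b = sgn (a - b) * (F f s a - F f s b)"

text \<open>For an admissible flux the supremum is attained.\<close>

definition maxF :: "(real \<Rightarrow> real) \<Rightarrow> real \<Rightarrow> real" where
  "maxF f s = (SUP a\<in>{0..1}. F f s a)"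

definition cond_Q :: "(real \<Rightarrow> real) \<Rightarrow> (real \<Rightarrow> real) \<Rightarrow> (real \<Rightarrow> real) \<Rightarrow> bool" where
  "cond_Q f dy q \<longleftrightarrow> (AE t in lebesgue_on {0<..}.
     (dy t \<ge> 0 \<longrightarrow> q t \<in> {0..<maxF f (dy t)}) \<and>
     (dy t < 0 \<longrightarrow> q t \<in> {- dy t..<maxF f (dy t)}))"

text \<open>In the first set, \<open>a > b\<close> are the two solutions in \<open>[0,1]\<close> of \<open>F\<^sub>s = q\<close>; it is a singleton
  whenever \<open>s\<close> and \<open>q\<close> are as in \<^const>\<open>cond_Q\<close>.\<close>

definition germ :: "(real \<Rightarrow> real) \<Rightarrow> real \<Rightarrow> real \<Rightarrow> (real \<times> real) set" where
  "germ f s q =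
     {(a, b). a > b \<and> {u\<in>{0..1}. F f s u = q} = {a, b}} \<union>
     {(k, k) | k. k \<in> {0..1} \<and> F f s k \<le> q} \<union>
     {(kl, kr). kl \<in> {0..1} \<and> kr \<in> {0..1} \<and> kl < kr \<and> F f s kl = F f s kr \<and> F f s kr \<le> q}"

subsection \<open>Entropy solutions\<close>

definition Om :: "(real \<times> real) set" where
  "Om = UNIV \<times> {0<..}"

definition Om_bar :: "(real \<times> real) set" where
  "Om_bar = UNIV \<times> {0..}"

definition Gam :: "(real \<Rightarrow> real) \<Rightarrow> (real \<times> real) set" where
  "Gam y = {(y t, t) | t. t \<ge> 0}"

definition dx :: "(real \<times> real \<Rightarrow> real) \<Rightarrow> real \<times> real \<Rightarrow> real" where
  "dx \<phi> = (\<lambda>(x, t). deriv (\<lambda>x'. \<phi> (x', t)) x)"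

definition dt :: "(real \<times> real \<Rightarrow> real) \<Rightarrow> real \<times> real \<Rightarrow> real" where
  "dt \<phi> = (\<lambda>(x, t). deriv (\<lambda>t'. \<phi> (x, t')) t)"

definition entropy_ineq ::
  "(real \<Rightarrow> real) \<Rightarrow> (real \<Rightarrow> real) \<Rightarrow> (real \<Rightarrow> real) \<Rightarrow> (real \<times> real \<Rightarrow> real) \<Rightarrow> bool" where
  "entropy_ineq f y \<rho>\<^sub>o \<rho> \<longleftrightarrow>
     (\<forall>\<phi> \<in> Cc_infty (Om_bar - Gam y). \<forall>\<kappa>\<in>{0..1}.
        (\<forall>z \<in> Om_bar - Gam y. 0 \<le> \<phi> z) \<longrightarrow>
        (LINT z:Om|lebesgue. \<bar>\<rho> z - \<kappa>\<bar> * dt \<phi> z + Phi f 0 (\<rho> z) \<kappa> * dx \<phi> z)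
          + (LINT x|lebesgue. \<bar>\<rho>\<^sub>o x - \<kappa>\<bar> * \<phi> (x, 0)) \<ge> 0)"

text \<open>Strong one-sided traces along \<open>x = y(t)\<close>, in the averaged \<open>L\<^sup>1\<^sub>l\<^sub>o\<^sub>c\<close> sense (implied by the
  existence of an essential one-sided limit in \<open>L\<^sup>1\<^sub>l\<^sub>o\<^sub>c\<close>). Such traces are unique up to null sets.\<close>

definition left_trace :: "(real \<Rightarrow> real) \<Rightarrow> (real \<times> real \<Rightarrow> real) \<Rightarrow> (real \<Rightarrow> real) \<Rightarrow> bool" where
  "left_trace y \<rho> \<gamma> \<longleftrightarrow> Linf_loc \<gamma> \<and>
     (\<forall>T>0. ((\<lambda>h. (LINT z:{(x, t). 0 < t \<and> t < T \<and> y t - h < x \<and> x < y t}|lebesgue.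
                      \<bar>\<rho> z - \<gamma> (snd z)\<bar>) / h) \<longlongrightarrow> 0) (at_right 0))"

definition right_trace :: "(real \<Rightarrow> real) \<Rightarrow> (real \<times> real \<Rightarrow> real) \<Rightarrow> (real \<Rightarrow> real) \<Rightarrow> bool" where
  "right_trace y \<rho> \<gamma> \<longleftrightarrow> Linf_loc \<gamma> \<and>
     (\<forall>T>0. ((\<lambda>h. (LINT z:{(x, t). 0 < t \<and> t < T \<and> y t < x \<and> x < y t + h}|lebesgue.
                      \<bar>\<rho> z - \<gamma> (snd z)\<bar>) / h) \<longlongrightarrow> 0) (at_right 0))"

text \<open>Existence of the traces along \<open>\<Gamma>\<close> is built into the notion of solution.\<close>

definition germ_entropy_solution ::
  "(real \<Rightarrow> real) \<Rightarrow> (real \<Rightarrow> real) \<Rightarrow> (real \<Rightarrow> real) \<Rightarrow> (real \<Rightarrow> real) \<Rightarrow> (real \<Rightarrow> real) \<Rightarrow>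
   (real \<times> real \<Rightarrow> real) \<Rightarrow> bool" where
  "germ_entropy_solution f y dy q \<rho>\<^sub>o \<rho> \<longleftrightarrow>
     Linf01 Om \<rho> \<and> entropy_ineq f y \<rho>\<^sub>o \<rho> \<and>
     (\<exists>\<gamma>l \<gamma>r. left_trace y \<rho> \<gamma>l \<and> right_trace y \<rho> \<gamma>r \<and>
        (AE t in lebesgue_on {0<..}. (\<gamma>l t, \<gamma>r t) \<in> germ f (dy t) (q t)))"

text \<open>\<open>R\<close>, a function of time with values in \<open>L\<^sup>1\<^sub>l\<^sub>o\<^sub>c(\<real>)\<close>, is the representative of \<open>\<rho>\<close> in
  \<open>C([0,\<infinity>); L\<^sup>1\<^sub>l\<^sub>o\<^sub>c(\<real>))\<close>.\<close>

definition time_continuous_rep ::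
  "(real \<times> real \<Rightarrow> real) \<Rightarrow> (real \<Rightarrow> real \<Rightarrow> real) \<Rightarrow> bool" where
  "time_continuous_rep \<rho> R \<longleftrightarrow>
     (\<forall>t\<ge>0. \<forall>M>0. set_integrable lebesgue {-M..M} (R t)) \<and>
     (\<forall>t\<ge>0. \<forall>M>0. ((\<lambda>s. LINT x:{-M..M}|lebesgue. \<bar>R s x - R t x\<bar>) \<longlongrightarrow> 0) (at t within {0..})) \<and>
     (AE t in lebesgue_on {0<..}. AE x in lebesgue. R t x = \<rho> (x, t))"

end

theory Submission
  imports Defs
begin

text \<open>The contraction follows from Kruzkov's doubling of variables away from \<open>\<Gamma>\<close>, the strong
  traces along \<open>\<Gamma>\<close>, and the dissipativity of the germ.

  A solution is extended to \<open>t \<le> 0\<close> by its initial datum and the flux is multiplied by the indicator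
  \<open>a\<close> of \<open>{t > 0}\<close>; the entropy inequality then holds on the whole plane minus \<open>\<Gamma>\<close> and has no initial
  term. Doubling the variables with the test function \<open>\<psi>(z) \<delta>(z - z')\<close> leaves only the error caused by
  \<open>a(t) - a(t')\<close>, and this vanishes in the limit if \<open>\<delta>\<close> has width \<open>\<epsilon>\<close> in space and \<open>\<epsilon>\<^sup>2\<close> in time.

  Testing with a function that vanishes for \<open>\<bar>x - y(t)\<bar> \<le> h/2\<close> and letting \<open>h \<rightarrow> 0\<close> produces the
  interface term \<open>\<Phi>\<^sub>s(\<rho>(y+), \<sigma>(y+)) - \<Phi>\<^sub>s(\<rho>(y-), \<sigma>(y-))\<close> with \<open>s\<close> the speed of the trajectory. Both
  elements of a pair in the germ have the same flux, at most the constraint, with equality for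
  nonclassical pairs; together with the concavity of the flux this bounds the interface term by
  \<open>2 \<bar>q - r\<bar>\<close>. A cutoff supported in a backward light cone concludes.\<close>

subsection \<open>Smooth functions\<close>

text \<open>Two obstacles shape the proof. The first is the jump of \<open>indicator Om\<close> at t
  = 0: doubling leaves (a(z) - a(z')) times the x-derivative of the kernel. With width e in both
  variables that derivative has order 1/e^3, the kernel support has area e^2 and the slab where a(z)
  and a(z') differ has height e, so the error stays of order one. With widths e and e^2 these orders
  become 1/e^4, e^3 and e^2, and the error is O(e). The large time derivative of the kernel is
  harmless: a does not multiply the time term, and the two contributions cancel exactly. The second
  is that the trajectory is only Lipschitz on bounded time intervals, so a cutoff in x - y(t) is not
  a smooth test function. The cutoff is therefore built on mollified trajectories. For fixed h the
  mollification is removed first, by almost everywhere convergence of the velocities; only then does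
  h tend to 0. Finally, the resulting estimate controls weighted time averages of the L^1 distance.
  Continuity in time recovers the value at T, while uniqueness is read off the averages.\<close>

definition smooth :: "('a::euclidean_space \<Rightarrow> real) \<Rightarrow> bool" where
  "smooth g \<longleftrightarrow> (\<forall>k. Ck k g)"

lemma Ck_Suc_imp: "Ck (Suc k) g \<Longrightarrow> Ck k g"
proof (induction k arbitrary: g)
  case 0
  then show ?case
    by (auto intro!: continuous_at_imp_continuous_on intro: has_derivative_continuous)
next
  case (Suc k)
  then show ?case by (subst Ck.simps) (metis Ck.simps(2))
qed

lemma Ck_const: "Ck k (\<lambda>z::'a::euclidean_space. c)"
proof (induction k arbitrary: c)
  case (Suc k)
  then show ?case by (auto intro!: exI[of _ "\<lambda>_. 0"])
qed simp

lemma Ck_inner: "Ck k (\<lambda>z::'a::euclidean_space. v \<bullet> z)"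
proof (cases k)
  case 0
  then show ?thesis by (simp add: continuous_intros)
next
  case (Suc j)
  show ?thesis unfolding Suc Ck.simps
    by (rule exI[of _ "\<lambda>_. v"]) (auto intro!: derivative_eq_intros Ck_const)
qed

lemma Ck_add: "Ck k g \<Longrightarrow> Ck k h \<Longrightarrow> Ck k (\<lambda>z. g z + h z)"
proof (induction k arbitrary: g h)
  case 0
  then show ?case by (simp add: continuous_on_add)
next
  case (Suc k)
  obtain G where
    "\<And>z. (g has_derivative (\<lambda>h. G z \<bullet> h)) (at z)" "\<And>i. i \<in> Basis \<Longrightarrow> Ck k (\<lambda>z. G z \<bullet> i)"
    using Suc.prems(1) by auto
  moreover obtain H where
    "\<And>z. (h has_derivative (\<lambda>h. H z \<bullet> h)) (at z)" "\<And>i. i \<in> Basis \<Longrightarrow> Ck k (\<lambda>z. H z \<bullet> i)"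
    using Suc.prems(2) by auto
  ultimately show ?case
    by (auto intro!: exI[of _ "\<lambda>z. G z + H z"] derivative_eq_intros Suc.IH simp: inner_add_left)
qed

lemma Ck_mult: "Ck k g \<Longrightarrow> Ck k h \<Longrightarrow> Ck k (\<lambda>z. g z * h z)"
proof (induction k arbitrary: g h)
  case 0
  then show ?case by (simp add: continuous_on_mult)
next
  case (Suc k)
  obtain G where
    "\<And>z. (g has_derivative (\<lambda>h. G z \<bullet> h)) (at z)" "\<And>i. i \<in> Basis \<Longrightarrow> Ck k (\<lambda>z. G z \<bullet> i)"
    using Suc.prems(1) by auto
  moreover obtain H where
    "\<And>z. (h has_derivative (\<lambda>h. H z \<bullet> h)) (at z)" "\<And>i. i \<in> Basis \<Longrightarrow> Ck k (\<lambda>z. H z \<bullet> i)"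
    using Suc.prems(2) by auto
  moreover have "Ck k g" "Ck k h"
    using Suc.prems Ck_Suc_imp by blast+
  ultimately show ?case unfolding Ck.simps
    by (intro exI[of _ "\<lambda>z. g z *\<^sub>R H z + h z *\<^sub>R G z"])
       (auto intro!: derivative_eq_intros Ck_add Suc.IH simp: inner_add_left algebra_simps)
qed

lemma Ck_Suc_real:
  "Ck (Suc k) (g::real \<Rightarrow> real) \<longleftrightarrow> (\<exists>g'. (\<forall>x. (g has_real_derivative g' x) (at x)) \<and> Ck k g')"
  by (simp add: has_field_derivative_def)

lemma Ck_comp: "Ck k (g::real \<Rightarrow> real) \<Longrightarrow> Ck k u \<Longrightarrow> Ck k (\<lambda>z. g (u z))"
proof (induction k arbitrary: g u)
  case 0
  then show ?case by (auto intro: continuous_on_compose2)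
next
  case (Suc k)
  obtain g' where g': "\<And>x. (g has_real_derivative g' x) (at x)" "Ck k g'"
    using Suc.prems(1) unfolding Ck_Suc_real by auto
  obtain U where U: "\<And>z. (u has_derivative (\<lambda>h. U z \<bullet> h)) (at z)" "\<And>i. i \<in> Basis \<Longrightarrow> Ck k (\<lambda>z. U z \<bullet> i)"
    using Suc.prems(2) by auto
  have D: "\<forall>z. ((\<lambda>z. g (u z)) has_derivative (\<lambda>h. (g' (u z) *\<^sub>R U z) \<bullet> h)) (at z)"
    using has_derivative_compose[OF U(1) g'(1)[unfolded has_field_derivative_def]] by simp
  have C: "\<forall>i\<in>Basis. Ck k (\<lambda>z. (g' (u z) *\<^sub>R U z) \<bullet> i)"
    using Suc.IH[OF g'(2) Ck_Suc_imp[OF Suc.prems(2)]] U(2) by (simp add: Ck_mult)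
  show ?case unfolding Ck.simps
    by (rule exI[of _ "\<lambda>z. g' (u z) *\<^sub>R U z"], rule conjI[OF D C])
qed

lemma smooth_const: "smooth (\<lambda>z::'a::euclidean_space. c)"
  and smooth_inner: "smooth (\<lambda>z::'a::euclidean_space. v \<bullet> z)"
  and smooth_add: "smooth g \<Longrightarrow> smooth h \<Longrightarrow> smooth (\<lambda>z. g z + h z)"
  and smooth_mult: "smooth g \<Longrightarrow> smooth h \<Longrightarrow> smooth (\<lambda>z. g z * h z)"
  and smooth_comp: "smooth \<phi> \<Longrightarrow> smooth g \<Longrightarrow> smooth (\<lambda>z. \<phi> (g z))"
  by (auto simp: smooth_def Ck_const Ck_inner Ck_add Ck_mult Ck_comp)

lemma smooth_ident: "smooth (\<lambda>x::real. x)"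
  using smooth_inner[of "1::real"] by simp

lemma smooth_fst: "smooth (\<lambda>z::real \<times> real. fst z)"
  and smooth_snd: "smooth (\<lambda>z::real \<times> real. snd z)"
  using smooth_inner[of "(1,0)::real \<times> real"] smooth_inner[of "(0,1)::real \<times> real"]
  by (simp_all add: inner_prod_def)

lemma smooth_diff: "smooth g \<Longrightarrow> smooth h \<Longrightarrow> smooth (\<lambda>z. g z - h z)"
  using smooth_add[OF _ smooth_mult[OF smooth_const[of "-1"]], of g h] by simp

lemma smooth_divide_const: "smooth g \<Longrightarrow> smooth (\<lambda>z. g z / c)"
  using smooth_mult[OF _ smooth_const[of "inverse c"], of g] by (simp add: divide_inverse)

lemmas smooth_intros = smooth_const smooth_ident smooth_fst smooth_snd smooth_add smooth_diff
  smooth_mult smooth_divide_const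

lemma smooth_primitive:
  assumes "\<And>x. (g has_real_derivative g' x) (at x)" "smooth g'"
  shows "smooth g"
  unfolding smooth_def
proof
  fix k show "Ck k g"
  proof (rule Ck_Suc_imp)
    show "Ck (Suc k) g"
      unfolding Ck_Suc_real using assms unfolding smooth_def by blast
  qed
qed

lemma smooth_imp_continuous: "smooth g \<Longrightarrow> continuous_on UNIV g"
  using Ck.simps(1) unfolding smooth_def by blast

lemma smooth_derivative:
  assumes "smooth (g::real \<Rightarrow> real)"
  obtains g' where "\<And>x. (g has_real_derivative g' x) (at x)" "continuous_on UNIV g'"
  using assms Ck_Suc_real[of 0 g] unfolding smooth_def by (metis Ck.simps(1))

text \<open>\<open>dx\<close> and \<open>dt\<close> are built from \<open>deriv\<close>, which has a
  value even where no derivative exists. Identifying them with the components of the gradient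
  supplied by \<open>Ck\<close> makes them genuine and continuous derivatives.\<close>

lemma smooth_plane:
  assumes "smooth (\<phi>::real \<times> real \<Rightarrow> real)"
  shows "((\<lambda>x. \<phi> (x, t)) has_real_derivative dx \<phi> (x, t)) (at x)"
    and "((\<lambda>t. \<phi> (x, t)) has_real_derivative dt \<phi> (x, t)) (at t)"
    and "continuous_on UNIV (dx \<phi>)" and "continuous_on UNIV (dt \<phi>)"
proof -
  obtain D where D: "\<And>z. (\<phi> has_derivative (\<lambda>h. D z \<bullet> h)) (at z)"
    and C: "\<And>i. i \<in> Basis \<Longrightarrow> continuous_on UNIV (\<lambda>z. D z \<bullet> i)"
    using assms unfolding smooth_def using Ck.simps by metis
  have X: "((\<lambda>x. \<phi> (x, t)) has_real_derivative D (x, t) \<bullet> (1, 0)) (at x)" for x t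
  proof -
    have "((\<lambda>x. \<phi> (x, t)) has_derivative (\<lambda>h. D (x, t) \<bullet> (h, 0))) (at x)"
      by (rule has_derivative_compose[OF _ D]) (auto intro!: derivative_eq_intros)
    then show ?thesis by (simp add: has_field_derivative_def inner_prod_def)
  qed
  have T: "((\<lambda>t. \<phi> (x, t)) has_real_derivative D (x, t) \<bullet> (0, 1)) (at t)" for x t
  proof -
    have "((\<lambda>t. \<phi> (x, t)) has_derivative (\<lambda>h. D (x, t) \<bullet> (0, h))) (at t)"
      by (rule has_derivative_compose[OF _ D]) (auto intro!: derivative_eq_intros)
    then show ?thesis by (simp add: has_field_derivative_def inner_prod_def)
  qed
  have dx: "dx \<phi> = (\<lambda>z. D z \<bullet> (1, 0))" and dt: "dt \<phi> = (\<lambda>z. D z \<bullet> (0, 1))"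
    using DERIV_imp_deriv[OF X] DERIV_imp_deriv[OF T] by (auto simp: dx_def dt_def)
  show "((\<lambda>x. \<phi> (x, t)) has_real_derivative dx \<phi> (x, t)) (at x)"
    "((\<lambda>t. \<phi> (x, t)) has_real_derivative dt \<phi> (x, t)) (at t)"
    "continuous_on UNIV (dx \<phi>)" "continuous_on UNIV (dt \<phi>)"
    using X T C by (auto simp: dx dt Basis_prod_def)
qed

lemma dx_eqI: "(\<And>x t. ((\<lambda>x. \<phi> (x, t)) has_real_derivative g x t) (at x)) \<Longrightarrow> dx \<phi> (x, t) = g x t"
  and dt_eqI: "(\<And>x t. ((\<lambda>t. \<phi> (x, t)) has_real_derivative g x t) (at t)) \<Longrightarrow> dt \<phi> (x, t) = g x t"
  by (auto simp: dx_def dt_def intro!: DERIV_imp_deriv)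

section \<open>An explicit smooth bump function and a smooth step\<close>

lemma poly_exp_tendsto_0: "((\<lambda>u. poly p u * exp (- u)) \<longlongrightarrow> (0::real)) at_top"
proof -
  have "((\<lambda>u. \<Sum>i\<le>degree p. coeff p i * (u ^ i / exp u)) \<longlongrightarrow> (\<Sum>i\<le>degree p. coeff p i * 0)) at_top"
    by (intro tendsto_intros tendsto_power_div_exp_0)
  moreover have "(\<Sum>i\<le>degree p. coeff p i * (u ^ i / exp u)) = poly p u * exp (- u)" for u
    by (simp add: poly_altdef sum_distrib_right exp_minus divide_inverse mult.assoc)
  ultimately show ?thesis by simp
qed

text \<open>The polynomial is carried along because the class of functions p(1/t) exp(-1/t),
  extended by 0, is closed under differentiation: with w = 1/t the derivative is w^2 (p(w) - p'(w))
  exp(-w). A single induction over all p then gives every order of smoothness, the point 0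
  included.\<close>

definition flat :: "real poly \<Rightarrow> real \<Rightarrow> real" where
  "flat p t = (if t > 0 then poly p (1 / t) * exp (- (1 / t)) else 0)"

lemma flat_has_derivative: "(flat p has_real_derivative flat (monom 1 2 * (p - pderiv p)) t) (at t)"
proof (cases t "0::real" rule: linorder_cases)
  case less
  then have "(flat p has_real_derivative 0) (at t) \<longleftrightarrow> ((\<lambda>_. 0) has_real_derivative 0) (at t)"
    by (intro has_field_derivative_cong_eventually eventually_at_in_open[of "{..<0}", THEN eventually_mono])
       (auto simp: flat_def)
  with less show ?thesis by (simp add: flat_def)
next
  case greater
  have "eventually (\<lambda>s. flat p s = poly p (1 / s) * exp (- (1 / s))) (nhds t)"
    using greater by (intro eventually_nhds_in_open[of "{0<..}", THEN eventually_mono]) (auto simp: flat_def)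
  moreover have "((\<lambda>s. poly p (1 / s) * exp (- (1 / s))) has_real_derivative
      flat (monom 1 2 * (p - pderiv p)) t) (at t)"
    using greater
    by (auto intro!: derivative_eq_intros DERIV_chain2[OF poly_DERIV]
        simp: flat_def poly_monom field_simps power2_eq_square)
  ultimately show ?thesis
    by (subst DERIV_cong_ev[OF refl _ refl])
next
  case equal
  \<comment> \<open>The difference quotient of \<open>flat p\<close> at 0 is \<open>flat\<close> of
    the polynomial w p(w), so differentiability at 0 is the decay of a polynomial times exp(-w) as w
    tends to infinity.\<close>
  have "((\<lambda>h. flat (monom 1 1 * p) h) \<longlongrightarrow> 0) (at_right 0)"
  proof -
    have "((\<lambda>h::real. poly (monom 1 1 * p) (1 / h) * exp (- (1 / h))) \<longlongrightarrow> 0) (at_right 0)"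
      using filterlim_compose[OF poly_exp_tendsto_0 filterlim_inverse_at_top_right, of "monom 1 1 * p"]
      by (simp add: inverse_eq_divide)
    then show ?thesis
      by (rule Lim_transform_eventually) (auto simp: flat_def eventually_at_filter)
  qed
  moreover have "((\<lambda>h. flat (monom 1 1 * p) h) \<longlongrightarrow> 0) (at_left 0)"
    by (rule tendsto_eventually) (auto simp: flat_def eventually_at_filter)
  ultimately have "((\<lambda>h. flat (monom 1 1 * p) h) \<longlongrightarrow> 0) (at 0)"
    by (simp add: filterlim_split_at_real)
  then have "((\<lambda>h. (flat p (0 + h) - flat p 0) / h) \<longlongrightarrow> 0) (at 0)"
    by (rule Lim_transform_eventually) (auto simp: flat_def poly_monom eventually_at_filter)
  then show ?thesis
    using equal by (simp add: DERIV_def flat_def)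
qed

lemma smooth_flat: "smooth (flat p)"
proof -
  have "Ck k (flat p)" for k p
  proof (induction k arbitrary: p)
    case 0
    then show ?case
      by (auto intro!: continuous_at_imp_continuous_on DERIV_isCont[OF flat_has_derivative])
  next
    case (Suc k)
    then show ?case unfolding Ck_Suc_real using flat_has_derivative by blast
  qed
  then show ?thesis by (simp add: smooth_def)
qed

definition bump0 :: "real \<Rightarrow> real" where
  "bump0 x = flat 1 x * flat 1 (1 - x)"

text \<open>The bump has unit mass and lives on [0,1], not on a symmetric interval. Kernels built
  from it look in one direction only; a convolution of the trajectory at a time t > 0 samples times
  after t and never leaves the half-line where the trajectory is given.\<close>

definition bump :: "real \<Rightarrow> real" where
  "bump x = bump0 x / integral {0..1} bump0"

text \<open>A smooth Heaviside function, rising from 0 at 0 to 1 at 1. For negative x the interval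
  is empty and the value is 0, in accordance with the support of \<open>bump\<close>.\<close>

definition step :: "real \<Rightarrow> real" where
  "step x = integral {0..x} bump"

lemma smooth_bump0: "smooth bump0"
  unfolding bump0_def by (intro smooth_intros smooth_comp[OF smooth_flat] smooth_flat)

lemma bump0_integral_pos: "0 < integral {0..1} bump0"
proof -
  have "integral (cbox 0 1) bump0 \<noteq> 0"
  proof
    assume "integral (cbox 0 1) bump0 = 0"
    moreover have "continuous_on {0..1} bump0"
      using continuous_on_subset[OF smooth_imp_continuous[OF smooth_bump0]] by simp
    ultimately have "\<forall>x\<in>{0..1}. bump0 x = 0"
      using integral_eq_0_iff[of 0 1 bump0] by (simp add: bump0_def flat_def)
    from bspec[OF this, of "1/2"] show False by (simp add: bump0_def flat_def)
  qed
  moreover have "0 \<le> integral {0..1} bump0"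
  proof (rule integral_nonneg)
    show "bump0 integrable_on {0..1}"
      by (intro integrable_continuous_interval continuous_on_subset[OF smooth_imp_continuous[OF smooth_bump0]]) simp
  qed (simp add: bump0_def flat_def)
  ultimately show ?thesis by simp
qed

lemma smooth_bump: "smooth bump"
  unfolding bump_def by (intro smooth_intros smooth_bump0)

lemma bump_nonneg: "0 \<le> bump x"
  and bump_pos: "0 < x \<Longrightarrow> x < 1 \<Longrightarrow> 0 < bump x"
  and bump_eq_0: "x \<le> 0 \<or> 1 \<le> x \<Longrightarrow> bump x = 0"
  using bump0_integral_pos by (auto simp: bump_def bump0_def flat_def)

lemma step_eq_0: "x \<le> 0 \<Longrightarrow> step x = 0"
  by (cases "x = 0") (auto simp: step_def)

lemma bump_integrable: "bump integrable_on {a..b}"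
  by (intro integrable_continuous_interval continuous_on_subset[OF smooth_imp_continuous[OF smooth_bump]]) auto

text \<open>Moving the base point to the left puts x in the interior of the interval of integration,
  so that the fundamental theorem of calculus yields a two-sided derivative also for x \<le>
  0.\<close>

lemma step_eq: "a \<le> 0 \<Longrightarrow> a \<le> x \<Longrightarrow> step x = integral {a..x} bump"
proof (cases "0 \<le> x")
  case True
  assume "a \<le> 0" "a \<le> x"
  then have "integral {a..0} bump + integral {0..x} bump = integral {a..x} bump"
    using True by (intro Henstock_Kurzweil_Integration.integral_combine bump_integrable) auto
  moreover have "integral {a..0} bump = 0"
    using integral_cong[of "{a..0}" bump "\<lambda>_. 0"] by (simp add: bump_eq_0)
  ultimately show ?thesis by (simp add: step_def)
next
  case False
  then have "integral {a..x} bump = 0"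
    using integral_cong[of "{a..x}" bump "\<lambda>_. 0"] by (simp add: bump_eq_0)
  with False show ?thesis by (simp add: step_eq_0)
qed

lemma step_has_derivative: "(step has_real_derivative bump x) (at x)"
proof -
  define a where "a = min 0 x - 1"
  have "((\<lambda>u. integral {a..u} bump) has_real_derivative bump x) (at x within {a..x+1})"
    by (rule integral_has_real_derivative)
       (auto simp: a_def intro!: continuous_on_subset[OF smooth_imp_continuous[OF smooth_bump]])
  then have "((\<lambda>u. integral {a..u} bump) has_real_derivative bump x) (at x)"
    by (subst (asm) at_within_interior) (auto simp: a_def)
  moreover have "eventually (\<lambda>u. step u = integral {a..u} bump) (nhds x)"
    by (rule eventually_mono[OF eventually_nhds_in_open[of "{a<..}" x]]) (auto simp: a_def intro!: step_eq)
  ultimately show ?thesis by (subst DERIV_cong_ev[OF refl _ refl])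
qed

lemma smooth_step: "smooth step"
  by (rule smooth_primitive[OF step_has_derivative smooth_bump])

lemma step_mono: "x \<le> y \<Longrightarrow> step x \<le> step y"
  by (rule DERIV_nonneg_imp_nondecreasing[of x y step]) (auto intro: step_has_derivative bump_nonneg)

lemma step_eq_1: "1 \<le> x \<Longrightarrow> step x = 1"
proof -
  assume x: "1 \<le> x"
  have "step 1 = 1"
    using bump0_integral_pos by (simp add: step_def bump_def[abs_def])
  moreover have "step x = step 1"
  proof (cases "x = 1")
    case False
    with x have "1 < x" by simp
    then show ?thesis
    proof (rule DERIV_isconst_end)
      show "continuous_on {1..x} step"
        using continuous_on_subset[OF smooth_imp_continuous[OF smooth_step]] by simp
      show "(step has_real_derivative 0) (at y)" if "1 < y" for y
        using step_has_derivative[of y] that by (simp add: bump_eq_0)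
    qed
  qed simp
  ultimately show ?thesis by simp
qed

lemma step_bounds: "0 \<le> step x" "step x \<le> 1"
  using step_mono[of "min 0 x" x] step_mono[of x "max 1 x"] by (auto simp: step_eq_0 step_eq_1)

subsection \<open>Integration lemmas\<close>

lemma integrable_bounded_support:
  fixes f :: "'a::euclidean_space \<Rightarrow> real"
  assumes [measurable]: "f \<in> borel_measurable borel" and K: "bounded K"
    and bd: "\<And>z. z \<in> K \<Longrightarrow> \<bar>f z\<bar> \<le> B" and 0: "\<And>z. z \<notin> K \<Longrightarrow> f z = 0"
  shows "integrable lborel f"
proof -
  obtain a where a: "K \<subseteq> cbox (-a) a"
    using bounded_subset_cbox_symmetric[OF K] by auto
  show ?thesis
  proof (rule integrableI_bounded_set[where A="cbox (-a) a" and B="max B 0"])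
    show "AE x in lborel. x \<in> cbox (- a) a \<longrightarrow> norm (f x) \<le> max B 0"
      using bd 0 by (intro AE_I2) (metis abs_zero max.coboundedI1 max.coboundedI2 order_refl real_norm_def)
    show "AE x in lborel. x \<notin> cbox (- a) a \<longrightarrow> f x = 0"
      using a 0 by (intro AE_I2) auto
  qed (simp_all add: emeasure_lborel_cbox_eq)
qed

lemma integral_bounded_support_le:
  fixes f :: "'a::euclidean_space \<Rightarrow> real"
  assumes "K \<in> sets borel" "bounded K" "0 \<le> B"
    and bd: "\<And>z. z \<in> K \<Longrightarrow> \<bar>f z\<bar> \<le> B" and 0: "\<And>z. z \<notin> K \<Longrightarrow> f z = 0"
  shows "\<bar>\<integral>z. f z \<partial>lborel\<bar> \<le> B * measure lborel K"
proof (cases "integrable lborel f")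
  case True
  have "\<bar>\<integral>z. f z \<partial>lborel\<bar> \<le> (\<integral>z. \<bar>f z\<bar> \<partial>lborel)"
    by (rule integral_abs_bound)
  also have "\<dots> \<le> (\<integral>z. B * indicator K z \<partial>lborel)"
  proof (rule integral_mono)
    show "integrable lborel (\<lambda>z. B * indicator K z)"
      by (rule integrable_bounded_support[OF _ assms(2), of _ B]) (use assms in auto)
    show "\<bar>f z\<bar> \<le> B * indicator K z" for z
      using bd[of z] 0[of z] by (cases "z \<in> K") auto
  qed (use True in auto)
  also have "\<dots> = B * measure lborel K" by simp
  finally show ?thesis .
next
  case False
  \<comment> \<open>The Bochner integral of a non-integrable function is 0 by convention, and the
    bound is nonnegative.\<close>
  then show ?thesis using \<open>0 \<le> B\<close> by (simp add: not_integrable_integral_eq)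
qed

lemma lborel_integral_translation:
  fixes f :: "'a::euclidean_space \<Rightarrow> real"
  assumes [measurable]: "f \<in> borel_measurable borel"
  shows "(\<integral>z. f (z - c) \<partial>lborel) = (\<integral>z. f z \<partial>lborel)"
proof -
  have "(\<integral>z. f z \<partial>lborel) = (\<integral>z. f z \<partial>distr lborel borel ((+) (-c)))"
    by (subst lborel_distr_plus) simp
  also have "\<dots> = (\<integral>z. f (z - c) \<partial>lborel)"
    by (subst integral_distr) simp_all
  finally show ?thesis by simp
qed

text \<open>Continuity of translations in L^1, localised by the weight \<open>G\<close>.
  Measurability provides continuous functions converging almost everywhere to \<open>v\<close>;
  truncated to the bound of \<open>v\<close>, they converge in L^1 on a ball by dominated
  convergence, and for a continuous function the claim is uniform continuity on a larger
  ball.\<close>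

lemma integral_translation_tendsto:
  fixes v G :: "'a::euclidean_space \<Rightarrow> real"
  assumes v[measurable]: "v \<in> borel_measurable borel" and vB: "\<And>z. \<bar>v z\<bar> \<le> B"
    and G[measurable]: "G \<in> borel_measurable borel" and GC: "\<And>z. \<bar>G z\<bar> \<le> C"
    and K: "bounded K" "\<And>z. z \<notin> K \<Longrightarrow> G z = 0"
  shows "((\<lambda>w. \<integral>z. \<bar>v z - v (z - w)\<bar> * \<bar>G z\<bar> \<partial>lborel) \<longlongrightarrow> 0) (at 0)"
proof -
  have B0: "0 \<le> B" "0 \<le> C" using vB[of 0] GC[of 0] by auto
  obtain a where a: "K \<subseteq> ball 0 a" "0 < a" using bounded_subset_ballD[OF K(1)] by auto
  \<comment> \<open>The margin 1 keeps z - w inside the ball when z lies in \<open>K\<close> and the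
    shift is shorter than 1.\<close>
  define K1 where "K1 = ball (0::'a) (a + 1)"
  have K1[measurable]: "K1 \<in> sets borel" "bounded K1" by (auto simp: K1_def)
  have "v measurable_on UNIV"
    by (rule lebesgue_measurable_imp_measurable_on) (auto intro: measurable_completion)
  then obtain N g0 where N: "negligible N" and g0: "\<And>n. continuous_on UNIV (g0 n)"
    and lim: "\<And>x. x \<notin> N \<Longrightarrow> (\<lambda>n. g0 n x) \<longlonglongrightarrow> v x"
    unfolding measurable_on_def by auto
  define g where "g n z = max (-B) (min B (g0 n z))" for n z
  have gc: "continuous_on UNIV (g n)" for n
    unfolding g_def by (intro continuous_intros g0)
  have gm[measurable]: "g n \<in> borel_measurable borel" for n
    by (rule borel_measurable_continuous_onI[OF gc])
  have gB: "\<bar>g n z\<bar> \<le> B" for n z using B0 by (auto simp: g_def)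
  have gl: "(\<lambda>n. g n x) \<longlonglongrightarrow> v x" if "x \<notin> N" for x
  proof -
    have "(\<lambda>n. g n x) \<longlonglongrightarrow> max (-B) (min B (v x))"
      unfolding g_def by (intro tendsto_intros lim that)
    then show ?thesis using vB[of x] by (simp add: abs_le_iff)
  qed
  have AEN: "AE x in lborel. x \<notin> N"
    using N AE_not_in[of N lebesgue] by (simp add: negligible_iff_null_sets AE_completion_iff)
  have bd2: "\<bar>g n z - v z\<bar> \<le> 2 * B" for n z
    using gB[of n z] vB[of z] by linarith
  have int1: "integrable lborel (\<lambda>z. indicator K1 z * \<bar>g n z - v z\<bar>)" for n
    by (rule integrable_bounded_support[OF _ K1(2), of _ "2*B"]) (auto simp: bd2)
  have L1: "(\<lambda>n. \<integral>z. indicator K1 z * \<bar>g n z - v z\<bar> \<partial>lborel) \<longlonglongrightarrow> (\<integral>z. indicator K1 z * 0 \<partial>lborel)"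
  proof (rule integral_dominated_convergence[where w="\<lambda>z. indicator K1 z * (2 * B)"])
    show "integrable lborel (\<lambda>z. indicator K1 z * (2 * B))"
      by (rule integrable_bounded_support[OF _ K1(2), of _ "2*B"]) (auto simp: B0)
    show "AE x in lborel. (\<lambda>i. indicator K1 x * \<bar>g i x - v x\<bar>) \<longlonglongrightarrow> indicator K1 x * 0"
      using AEN
    proof eventually_elim
      case (elim x)
      then have "(\<lambda>i. indicator K1 x * \<bar>g i x - v x\<bar>) \<longlonglongrightarrow> indicator K1 x * \<bar>v x - v x\<bar>"
        by (intro tendsto_intros gl)
      then show ?case by simp
    qed
    show "AE x in lborel. norm (indicator K1 x * \<bar>g i x - v x\<bar>) \<le> indicator K1 x * (2 * B)" for i
      using bd2 by (auto simp: indicator_def)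
  qed auto
  show ?thesis
  proof (rule LIM_I)
    fix e :: real assume e: "0 < e"
    \<comment> \<open>The two L^1 errors of size \<open>e1\<close> contribute at most 2e/3 and the
      modulus of continuity \<open>e2\<close> at most e/6. The summands 1 avoid a division by zero
      when \<open>C\<close> or the measure of the ball vanishes.\<close>
    define e1 where "e1 = e / (3 * (C + 1))"
    have e1: "0 < e1" using e B0 by (simp add: e1_def)
    obtain n where n: "(\<integral>z. indicator K1 z * \<bar>g n z - v z\<bar> \<partial>lborel) < e1"
      using order_tendstoD(2)[OF L1, of e1] e1 by (auto simp: eventually_sequentially)
    define m where "m = measure lborel K1"
    define e2 where "e2 = e / (6 * (C + 1) * (m + 1))"
    have e2: "0 < e2" unfolding e2_def m_def
      using e B0 by (intro divide_pos_pos mult_pos_pos add_nonneg_pos measure_nonneg) auto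
    have "uniformly_continuous_on (cball 0 (a + 2)) (g n)"
      by (intro compact_uniformly_continuous continuous_on_subset[OF gc]) auto
    then obtain d where d: "0 < d"
      "\<And>x x'. x \<in> cball 0 (a+2) \<Longrightarrow> x' \<in> cball 0 (a+2) \<Longrightarrow> dist x' x < d \<Longrightarrow> dist (g n x') (g n x) < e2"
      using e2 unfolding uniformly_continuous_on_def by metis
    show "\<exists>s>0. \<forall>w. w \<noteq> 0 \<and> norm (w - 0) < s \<longrightarrow>
        norm ((\<integral>z. \<bar>v z - v (z - w)\<bar> * \<bar>G z\<bar> \<partial>lborel) - 0) < e"
    proof (intro exI[of _ "min d 1"] conjI allI impI)
      fix w :: 'a assume "w \<noteq> 0 \<and> norm (w - 0) < min d 1"
      then have w: "norm w < d" "norm w < 1" by auto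
      define h where "h z = indicator K1 z * \<bar>g n z - v z\<bar>" for z
      have [measurable]: "h \<in> borel_measurable borel" by (simp add: h_def[abs_def])
      have ih: "integrable lborel h" using int1 by (simp add: h_def[abs_def])
      have ihw: "integrable lborel (\<lambda>z. h (z - w))"
      proof (rule integrable_bounded_support[of _ "ball 0 (a+2)" "2*B"])
        show "\<bar>h (z - w)\<bar> \<le> 2 * B" for z using bd2 B0 by (simp add: h_def indicator_def)
        show "h (z - w) = 0" if "z \<notin> ball 0 (a+2)" for z
          using norm_triangle_ineq2[of z w] w that by (simp add: h_def K1_def)
      qed auto
      have key: "\<bar>v z - v (z - w)\<bar> * \<bar>G z\<bar> \<le> C * (h z + e2 * indicator K1 z + h (z - w))" for z
      proof (cases "z \<in> K")
        case True
        then have z: "norm z < a" using a by auto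
        have zw: "norm (z - w) < a + 1" using norm_triangle_ineq4[of z w] w z by simp
        have "\<bar>g n z - g n (z - w)\<bar> < e2"
          using d(2)[of "z - w" z] z zw w by (simp add: dist_norm norm_minus_commute[of w z])
        then have "\<bar>v z - v (z - w)\<bar> \<le> h z + e2 + h (z - w)"
          using z zw by (auto simp: h_def K1_def)
        then have "\<bar>v z - v (z - w)\<bar> * \<bar>G z\<bar> \<le> (h z + e2 + h (z - w)) * C"
          using GC by (intro mult_mono) auto
        then show ?thesis using z by (simp add: K1_def mult.commute)
      next
        case False
        then show ?thesis using K(2) B0 e2 by (auto simp: h_def)
      qed
      have iK1: "integrable lborel (indicator K1 :: 'a \<Rightarrow> real)"
        by (rule integrable_bounded_support[OF _ K1(2), of _ 1]) auto
      have "(\<integral>z. \<bar>v z - v (z - w)\<bar> * \<bar>G z\<bar> \<partial>lborel)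
          \<le> (\<integral>z. C * (h z + e2 * indicator K1 z + h (z - w)) \<partial>lborel)"
      proof (rule integral_mono)
        show "integrable lborel (\<lambda>z. \<bar>v z - v (z - w)\<bar> * \<bar>G z\<bar>)"
        proof (rule integrable_bounded_support[OF _ K(1), of _ "2 * B * C"])
          show "\<bar>\<bar>v z - v (z - w)\<bar> * \<bar>G z\<bar>\<bar> \<le> 2 * B * C" for z
            unfolding abs_mult abs_abs using vB[of z] vB[of "z - w"] GC B0 by (intro mult_mono) auto
        qed (auto simp: K)
      qed (auto intro!: integrable_add integrable_mult_right ih ihw iK1 key)
      also have "\<dots> = C * ((\<integral>z. h z \<partial>lborel) + e2 * m + (\<integral>z. h (z - w) \<partial>lborel))"
        using ih ihw iK1 by (simp add: m_def)
      also have "\<dots> = C * (2 * (\<integral>z. h z \<partial>lborel) + e2 * m)"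
        by (simp add: lborel_integral_translation)
      also have "\<dots> \<le> C * (2 * e1 + e2 * m)"
        using n B0 by (intro mult_left_mono) (auto simp: h_def[abs_def])
      also have "\<dots> < e"
      proof -
        have m: "0 \<le> m" by (simp add: m_def)
        have "C * (2 * e1) \<le> (C + 1) * (2 * e1)" using e1 by simp
        also have "\<dots> = 2 * e / 3" using B0 by (simp add: e1_def field_simps)
        finally have 1: "C * (2 * e1) \<le> 2 * e / 3" .
        have "C * (e2 * m) \<le> (C + 1) * (e2 * (m + 1))"
          using e2 B0 m by (intro mult_mono) auto
        also have "\<dots> = ((C + 1) / (C + 1)) * ((m + 1) / (m + 1)) * e / 6"
          by (simp add: e2_def ac_simps)
        also have "\<dots> = e / 6" using B0 m by (simp del: distrib_right_numeral)
        finally show ?thesis using 1 e by (simp add: distrib_left)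
      qed
      finally show "norm ((\<integral>z. \<bar>v z - v (z - w)\<bar> * \<bar>G z\<bar> \<partial>lborel) - 0) < e"
        by (simp add: integral_nonneg_AE)
    qed (use d in auto)
  qed
qed

section \<open>Lebesgue measurable data and their Borel representatives\<close>

lemma ex_borel_representative:
  fixes u :: "'a::euclidean_space \<Rightarrow> real"
  assumes "u \<in> borel_measurable (lebesgue_on S)" "S \<in> sets lebesgue"
  obtains u0 where "u0 \<in> borel_measurable borel" "AE x in lborel. x \<in> S \<longrightarrow> u x = u0 x"
proof -
  have "(\<lambda>x. if x \<in> S then u x else 0) \<in> borel_measurable (completion lborel)"
    using borel_measurable_if_I[OF assms] .
  from completion_ex_borel_measurable_real[OF this]
  obtain u0 where "u0 \<in> borel_measurable lborel" "AE x in lborel. (if x \<in> S then u x else 0) = u0 x"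
    by blast
  then show thesis
    by (intro that[of u0]) (auto elim!: eventually_mono)
qed

lemma AE_lebesgue_on_iff:
  "S \<in> sets lebesgue \<Longrightarrow> (AE x in lebesgue_on S. P x) \<longleftrightarrow> (AE x in lborel. x \<in> S \<longrightarrow> P x)"
  by (simp add: AE_restrict_space_iff AE_completion_iff)

text \<open>Fubini and translation are applied to Borel functions on \<open>lborel\<close>, whereas
  the definitions integrate against \<open>lebesgue\<close>. Agreement almost everywhere with a
  Borel function makes \<open>f\<close> measurable for the completed measure, which allows the
  passage.\<close>

lemma lebesgue_integral_eq_lborel:
  fixes f g :: "'a::euclidean_space \<Rightarrow> real"
  assumes "g \<in> borel_measurable borel" "AE x in lborel. f x = g x"
  shows "integral\<^sup>L lebesgue f = (\<integral>x. g x \<partial>lborel)"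
proof -
  have g: "g \<in> borel_measurable lebesgue" using assms(1) by (auto intro: measurable_completion)
  have ae: "AE x in lebesgue. g x = f x" using assms(2) by (auto simp: AE_completion_iff eq_commute)
  have "integral\<^sup>L lebesgue f = integral\<^sup>L lebesgue g"
    using borel_measurable_AE[OF g ae] g ae by (intro integral_cong_AE) auto
  then show ?thesis using assms(1) by (simp add: integral_completion)
qed

lemma AE_pair_swap:
  fixes P :: "real \<times> real \<Rightarrow> bool"
  assumes "Measurable.pred borel P" "AE t in lborel. AE x in lborel. P (x, t)"
  shows "AE z in lborel. P z"
proof -
  have m: "{z \<in> space (lborel \<Otimes>\<^sub>M lborel). P z} \<in> sets (lborel \<Otimes>\<^sub>M lborel)"
    using assms(1) unfolding lborel_prod by (simp add: pred_def)
  have "AE x in lborel. AE t in lborel. P (x, t)"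
    using assms(2) m by (subst lborel_pair.AE_commute) auto
  then have "AE z in lborel \<Otimes>\<^sub>M lborel. P z"
    using m by (intro lborel_pair.AE_pair_measure) auto
  then show ?thesis by (simp only: lborel_prod)
qed

lemma AE_snd_lborel:
  assumes "AE x in lborel. P x"
  shows "AE z::real \<times> real in lborel. P (snd z)"
proof -
  obtain N where N: "{x. \<not> P x} \<subseteq> N" "N \<in> null_sets lborel"
    using assms by (auto elim!: AE_E simp: null_sets_def)
  have [measurable]: "N \<in> sets borel" using N(2) by auto
  have "AE x in lborel. x \<notin> N" using N(2) by (rule AE_not_in)
  then have "AE t in lborel. AE x::real in lborel. t \<notin> N"
    by auto
  moreover have "Measurable.pred borel (\<lambda>z::real \<times> real. snd z \<notin> N)"
    unfolding borel_prod[symmetric] by measurable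
  ultimately have "AE z::real \<times> real in lborel. snd z \<notin> N"
    by (auto intro!: AE_pair_swap)
  moreover have "P x" if "x \<notin> N" for x using N(1) that by auto
  ultimately show ?thesis by (simp add: eventually_mono)
qed

subsection \<open>Mollifiers and the Kruzkov flux\<close>

lemma bounded_compact_support:
  fixes g :: "'a::metric_space \<Rightarrow> real"
  assumes "continuous_on UNIV g" "compact K" "\<And>z. z \<notin> K \<Longrightarrow> g z = 0"
  obtains B where "0 \<le> B" "\<And>z. \<bar>g z\<bar> \<le> B"
proof -
  have "bounded (g ` K)"
    by (intro compact_imp_bounded compact_continuous_image continuous_on_subset[OF assms(1)] assms(2)) auto
  then obtain B where B: "0 < B" "\<And>x. x \<in> K \<Longrightarrow> \<bar>g x\<bar> \<le> B" by (auto simp: bounded_pos)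
  show thesis
  proof
    show "0 \<le> B" using B(1) by simp
    show "\<bar>g z\<bar> \<le> B" for z using B assms(3)[of z] by (cases "z \<in> K") auto
  qed
qed

lemma integral_bump: "(\<integral>x. bump x \<partial>lborel) = 1"
proof -
  have c: "continuous_on UNIV bump" by (rule smooth_imp_continuous[OF smooth_bump])
  obtain B where B: "\<And>x. \<bar>bump x\<bar> \<le> B"
    by (rule bounded_compact_support[OF c, of "{0..1}"]) (auto simp: bump_eq_0)
  have "integrable lborel bump"
    by (rule integrable_bounded_support[OF borel_measurable_continuous_onI[OF c], of "{0..1}" B])
       (auto simp: bump_eq_0 B)
  then have "(\<integral>x. bump x \<partial>lborel) = integral UNIV bump"
    by (rule integral_lborel[symmetric])
  also have "\<dots> = integral UNIV (\<lambda>x. if x \<in> {0..1} then bump x else 0)"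
    by (rule integral_cong) (auto simp: bump_eq_0)
  also have "\<dots> = integral {0..1} bump"
    by (rule integral_restrict_UNIV)
  also have "\<dots> = 1" using step_eq_1[of 1] by (simp add: step_def)
  finally show ?thesis .
qed

lemma integral_bump_affine: "c \<noteq> 0 \<Longrightarrow> (\<integral>x. bump ((x - a) / c) \<partial>lborel) = \<bar>c\<bar>"
  using lborel_integral_real_affine[of c "\<lambda>x. bump ((x - a) / c)" a] by (simp add: integral_bump)

lemma integral_fst_mult_snd:
  fixes f g :: "real \<Rightarrow> real"
  assumes "integrable lborel (\<lambda>z. f (fst z) * g (snd z))"
  shows "(\<integral>z. f (fst z) * g (snd z) \<partial>lborel) = (\<integral>x. f x \<partial>lborel) * (\<integral>x. g x \<partial>lborel)"
proof -
  have "(\<integral>z. f (fst z) * g (snd z) \<partial>(lborel \<Otimes>\<^sub>M lborel)) = (\<integral>x. (\<integral>y. f x * g y \<partial>lborel) \<partial>lborel)"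
    using lborel_pair.integral_fst[of "\<lambda>x y. f x * g y"] assms
    by (simp add: lborel_prod case_prod_beta')
  then show ?thesis by (simp add: lborel_prod)
qed

lemma dx_dt_eq_0:
  assumes "closed K" "\<And>z. z \<notin> K \<Longrightarrow> \<phi> z = 0" "z \<notin> K"
  shows "dx \<phi> z = 0" "dt \<phi> z = 0"
proof -
  obtain x t where z: "z = (x, t)" by (cases z)
  have U: "open (- K)" using assms(1) by auto
  have "open ((\<lambda>x. (x, t)) -` (- K))" "open ((\<lambda>t. (x, t)) -` (- K))"
    using U by (auto intro!: open_vimage continuous_intros)
  then have "eventually (\<lambda>x. \<phi> (x, t) = 0) (nhds x)" "eventually (\<lambda>t. \<phi> (x, t) = 0) (nhds t)"
    using assms(2,3) z by (auto intro: eventually_mono[OF eventually_nhds_in_open])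
  from this[THEN deriv_cong_ev, OF refl]
  have "deriv (\<lambda>x. \<phi> (x, t)) x = 0" "deriv (\<lambda>t. \<phi> (x, t)) t = 0" by simp_all
  then show "dx \<phi> z = 0" "dt \<phi> z = 0"
    by (simp_all add: z dx_def dt_def)
qed

text \<open>This is the entropy flux sgn(a - b) (g(a) - g(b)). Written with max and min it is
  visibly symmetric, and Lipschitz in each argument even where the sign jumps.\<close>

definition kflux :: "(real \<Rightarrow> real) \<Rightarrow> real \<Rightarrow> real \<Rightarrow> real" where
  "kflux g a b = g (max a b) - g (min a b)"

text \<open>The flux carries the indicator of \<^const>\<open>Om\<close>, so that for a function that does not depend on
  \<open>t\<close> when \<open>t \<le> 0\<close> the integral over \<open>t \<le> 0\<close> is the initial term of the entropy inequality.\<close>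

definition kruzkov :: "(real \<Rightarrow> real) \<Rightarrow> (real \<times> real) set \<Rightarrow> (real \<times> real \<Rightarrow> real) \<Rightarrow> bool" where
  "kruzkov g G u \<longleftrightarrow> u \<in> borel_measurable borel \<and> (\<forall>z. u z \<in> {0..1}) \<and>
     (\<forall>\<phi> K \<kappa>. smooth \<phi> \<longrightarrow> compact K \<longrightarrow> (\<forall>z. z \<notin> K \<longrightarrow> \<phi> z = 0) \<longrightarrow> K \<inter> G = {} \<longrightarrow>
        (\<forall>z. 0 \<le> \<phi> z) \<longrightarrow> \<kappa> \<in> {0..1} \<longrightarrow>
        0 \<le> (\<integral>z. \<bar>u z - \<kappa>\<bar> * dt \<phi> z + indicator Om z * kflux g (u z) \<kappa> * dx \<phi> z \<partial>lborel))"

lemma Om_borel[measurable]: "Om \<in> sets borel"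
  unfolding Om_def borel_prod[symmetric] by measurable

lemma kflux_commute: "kflux g a b = kflux g b a"
  by (simp add: kflux_def max.commute min.commute)

text \<open>The flux is Lipschitz on the whole line and not just on [0,1], which frees the estimates
  from range conditions. The instance used at the end is the given flux precomposed with the
  projection \<open>clamp01\<close> onto [0,1]; the two agree on the values of solutions.\<close>

locale lipschitz_flux =
  fixes g :: "real \<Rightarrow> real" and L :: real
  assumes lip: "\<And>x y. \<bar>g x - g y\<bar> \<le> L * \<bar>x - y\<bar>"
begin

lemma L_nonneg: "0 \<le> L"
  using lip[of 0 1] by simp

lemma continuous_g: "continuous_on UNIV g"
proof -
  have "L-lipschitz_on UNIV g"
    using lip L_nonneg by (auto intro!: lipschitz_onI simp: dist_real_def)
  then show ?thesis by (rule lipschitz_on_continuous_on)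
qed

lemma g_measurable[measurable]: "g \<in> borel_measurable borel"
  by (rule borel_measurable_continuous_onI[OF continuous_g])

lemma kflux_measurable[measurable (raw)]:
  "f \<in> borel_measurable M \<Longrightarrow> h \<in> borel_measurable M \<Longrightarrow> (\<lambda>x. kflux g (f x) (h x)) \<in> borel_measurable M"
  unfolding kflux_def
  by (intro borel_measurable_diff measurable_compose[OF _ g_measurable] borel_measurable_max borel_measurable_min)

lemma kflux_le: "\<bar>kflux g a b\<bar> \<le> L * \<bar>a - b\<bar>"
  using lip[of "max a b" "min a b"] by (simp add: kflux_def max_def min_def abs_minus_commute split: if_splits)

lemma kflux_lipschitz: "\<bar>kflux g a b - kflux g a c\<bar> \<le> 2 * L * \<bar>b - c\<bar>"
proof -
  have "\<bar>kflux g a b - kflux g a c\<bar> \<le> \<bar>g (max a b) - g (max a c)\<bar> + \<bar>g (min a b) - g (min a c)\<bar>"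
    unfolding kflux_def by linarith
  also have "\<dots> \<le> L * \<bar>max a b - max a c\<bar> + L * \<bar>min a b - min a c\<bar>"
    by (intro add_mono lip)
  also have "\<dots> \<le> L * \<bar>b - c\<bar> + L * \<bar>b - c\<bar>"
    using L_nonneg by (intro add_mono mult_left_mono) (auto simp: max_def min_def)
  finally show ?thesis by simp
qed

lemma kflux_le_unit: "a \<in> {0..1} \<Longrightarrow> b \<in> {0..1} \<Longrightarrow> \<bar>kflux g a b\<bar> \<le> L"
  using kflux_le[of a b] mult_left_mono[OF _ L_nonneg, of "\<bar>a - b\<bar>" 1] by (simp add: abs_le_iff)

end

text \<open>The exponent 3 normalises the mass to 1: width e in space times width e^2 in
  time.\<close>

definition kern :: "real \<Rightarrow> real \<times> real \<Rightarrow> real" where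
  "kern e w = bump (fst w / e) * bump (snd w / e\<^sup>2) / e ^ 3"

lemma integral_kern: "0 < e \<Longrightarrow> integrable lborel (kern e) \<Longrightarrow> (\<integral>w. kern e w \<partial>lborel) = 1"
proof -
  assume e: "0 < e" and i: "integrable lborel (kern e)"
  have eq: "kern e = (\<lambda>w. (bump (fst w / e)) * (bump (snd w / e\<^sup>2) / e ^ 3))"
    by (simp add: kern_def fun_eq_iff)
  show ?thesis using i unfolding eq
    by (subst integral_fst_mult_snd)
       (use e integral_bump_affine[of e 0] integral_bump_affine[of "e\<^sup>2" 0] in \<open>simp_all add: power2_eq_square power3_eq_cube\<close>)
qed

lemma smooth_kern: "smooth (kern e)"
  unfolding kern_def by (intro smooth_intros smooth_comp[OF smooth_bump])

lemma kern_nonneg: "0 < e \<Longrightarrow> 0 \<le> kern e w"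
  by (simp add: kern_def bump_nonneg)

lemma kern_support: "0 < e \<Longrightarrow> w \<notin> {0..e} \<times> {0..e\<^sup>2} \<Longrightarrow> kern e w = 0"
  by (cases w) (auto simp: kern_def divide_le_0_iff pos_le_divide_eq not_le intro!: bump_eq_0)

lemma norm_kern_support: "e \<le> 1 \<Longrightarrow> w \<in> {0..e} \<times> {0..e\<^sup>2} \<Longrightarrow> norm w \<le> 2 * e"
proof -
  assume e: "e \<le> 1" and w: "w \<in> {0..e} \<times> {0..e\<^sup>2}"
  then have "0 \<le> e" by (cases w) auto
  then have "e\<^sup>2 \<le> e" using e by (simp add: power2_eq_square mult_left_le)
  then show "norm w \<le> 2 * e" using norm_fst_le[of w] norm_triangle_le[of "(fst w, 0)" "(0, snd w)" "2 * e"] w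
    by (cases w) (auto simp: norm_Pair)
qed

text \<open>The space derivative costs one factor 1/e on top of the normalisation 1/e^3. The
  constant is uniform in e, on which the passage to the limit relies.\<close>

lemma dx_kern_bound: obtains C where "0 \<le> C" "\<And>e w. 0 < e \<Longrightarrow> \<bar>dx (kern e) w\<bar> \<le> C / e ^ 4"
proof -
  obtain b' where b': "\<And>x. (bump has_real_derivative b' x) (at x)" "continuous_on UNIV b'"
    using smooth_derivative[OF smooth_bump] by blast
  have z: "b' x = 0" if "x \<notin> {0..1}" for x
  proof -
    have "eventually (\<lambda>x. bump x = 0) (nhds x)"
      by (rule eventually_mono[OF eventually_nhds_in_open[of "- {0..1}"]]) (use that in \<open>auto simp: bump_eq_0\<close>)
    then have "(bump has_real_derivative b' x) (at x) \<longleftrightarrow> ((\<lambda>_. 0) has_real_derivative b' x) (at x)"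
      by (intro DERIV_cong_ev) auto
    then show ?thesis using b'(1) DERIV_unique[OF _ DERIV_const] by blast
  qed
  obtain B0 where B0: "0 \<le> B0" "\<And>x. \<bar>bump x\<bar> \<le> B0"
    using bounded_compact_support[of bump "{0..1}"] smooth_imp_continuous[OF smooth_bump] by (metis atLeastAtMost_iff bump_eq_0 compact_Icc linorder_le_cases)
  obtain B1 where B1: "0 \<le> B1" "\<And>x. \<bar>b' x\<bar> \<le> B1"
    using bounded_compact_support[of b' "{0..1}"] b' z by (metis compact_Icc)
  show thesis
  proof
    show "0 \<le> B1 * B0" using B0 B1 by simp
    fix e :: real and w :: "real \<times> real" assume e: "0 < e"
    have D: "((\<lambda>x. kern e (x, t)) has_real_derivative b' (x / e) * bump (t / e\<^sup>2) / e ^ 4) (at x)" for x t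
      unfolding kern_def using e
      by (auto intro!: derivative_eq_intros DERIV_chain2[OF b'(1)] simp: field_simps power_numeral_reduce)
    have "dx (kern e) w = b' (fst w / e) * bump (snd w / e\<^sup>2) / e ^ 4"
      using dx_eqI[of "kern e", OF D, of "fst w" "snd w"] by simp
    then have "\<bar>dx (kern e) w\<bar> = \<bar>b' (fst w / e)\<bar> * \<bar>bump (snd w / e\<^sup>2)\<bar> / e ^ 4"
      using e by (simp add: abs_mult)
    also have "\<dots> \<le> B1 * B0 / e ^ 4"
      using B0 B1 e by (intro divide_right_mono mult_mono) auto
    finally show "\<bar>dx (kern e) w\<bar> \<le> B1 * B0 / e ^ 4" .
  qed
qed

subsection \<open>Doubling of variables\<close>

text \<open>Boundedness with the constant hidden, so that integrability of long integrands follows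
  from closure rules and a bounded support.\<close>

definition bdd :: "('a \<Rightarrow> real) \<Rightarrow> bool" where
  "bdd f \<longleftrightarrow> (\<exists>B. \<forall>z. \<bar>f z\<bar> \<le> B)"

lemma bddI: "(\<And>z. \<bar>f z\<bar> \<le> B) \<Longrightarrow> bdd f"
  by (auto simp: bdd_def)

lemma bddE:
  assumes "bdd f" obtains B where "0 \<le> B" "\<And>z. \<bar>f z\<bar> \<le> B"
proof -
  obtain B where B: "\<And>z. \<bar>f z\<bar> \<le> B" using assms by (auto simp: bdd_def)
  have "0 \<le> B" using B[of undefined] by linarith
  then show thesis using B that by blast
qed

lemma bdd_const: "bdd (\<lambda>z. c)"
  and bdd_indicator: "bdd (\<lambda>z. indicator (A z) (h z) :: real)"
  and bdd_abs: "bdd f \<Longrightarrow> bdd (\<lambda>z. \<bar>f z\<bar>)"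
  and bdd_uminus: "bdd f \<Longrightarrow> bdd (\<lambda>z. - f z)"
  and bdd_comp: "bdd f' \<Longrightarrow> bdd (\<lambda>z. f' (h' z))"
  by (auto simp: bdd_def indicator_def intro: exI[of _ 1])

lemma bdd_add: assumes "bdd f" "bdd h" shows "bdd (\<lambda>z. f z + h z)"
proof -
  obtain A where "0 \<le> A" "\<And>z. \<bar>f z\<bar> \<le> A" using bddE[OF assms(1)] by blast
  moreover obtain B where "0 \<le> B" "\<And>z. \<bar>h z\<bar> \<le> B" using bddE[OF assms(2)] by blast
  ultimately show ?thesis
    by (intro bddI[of _ "A + B"] order_trans[OF abs_triangle_ineq add_mono])
qed

lemma bdd_diff: "bdd f \<Longrightarrow> bdd h \<Longrightarrow> bdd (\<lambda>z. f z - h z)"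
  using bdd_add[OF _ bdd_uminus, of f h] by simp

lemma bdd_mult: assumes "bdd f" "bdd h" shows "bdd (\<lambda>z. f z * h z)"
proof -
  obtain A where A: "0 \<le> A" "\<And>z. \<bar>f z\<bar> \<le> A" using bddE[OF assms(1)] by blast
  obtain B where B: "0 \<le> B" "\<And>z. \<bar>h z\<bar> \<le> B" using bddE[OF assms(2)] by blast
  show ?thesis
    by (rule bddI[of _ "A * B"]) (unfold abs_mult, intro mult_mono A B abs_ge_zero)
qed

lemmas bdd_intros = bdd_const bdd_indicator bdd_abs bdd_uminus bdd_add bdd_diff bdd_mult

lemma integrable_bdd:
  fixes f :: "'a::euclidean_space \<Rightarrow> real"
  assumes "f \<in> borel_measurable borel" "bdd f" "bounded K" "\<And>z. z \<notin> K \<Longrightarrow> f z = 0"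
  shows "integrable lborel f"
proof -
  obtain B where "0 \<le> B" "\<And>z. \<bar>f z\<bar> \<le> B" using bddE[OF assms(2)] by blast
  then show ?thesis
    by (intro integrable_bounded_support[OF assms(1,3) _ assms(4)])
qed

lemma bdd_compact_support:
  assumes "continuous_on UNIV g" "compact K" "\<And>z::'a::metric_space. z \<notin> K \<Longrightarrow> g z = 0"
  shows "bdd g"
proof -
  obtain B where "0 \<le> B" "\<And>z. \<bar>g z\<bar> \<le> B" using bounded_compact_support[OF assms] by blast
  then show ?thesis by (intro bddI)
qed

lemma borel_measurable_fst_borel[measurable (raw)]:
  "f \<in> borel_measurable M \<Longrightarrow> (\<lambda>x. fst (f x :: 'a::second_countable_topology \<times> 'b::second_countable_topology)) \<in> borel_measurable M"
  by (rule measurable_compose[OF _ borel_measurable_continuous_onI]) (auto intro: continuous_intros)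

lemma borel_measurable_snd_borel[measurable (raw)]:
  "f \<in> borel_measurable M \<Longrightarrow> (\<lambda>x. snd (f x :: 'a::second_countable_topology \<times> 'b::second_countable_topology)) \<in> borel_measurable M"
  by (rule measurable_compose[OF _ borel_measurable_continuous_onI]) (auto intro: continuous_intros)

lemma dx_mult:
  assumes "smooth \<phi>" "smooth \<psi>"
  shows "dx (\<lambda>z. \<phi> z * \<psi> z) z = dx \<phi> z * \<psi> z + \<phi> z * dx \<psi> z"
    and "dt (\<lambda>z. \<phi> z * \<psi> z) z = dt \<phi> z * \<psi> z + \<phi> z * dt \<psi> z"
proof -
  have "dx (\<lambda>z. \<phi> z * \<psi> z) (x, t) = dx \<phi> (x, t) * \<psi> (x, t) + \<phi> (x, t) * dx \<psi> (x, t)"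
    and "dt (\<lambda>z. \<phi> z * \<psi> z) (x, t) = dt \<phi> (x, t) * \<psi> (x, t) + \<phi> (x, t) * dt \<psi> (x, t)" for x t
    using assms by (auto intro!: dx_eqI dt_eqI derivative_eq_intros smooth_plane)
  from this[of "fst z" "snd z"]
  show "dx (\<lambda>z. \<phi> z * \<psi> z) z = dx \<phi> z * \<psi> z + \<phi> z * dx \<psi> z"
    "dt (\<lambda>z. \<phi> z * \<psi> z) z = dt \<phi> z * \<psi> z + \<phi> z * dt \<psi> z" by simp_all
qed

lemma dx_shift:
  assumes "smooth \<phi>"
  shows "dx (\<lambda>z. \<phi> (z - c)) z = dx \<phi> (z - c)" "dt (\<lambda>z. \<phi> (z - c)) z = dt \<phi> (z - c)"
    and "dx (\<lambda>z. \<phi> (c - z)) z = - dx \<phi> (c - z)" "dt (\<lambda>z. \<phi> (c - z)) z = - dt \<phi> (c - z)"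
proof -
  obtain p r where c: "c = (p, r)" by (cases c)
  have "dx (\<lambda>z. \<phi> (z - c)) (x, t) = dx \<phi> (x - p, t - r)"
    "dt (\<lambda>z. \<phi> (z - c)) (x, t) = dt \<phi> (x - p, t - r)"
    "dx (\<lambda>z. \<phi> (c - z)) (x, t) = - dx \<phi> (p - x, r - t)"
    "dt (\<lambda>z. \<phi> (c - z)) (x, t) = - dt \<phi> (p - x, r - t)" for x t
  proof -
    have X: "((\<lambda>x. \<phi> (h x, s)) has_real_derivative dx \<phi> (h x, s) * d) (at x)"
      and T: "((\<lambda>t. \<phi> (s, h t)) has_real_derivative dt \<phi> (s, h x) * d) (at x)"
      if "(h has_real_derivative d) (at x)" for h d s x
      using DERIV_chain2[OF smooth_plane(1)[OF assms] that] DERIV_chain2[OF smooth_plane(2)[OF assms] that]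
      by simp_all
    have d: "((\<lambda>x. x - p) has_real_derivative 1) (at x)" "((\<lambda>x. p - x) has_real_derivative - 1) (at x)" for p x :: real
      by (auto intro!: derivative_eq_intros)
    show "dx (\<lambda>z. \<phi> (z - c)) (x, t) = dx \<phi> (x - p, t - r)"
      "dt (\<lambda>z. \<phi> (z - c)) (x, t) = dt \<phi> (x - p, t - r)"
      "dx (\<lambda>z. \<phi> (c - z)) (x, t) = - dx \<phi> (p - x, r - t)"
      "dt (\<lambda>z. \<phi> (c - z)) (x, t) = - dt \<phi> (p - x, r - t)"
      unfolding c using X[OF d(1)] T[OF d(1)] X[OF d(2)] T[OF d(2)]
      by (auto intro!: dx_eqI dt_eqI)
  qed
  from this[of "fst z" "snd z"]
  show "dx (\<lambda>z. \<phi> (z - c)) z = dx \<phi> (z - c)" "dt (\<lambda>z. \<phi> (z - c)) z = dt \<phi> (z - c)"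
    "dx (\<lambda>z. \<phi> (c - z)) z = - dx \<phi> (c - z)" "dt (\<lambda>z. \<phi> (c - z)) z = - dt \<phi> (c - z)"
    by (cases z; simp add: c)+
qed

lemma kruzkov_measurable: "kruzkov g G u \<Longrightarrow> u \<in> borel_measurable borel"
  and kruzkov_range: "kruzkov g G u \<Longrightarrow> u z \<in> {0..1}"
  and kruzkov_ineq: "kruzkov g G u \<Longrightarrow> smooth \<phi> \<Longrightarrow> compact K \<Longrightarrow> (\<And>z. z \<notin> K \<Longrightarrow> \<phi> z = 0) \<Longrightarrow>
    K \<inter> G = {} \<Longrightarrow> (\<And>z. 0 \<le> \<phi> z) \<Longrightarrow> \<kappa> \<in> {0..1} \<Longrightarrow>
    0 \<le> (\<integral>z. \<bar>u z - \<kappa>\<bar> * dt \<phi> z + indicator Om z * kflux g (u z) \<kappa> * dx \<phi> z \<partial>lborel)"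
  unfolding kruzkov_def by blast+

lemma kruzkov_bdd: "kruzkov g G u \<Longrightarrow> bdd u"
proof (rule bddI)
  show "kruzkov g G u \<Longrightarrow> \<bar>u z\<bar> \<le> 1" for z using kruzkov_range[of g G u z] by simp
qed

lemma (in lipschitz_flux) kflux_bdd:
  assumes "bdd f" "bdd h" shows "bdd (\<lambda>z. kflux g (f z) (h z))"
proof -
  have b: "bdd (\<lambda>z. L * \<bar>f z - h z\<bar>)" by (intro bdd_intros assms)
  obtain B where "0 \<le> B" and B: "\<And>z. \<bar>L * \<bar>f z - h z\<bar>\<bar> \<le> B" using bddE[OF b] by blast
  have "\<bar>kflux g (f z) (h z)\<bar> \<le> B" for z
    using kflux_le[of "f z" "h z"] B[of z] by linarith
  then show ?thesis by (rule bddI)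
qed

lemma lborel_integral_translation':
  fixes f :: "'a::euclidean_space \<Rightarrow> real"
  assumes "f \<in> borel_measurable borel"
  shows "(\<integral>z. f z \<partial>lborel) = (\<integral>z. f (c + z) \<partial>lborel)"
  using lborel_integral_translation[OF assms, of "- c"] by (simp add: add.commute)

text \<open>With w = z - z', the inequality for \<open>u\<close> in z and that for \<open>v\<close>
  in z' are tested with psi(z) times the kernel at w, each with the value of the other function as
  its constant. Kernel derivatives enter with opposite signs in z and z'. In time they cancel; in
  space only the difference of the two indicators survives and is collected in \<open>R\<close>. The
  terms in which psi is differentiated form \<open>J\<close>. The separation hypothesis keeps the
  points z - w, the support of the second test function, away from \<open>G\<close>.\<close>

lemma (in lipschitz_flux) kato_mollified:
  fixes \<psi> :: "real \<times> real \<Rightarrow> real"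
  assumes u: "kruzkov g G u" and v: "kruzkov g G v"
    and \<psi>: "smooth \<psi>" "compact K" "\<And>z. z \<notin> K \<Longrightarrow> \<psi> z = 0" "K \<inter> G = {}" "\<And>z. 0 \<le> \<psi> z"
    and e: "0 < e" and sep: "\<And>z w. z \<in> K \<Longrightarrow> w \<in> {0..e} \<times> {0..e\<^sup>2} \<Longrightarrow> z - w \<notin> G"
  defines "J \<equiv> \<lambda>w. \<integral>z. \<bar>u z - v (z - w)\<bar> * dt \<psi> z + indicator Om z * kflux g (u z) (v (z - w)) * dx \<psi> z \<partial>lborel"
    and "R \<equiv> \<lambda>w. \<integral>z. (indicator Om z - indicator Om (z - w)) * kflux g (u z) (v (z - w)) * \<psi> z \<partial>lborel"
  shows "integrable lborel (\<lambda>w. kern e w * J w + dx (kern e) w * R w)"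
    and "0 \<le> (\<integral>w. kern e w * J w + dx (kern e) w * R w \<partial>lborel)"
proof -
  define S where "S = {0..e} \<times> {0..e\<^sup>2}"
  have S: "compact S" unfolding S_def by (intro compact_Times) auto
  define K' where "K' = {z - w | z w. z \<in> K \<and> w \<in> S}"
  have K': "compact K'" unfolding K'_def by (rule compact_differences[OF \<psi>(2) S])
  let ?k = "kern e" and ?a = "indicator Om :: real \<times> real \<Rightarrow> real"
  have k0: "?k w = 0" "dx ?k w = 0" "dt ?k w = 0" if "w \<notin> S" for w
    using that kern_support[OF e] dx_dt_eq_0[OF compact_imp_closed[OF S], of ?k] by (auto simp: S_def)
  have p0: "\<psi> z = 0" "dx \<psi> z = 0" "dt \<psi> z = 0" if "z \<notin> K" for z
    using that \<psi>(3) dx_dt_eq_0[OF compact_imp_closed[OF \<psi>(2)], of \<psi>] by auto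
  note um[measurable] = kruzkov_measurable[OF u] and vm[measurable] = kruzkov_measurable[OF v]
  have km[measurable]: "?k \<in> borel_measurable borel" "dx ?k \<in> borel_measurable borel" "dt ?k \<in> borel_measurable borel"
    by (auto intro!: borel_measurable_continuous_onI smooth_imp_continuous smooth_plane smooth_kern)
  have pm[measurable]: "\<psi> \<in> borel_measurable borel" "dx \<psi> \<in> borel_measurable borel" "dt \<psi> \<in> borel_measurable borel"
    by (auto intro!: borel_measurable_continuous_onI smooth_imp_continuous smooth_plane \<psi>)
  have kb: "bdd ?k" "bdd (dx ?k)" "bdd (dt ?k)"
    by (auto intro!: bdd_compact_support[OF _ S] smooth_imp_continuous smooth_plane smooth_kern simp: k0)
  have pb: "bdd \<psi>" "bdd (dx \<psi>)" "bdd (dt \<psi>)"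
    by (auto intro!: bdd_compact_support[OF _ \<psi>(2)] smooth_imp_continuous smooth_plane \<psi>(1) simp: p0)
  note ub = kruzkov_bdd[OF u] and vb = kruzkov_bdd[OF v]
  note bds = bdd_intros kflux_bdd kb[THEN bdd_comp] pb[THEN bdd_comp] ub[THEN bdd_comp] vb[THEN bdd_comp]
  \<comment> \<open>\<open>H1\<close> is the integrand for \<open>u\<close> with z' frozen and
    \<open>H2\<close> that for \<open>v\<close> with z frozen. Since psi does not depend on z', only
    the kernel is differentiated in \<open>H2\<close>.\<close>
  define H1 where "H1 z z' = \<bar>u z - v z'\<bar> * (dt \<psi> z * ?k (z - z') + \<psi> z * dt ?k (z - z'))
      + ?a z * kflux g (u z) (v z') * (dx \<psi> z * ?k (z - z') + \<psi> z * dx ?k (z - z'))" for z z'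
  define H2 where "H2 z z' = \<bar>v z' - u z\<bar> * (\<psi> z * - dt ?k (z - z'))
      + ?a z' * kflux g (v z') (u z) * (\<psi> z * - dx ?k (z - z'))" for z z'
  define D where "D z z' = ?k (z - z') * (\<bar>u z - v z'\<bar> * dt \<psi> z + ?a z * kflux g (u z) (v z') * dx \<psi> z)
      + dx ?k (z - z') * ((?a z - ?a z') * kflux g (u z) (v z') * \<psi> z)" for z z'
  have D: "D z z' = H1 z z' + H2 z z'" for z z'
    by (simp add: D_def H1_def H2_def kflux_commute[of g "v z'"] abs_minus_commute[of "v z'"] algebra_simps)
  have out: "H1 z z' = 0" "H2 z z' = 0" if "(z, z') \<notin> K \<times> K'" for z z'
  proof -
    have "z \<notin> K \<or> z - z' \<notin> S"
    proof (rule ccontr)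
      assume "\<not> (z \<notin> K \<or> z - z' \<notin> S)"
      then have "z - (z - z') \<in> K'" unfolding K'_def by blast
      then show False using that \<open>\<not> (z \<notin> K \<or> z - z' \<notin> S)\<close> by simp
    qed
    then show "H1 z z' = 0" "H2 z z' = 0"
      by (auto simp: H1_def H2_def k0 p0)
  qed
  have bK: "bounded (K \<times> K')" using \<psi>(2) K' by (intro bounded_Times compact_imp_bounded)
  have iH1: "integrable lborel (\<lambda>p. H1 (fst p) (snd p))"
  proof (rule integrable_bdd[OF _ _ bK])
    show "(\<lambda>p. H1 (fst p) (snd p)) \<in> borel_measurable borel" unfolding H1_def by measurable
    show "bdd (\<lambda>p. H1 (fst p) (snd p))" unfolding H1_def by (intro bds)
  qed (auto intro: out)
  have iH2: "integrable lborel (\<lambda>p. H2 (fst p) (snd p))"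
  proof (rule integrable_bdd[OF _ _ bK])
    show "(\<lambda>p. H2 (fst p) (snd p)) \<in> borel_measurable borel" unfolding H2_def by measurable
    show "bdd (\<lambda>p. H2 (fst p) (snd p))" unfolding H2_def by (intro bds)
  qed (auto intro: out)
  have smk: "smooth (\<lambda>z. ?k (z - z'))" "smooth (\<lambda>z. ?k (z' - z))" for z'
    unfolding kern_def fst_diff snd_diff by (intro smooth_intros smooth_comp[OF smooth_bump])+
  have A: "0 \<le> (\<integral>z. H1 z z' \<partial>lborel)" for z'
  proof -
    have "0 \<le> (\<integral>z. \<bar>u z - v z'\<bar> * dt (\<lambda>z. \<psi> z * ?k (z - z')) z
        + ?a z * kflux g (u z) (v z') * dx (\<lambda>z. \<psi> z * ?k (z - z')) z \<partial>lborel)"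
      using u \<psi>(2) kruzkov_range[OF v]
      by (intro kruzkov_ineq[of g G u _ K]) (auto simp: \<psi> kern_nonneg[OF e] intro!: smooth_mult smk)
    then show ?thesis
      unfolding H1_def by (simp add: dx_mult dx_shift \<psi>(1) smk smooth_kern)
  qed
  have B: "0 \<le> (\<integral>z'. H2 z z' \<partial>lborel)" for z
  proof (cases "z \<in> K")
    case True
    let ?\<phi> = "\<lambda>z'. \<psi> z * ?k (z - z')"
    have "0 \<le> (\<integral>z'. \<bar>v z' - u z\<bar> * dt ?\<phi> z' + ?a z' * kflux g (v z') (u z) * dx ?\<phi> z' \<partial>lborel)"
    proof (rule kruzkov_ineq[OF v])
      show "compact ((\<lambda>w. z - w) ` S)"
        by (intro compact_continuous_image continuous_intros S)
      show "?\<phi> z' = 0" if "z' \<notin> (\<lambda>w. z - w) ` S" for z'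
      proof -
        have "z - z' \<notin> S" using that by (metis add_diff_cancel_left' diff_add_cancel image_eqI uminus_add_conv_diff diff_diff_eq2 add_diff_cancel_left)
        then show ?thesis by (simp add: k0)
      qed
      show "(\<lambda>w. z - w) ` S \<inter> G = {}" using sep[OF True] unfolding S_def by blast
    qed (use kruzkov_range[OF u] in \<open>auto simp: \<psi> kern_nonneg[OF e] intro!: smooth_intros smk\<close>)
    then show ?thesis
      unfolding H2_def by (simp add: dx_mult[OF smooth_const] dx_shift smk smooth_kern dx_def[of "\<lambda>_. _"] dt_def[of "\<lambda>_. _"])
  qed (simp add: H2_def p0)
  have iD: "integrable lborel (\<lambda>p. D (fst p) (snd p))"
    unfolding D by (intro Bochner_Integration.integrable_add iH1 iH2)
  have "0 \<le> (\<integral>p. D (fst p) (snd p) \<partial>lborel)"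
  proof -
    have "(\<integral>p. H1 (fst p) (snd p) \<partial>lborel) = (\<integral>z'. (\<integral>z. H1 z z' \<partial>lborel) \<partial>lborel)"
      using lborel_pair.integral_snd[of H1] iH1 by (simp add: lborel_prod case_prod_beta')
    then have "0 \<le> (\<integral>p. H1 (fst p) (snd p) \<partial>lborel)" using A by (simp add: integral_nonneg_AE)
    moreover have "(\<integral>p. H2 (fst p) (snd p) \<partial>lborel) = (\<integral>z. (\<integral>z'. H2 z z' \<partial>lborel) \<partial>lborel)"
      using lborel_pair.integral_fst[of H2] iH2 by (simp add: lborel_prod case_prod_beta')
    then have "0 \<le> (\<integral>p. H2 (fst p) (snd p) \<partial>lborel)" using B by (simp add: integral_nonneg_AE)
    ultimately show ?thesis unfolding D using iH1 iH2 by simp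
  qed
  also have "(\<integral>p. D (fst p) (snd p) \<partial>lborel) = (\<integral>z'. (\<integral>z. D z z' \<partial>lborel) \<partial>lborel)"
    using lborel_pair.integral_snd[of D] iD by (simp add: lborel_prod case_prod_beta')
  \<comment> \<open>Substituting z = z' + w makes the kernel a function of w alone; after exchanging
    the integrals it factors out of the integral over z'.\<close>
  also have "\<dots> = (\<integral>z'. (\<integral>w. D (z' + w) z' \<partial>lborel) \<partial>lborel)"
  proof (rule Bochner_Integration.integral_cong[OF refl])
    fix z'
    have "(\<lambda>z. D z z') \<in> borel_measurable borel" unfolding D_def by measurable
    then show "(\<integral>z. D z z' \<partial>lborel) = (\<integral>w. D (z' + w) z' \<partial>lborel)"
      by (rule lborel_integral_translation')
  qed
  finally have P: "0 \<le> (\<integral>z'. (\<integral>w. D (z' + w) z' \<partial>lborel) \<partial>lborel)" .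
  have iD': "integrable lborel (\<lambda>p. D (fst p + snd p) (fst p))"
  proof (rule integrable_bdd[of _ "K' \<times> S"])
    show "(\<lambda>p. D (fst p + snd p) (fst p)) \<in> borel_measurable borel" unfolding D_def by measurable
    have "bdd (\<lambda>p. D (fst p) (snd p))" unfolding D_def by (intro bds)
    from bdd_comp[OF this, of "\<lambda>p. (fst p + snd p, fst p)"]
    show "bdd (\<lambda>p. D (fst p + snd p) (fst p))" by simp
    show "bounded (K' \<times> S)" using S K' by (intro bounded_Times compact_imp_bounded)
    show "D (fst p + snd p) (fst p) = 0" if "p \<notin> K' \<times> S" for p
    proof (cases "snd p \<in> S")
      case True
      then have "fst p \<notin> K'" using that by (cases p) auto
      moreover have "fst p \<in> K'" if "fst p + snd p \<in> K"
      proof -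
        have "(fst p + snd p) - snd p \<in> K'" using that True unfolding K'_def by blast
        then show ?thesis by simp
      qed
      ultimately have "fst p + snd p \<notin> K" by blast
      then show ?thesis by (simp add: D_def p0)
    qed (simp add: D_def k0)
  qed
  have DJR: "(\<integral>z'. D (z' + w) z' \<partial>lborel) = ?k w * J w + dx ?k w * R w" for w
  proof -
    have "(\<integral>z'. D (z' + w) z' \<partial>lborel) = (\<integral>z. D z (z - w) \<partial>lborel)"
    proof -
      have "(\<lambda>z. D z (z - w)) \<in> borel_measurable borel" unfolding D_def by measurable
      from lborel_integral_translation'[OF this, of w] show ?thesis
        by (simp add: add.commute[of w])
    qed
    also have "\<dots> = ?k w * J w + dx ?k w * R w"
    proof -
      have "bounded K" by (rule compact_imp_bounded[OF \<psi>(2)])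
      have i: "integrable lborel (\<lambda>z. \<bar>u z - v (z - w)\<bar> * dt \<psi> z + ?a z * kflux g (u z) (v (z - w)) * dx \<psi> z)"
        "integrable lborel (\<lambda>z. (?a z - ?a (z - w)) * kflux g (u z) (v (z - w)) * \<psi> z)"
      proof -
        show "integrable lborel (\<lambda>z. \<bar>u z - v (z - w)\<bar> * dt \<psi> z + ?a z * kflux g (u z) (v (z - w)) * dx \<psi> z)"
          by (rule integrable_bdd[OF _ _ \<open>bounded K\<close>], measurable, intro bds, simp add: p0)
        show "integrable lborel (\<lambda>z. (?a z - ?a (z - w)) * kflux g (u z) (v (z - w)) * \<psi> z)"
          by (rule integrable_bdd[OF _ _ \<open>bounded K\<close>], measurable, intro bds, simp add: p0)
      qed
      have "(\<integral>z. D z (z - w) \<partial>lborel) = (\<integral>z. ?k w * (\<bar>u z - v (z - w)\<bar> * dt \<psi> z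
          + ?a z * kflux g (u z) (v (z - w)) * dx \<psi> z)
          + dx ?k w * ((?a z - ?a (z - w)) * kflux g (u z) (v (z - w)) * \<psi> z) \<partial>lborel)"
        by (simp add: D_def)
      also have "\<dots> = ?k w * J w + dx ?k w * R w"
      proof -
        have "(\<integral>z. ?k w * f z + dx ?k w * h z \<partial>lborel) = ?k w * (\<integral>z. f z \<partial>lborel) + dx ?k w * (\<integral>z. h z \<partial>lborel)"
          if "integrable lborel f" "integrable lborel h" for f h :: "real \<times> real \<Rightarrow> real"
          using that by simp
        from this[OF i] show ?thesis unfolding J_def R_def .
      qed
      finally show ?thesis .
    qed
    finally show ?thesis .
  qed
  have F: "integrable (lborel \<Otimes>\<^sub>M lborel) (\<lambda>(z', w). D (z' + w) z')"
    using iD' unfolding lborel_prod case_prod_beta' .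
  show "integrable lborel (\<lambda>w. ?k w * J w + dx ?k w * R w)"
    using lborel_pair.integrable_snd[OF F] unfolding DJR .
  show "0 \<le> (\<integral>w. ?k w * J w + dx ?k w * R w \<partial>lborel)"
    using P unfolding lborel_pair.Fubini_integral[OF F, symmetric] DJR .
qed

text \<open>The compact support of psi has positive distance from the closed set \<open>G\<close>,
  so the mollified inequality is available for all small e. The kernel averages \<open>J\<close>
  near w = 0, where \<open>J\<close> differs little from \<open>J 0\<close> by continuity of
  translations in L^1, and the contribution of \<open>R\<close> is absorbed by the choice of
  e.\<close>

lemma (in lipschitz_flux) kato:
  fixes \<psi> :: "real \<times> real \<Rightarrow> real"
  assumes u: "kruzkov g G u" and v: "kruzkov g G v" and G: "closed G"
    and \<psi>: "smooth \<psi>" "compact K" "\<And>z. z \<notin> K \<Longrightarrow> \<psi> z = 0" "K \<inter> G = {}" "\<And>z. 0 \<le> \<psi> z"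
  shows "0 \<le> (\<integral>z. \<bar>u z - v z\<bar> * dt \<psi> z + indicator Om z * kflux g (u z) (v z) * dx \<psi> z \<partial>lborel)"
proof -
  let ?a = "indicator Om :: real \<times> real \<Rightarrow> real"
  define J where "J w = (\<integral>z. \<bar>u z - v (z - w)\<bar> * dt \<psi> z + ?a z * kflux g (u z) (v (z - w)) * dx \<psi> z \<partial>lborel)" for w
  define R where "R w = (\<integral>z. (?a z - ?a (z - w)) * kflux g (u z) (v (z - w)) * \<psi> z \<partial>lborel)" for w
  note um[measurable] = kruzkov_measurable[OF u] and vm[measurable] = kruzkov_measurable[OF v]
  note ur = kruzkov_range[OF u] and vr = kruzkov_range[OF v]
  have vr': "\<bar>v z\<bar> \<le> 1" for z using vr[of z] by simp
  have p0: "dx \<psi> z = 0" "dt \<psi> z = 0" if "z \<notin> K" for z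
    using that \<psi>(3) dx_dt_eq_0[OF compact_imp_closed[OF \<psi>(2)], of \<psi>] by auto
  have pm[measurable]: "\<psi> \<in> borel_measurable borel" "dx \<psi> \<in> borel_measurable borel" "dt \<psi> \<in> borel_measurable borel"
    by (auto intro!: borel_measurable_continuous_onI smooth_imp_continuous smooth_plane \<psi>(1))
  have pb: "bdd \<psi>" "bdd (dx \<psi>)" "bdd (dt \<psi>)"
    by (auto intro!: bdd_compact_support[OF _ \<psi>(2)] smooth_imp_continuous smooth_plane \<psi>(1) simp: p0 \<psi>(3))
  have ub: "bdd u" and vb: "bdd v" using kruzkov_bdd u v by auto
  have bK: "bounded K" by (rule compact_imp_bounded[OF \<psi>(2)])
  \<comment> \<open>The weight collects the Lipschitz constants of the integrand in the value of
    \<open>v\<close>: 1 in the time term and 2 L in the flux term.\<close>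
  define W where "W z = \<bar>dt \<psi> z\<bar> + 2 * L * \<bar>dx \<psi> z\<bar>" for z
  have W0: "0 \<le> W z" for z using L_nonneg by (simp add: W_def)
  have Wm[measurable]: "W \<in> borel_measurable borel" unfolding W_def[abs_def] by measurable
  have Wb: "bdd W" unfolding W_def[abs_def] by (intro bdd_intros pb)
  define \<omega> where "\<omega> w = (\<integral>z. \<bar>v z - v (z - w)\<bar> * \<bar>W z\<bar> \<partial>lborel)" for w
  have \<omega>: "(\<omega> \<longlongrightarrow> 0) (at 0)"
  proof -
    obtain C where C: "0 \<le> C" "\<And>z. \<bar>W z\<bar> \<le> C" using bddE[OF Wb] by blast
    show ?thesis unfolding \<omega>_def[abs_def]
      by (rule integral_translation_tendsto[OF vm _ Wm C(2) bK, of 1]) (use vr' in \<open>auto simp: W_def p0\<close>)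
  qed
  have ii: "integrable lborel (\<lambda>z. \<bar>u z - v (z - w)\<bar> * dt \<psi> z + ?a z * kflux g (u z) (v (z - w)) * dx \<psi> z)" for w
    by (rule integrable_bdd[OF _ _ bK], measurable, intro bdd_intros kflux_bdd ub pb bdd_comp[OF vb], simp add: p0)
  have iw: "integrable lborel (\<lambda>z. \<bar>v z - v (z - w)\<bar> * \<bar>W z\<bar>)" for w
    by (rule integrable_bdd[OF _ _ bK], measurable, intro bdd_intros Wb vb bdd_comp[OF vb], simp add: W_def p0)
  have JJ: "J w \<le> J 0 + \<omega> w" for w
  proof -
    have "J w \<le> (\<integral>z. (\<bar>u z - v (z - 0)\<bar> * dt \<psi> z + ?a z * kflux g (u z) (v (z - 0)) * dx \<psi> z)
        + \<bar>v z - v (z - w)\<bar> * \<bar>W z\<bar> \<partial>lborel)"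
      unfolding J_def
    proof (intro integral_mono ii Bochner_Integration.integrable_add iw)
      fix z
      have "(\<bar>u z - v (z - w)\<bar> - \<bar>u z - v z\<bar>) * dt \<psi> z \<le> \<bar>v z - v (z - w)\<bar> * \<bar>dt \<psi> z\<bar>"
        by (rule order_trans[OF abs_ge_self], unfold abs_mult, rule mult_right_mono) auto
      moreover have "?a z * ((kflux g (u z) (v (z - w)) - kflux g (u z) (v z)) * dx \<psi> z)
          \<le> 1 * (2 * L * \<bar>v z - v (z - w)\<bar> * \<bar>dx \<psi> z\<bar>)"
        using kflux_lipschitz[of "u z" "v (z - w)" "v z"] L_nonneg
        by - (rule order_trans[OF abs_ge_self], unfold abs_mult, intro mult_mono;
           auto simp: abs_minus_commute)
      ultimately show "\<bar>u z - v (z - w)\<bar> * dt \<psi> z + ?a z * kflux g (u z) (v (z - w)) * dx \<psi> z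
        \<le> (\<bar>u z - v (z - 0)\<bar> * dt \<psi> z + ?a z * kflux g (u z) (v (z - 0)) * dx \<psi> z) + \<bar>v z - v (z - w)\<bar> * \<bar>W z\<bar>"
        using W0[of z] by (simp add: W_def algebra_simps)
    qed
    also have "\<dots> = J 0 + \<omega> w"
      unfolding J_def \<omega>_def by (intro Bochner_Integration.integral_add ii iw)
    finally show ?thesis .
  qed
  obtain b where b: "0 < b" "K \<subseteq> cbox (-b, -b) (b, b)"
  proof -
    obtain a where a: "0 < a" "\<And>z. z \<in> K \<Longrightarrow> norm z \<le> a" using bK by (auto simp: bounded_pos)
    have "K \<subseteq> cbox (-a, -a) (a, a)"
    proof
      fix z assume "z \<in> K"
      then have "\<bar>fst z\<bar> \<le> a" "\<bar>snd z\<bar> \<le> a"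
        using a(2)[of z] norm_fst_le[of "fst z" "snd z"] norm_snd_le[of "snd z" "fst z"] by auto
      then show "z \<in> cbox (-a, -a) (a, a)" by (cases z) auto
    qed
    then show thesis using that a(1) by blast
  qed
  obtain P where P: "0 \<le> P" "\<And>z. \<bar>\<psi> z\<bar> \<le> P" using bddE[OF pb(1)] by blast
  obtain C where C: "0 \<le> C" "\<And>e w. 0 < e \<Longrightarrow> \<bar>dx (kern e) w\<bar> \<le> C / e ^ 4"
    using dx_kern_bound by blast
  \<comment> \<open>L bounds the flux, P bounds psi, and 2 b is the width of a box around
    \<open>K\<close>.\<close>
  define M where "M = L * P * (2 * b)"
  have M0: "0 \<le> M" using L_nonneg P b by (simp add: M_def)
  have RR: "\<bar>R w\<bar> \<le> M * e\<^sup>2" if "w \<in> {0..e} \<times> {0..e\<^sup>2}" for w e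
  proof -
    \<comment> \<open>For w in the kernel support the indicators at z and z - w differ only in the
      time slab 0 < t \<le> e^2.\<close>
    let ?B = "cbox (-b, 0) (b, e\<^sup>2) :: (real \<times> real) set"
    have "\<bar>R w\<bar> \<le> (L * P) * measure lborel ?B"
      unfolding R_def
    proof (rule integral_bounded_support_le)
      show "0 \<le> L * P" using L_nonneg P by simp
      fix z
      have "\<bar>(?a z - ?a (z - w)) * kflux g (u z) (v (z - w)) * \<psi> z\<bar> \<le> 1 * L * P"
        unfolding abs_mult
        by (intro mult_mono kflux_le_unit ur vr P mult_nonneg_nonneg abs_ge_zero L_nonneg)
           (auto simp: indicator_def)
      then show "\<bar>(?a z - ?a (z - w)) * kflux g (u z) (v (z - w)) * \<psi> z\<bar> \<le> L * P" by simp
      assume z: "z \<notin> ?B"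
      show "(?a z - ?a (z - w)) * kflux g (u z) (v (z - w)) * \<psi> z = 0"
      proof (cases "z \<in> K")
        case True
        then have "z \<in> cbox (-b, -b) (b, b)" using b by auto
        with z that have "?a z = ?a (z - w)"
          by (cases z; cases w) (auto simp: indicator_def Om_def)
        then show ?thesis by simp
      qed (simp add: \<psi>(3))
    qed auto
    also have "measure lborel ?B = 2 * b * e\<^sup>2"
      using b by (subst content_Pair) auto
    finally show ?thesis by (simp add: M_def mult.assoc)
  qed
  have lim: "0 \<le> J 0 + \<eta>" if \<eta>: "0 < \<eta>" for \<eta>
  proof -
    have "eventually (\<lambda>w. \<omega> w < \<eta> / 2) (at 0)"
      using order_tendstoD(2)[OF \<omega>, of "\<eta> / 2"] \<eta> by simp
    then obtain d where d: "0 < d" "\<And>w. w \<noteq> 0 \<Longrightarrow> norm w < d \<Longrightarrow> \<omega> w < \<eta> / 2"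
      unfolding eventually_at by (auto simp: dist_norm)
    have \<omega>0: "\<omega> 0 = 0" by (simp add: \<omega>_def)
    obtain d' where d': "0 < d'" "\<And>x y. x \<in> K \<Longrightarrow> y \<in> G \<Longrightarrow> d' \<le> dist x y"
      using separate_compact_closed[OF \<psi>(2) G \<psi>(4)] by blast
    define k where "k = M * C + 1"
    have k0: "0 < k" unfolding k_def by (intro add_nonneg_pos mult_nonneg_nonneg M0 C(1) zero_less_one)
    \<comment> \<open>The bounds d / 3 and d' / 3 suffice because shifts in the kernel support have
      norm at most 2 e. The last entry makes the error from \<open>R\<close> at most \<eta> /
      2.\<close>
    define e where "e = Min {1, d / 3, d' / 3, \<eta> / 2 / k}"
    have e: "0 < e" "e \<le> 1" "2 * e < d" "2 * e < d'" "e \<le> \<eta> / 2 / k"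
      using d(1) d'(1) divide_pos_pos[OF half_gt_zero[OF \<eta>] k0] by (auto simp: e_def)
    have sep: "z - w \<notin> G" if "z \<in> K" "w \<in> {0..e} \<times> {0..e\<^sup>2}" for z w
    proof
      assume "z - w \<in> G"
      then have "d' \<le> norm w" using d'(2)[OF that(1), of "z - w"] by (simp add: dist_norm)
      then show False using norm_kern_support[OF e(2) that(2)] e(4) by simp
    qed
    note km = kato_mollified[OF u v \<psi> e(1) sep, folded J_def R_def]
    have ik: "integrable lborel (kern e)"
    proof (rule integrable_bdd[of _ "{0..e} \<times> {0..e\<^sup>2}"])
      have S: "compact ({0..e} \<times> {0..e\<^sup>2})" by (intro compact_Times) auto
      show "bdd (kern e)"
        by (rule bdd_compact_support[OF smooth_imp_continuous[OF smooth_kern] S kern_support[OF e(1)]])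
      show "bounded ({0..e} \<times> {0..e\<^sup>2})" by (rule compact_imp_bounded[OF S])
      show "kern e \<in> borel_measurable borel"
        by (intro borel_measurable_continuous_onI smooth_imp_continuous smooth_kern)
    qed (rule kern_support[OF e(1)])
    let ?B = "cbox (0, 0) (e, e\<^sup>2) :: (real \<times> real) set"
    have iB: "integrable lborel (indicator ?B :: real \<times> real \<Rightarrow> real)"
      by (rule integrable_bounded_support[of _ ?B 1]) auto
    define c where "c = C / e ^ 4 * (M * e\<^sup>2)"
    have "0 \<le> (\<integral>w. kern e w * J w + dx (kern e) w * R w \<partial>lborel)" by (rule km(2))
    also have "\<dots> \<le> (\<integral>w. kern e w * (J 0 + \<eta> / 2) + c * indicator ?B w \<partial>lborel)"
    proof (rule integral_mono[OF km(1)])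
      show "integrable lborel (\<lambda>w. kern e w * (J 0 + \<eta> / 2) + c * indicator ?B w)"
        using ik iB by simp
      fix w
      show "kern e w * J w + dx (kern e) w * R w \<le> kern e w * (J 0 + \<eta> / 2) + c * indicator ?B w"
      proof (cases "w \<in> {0..e} \<times> {0..e\<^sup>2}")
        case True
        then have "norm w < d" using norm_kern_support[OF e(2) True] e(3) by simp
        then have "\<omega> w \<le> \<eta> / 2" using d(2)[of w] \<omega>0 \<eta> by (cases "w = 0") auto
        then have "kern e w * J w \<le> kern e w * (J 0 + \<eta> / 2)"
          using JJ[of w] by (intro mult_left_mono kern_nonneg e(1)) auto
        moreover have "dx (kern e) w * R w \<le> c"
          unfolding c_def using C(1) e(1)
          by - (rule order_trans[OF abs_ge_self], unfold abs_mult, intro mult_mono C(2) RR True, auto)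
        moreover have "w \<in> ?B" using True by (cases w) auto
        ultimately show ?thesis by simp
      next
        case False
        have "closed ({0..e} \<times> {0..e\<^sup>2})" by (intro closed_Times) auto
        then have "dx (kern e) w = 0"
          by (rule dx_dt_eq_0(1)[OF _ kern_support[OF e(1)] False])
        moreover have "w \<notin> ?B" using False by (cases w) auto
        ultimately show ?thesis using kern_support[OF e(1) False] by simp
      qed
    qed
    also have "\<dots> = J 0 + \<eta> / 2 + c * measure lborel ?B"
      using ik iB integral_kern[OF e(1) ik] by simp
    finally have fin: "0 \<le> J 0 + \<eta> / 2 + c * measure lborel ?B" .
    have mB: "measure lborel ?B = e * e\<^sup>2"
      using e(1) by (subst content_Pair) auto
    have ce: "c * (e * e\<^sup>2) = M * C * e"
      using e(1) by (simp add: c_def power2_eq_square power4_eq_xxxx)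
    have "M * C * e \<le> k * e" using e(1) by (intro mult_right_mono) (simp_all add: k_def)
    moreover have "k * e \<le> \<eta> / 2"
      using e(5) k0 by (simp only: pos_le_divide_eq mult.commute)
    ultimately have "c * measure lborel ?B \<le> \<eta> / 2" unfolding mB ce by linarith
    with fin show ?thesis by linarith
  qed
  have "0 \<le> J 0"
    by (rule field_le_epsilon) (use lim in simp)
  then show ?thesis by (simp add: J_def)
qed

section \<open>Initial data as values at nonpositive times\<close>

lemma integral_dt_initial:
  fixes \<phi> :: "real \<times> real \<Rightarrow> real"
  assumes c[measurable]: "c \<in> borel_measurable borel" and cb: "bdd c"
    and \<phi>: "smooth \<phi>" "compact K" "\<And>z. z \<notin> K \<Longrightarrow> \<phi> z = 0"
  shows "(\<integral>z. indicator (- Om) z * c (fst z) * dt \<phi> z \<partial>lborel) = (\<integral>x. c x * \<phi> (x, 0) \<partial>lborel)"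
proof -
  have p0: "dt \<phi> z = 0" if "z \<notin> K" for z
    using that \<phi>(3) dx_dt_eq_0[OF compact_imp_closed[OF \<phi>(2)], of \<phi>] by auto
  have pm[measurable]: "dt \<phi> \<in> borel_measurable borel"
    by (intro borel_measurable_continuous_onI smooth_plane \<phi>(1))
  have pb: "bdd (dt \<phi>)"
    by (rule bdd_compact_support[OF smooth_plane(4)[OF \<phi>(1)] \<phi>(2) p0])
  have bK: "bounded K" by (rule compact_imp_bounded[OF \<phi>(2)])
  obtain a where a: "0 < a" "\<And>z. z \<in> K \<Longrightarrow> norm z < a"
    using bK by (metis bounded_pos_less)
  have out: "(x, t) \<notin> K" if "t \<le> - a" for x t
    using a(2)[of "(x, t)"] norm_snd_le[of t x] that by auto
  have i: "integrable lborel (\<lambda>z. indicator (- Om) z * c (fst z) * dt \<phi> z)"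
    by (rule integrable_bdd[OF _ _ bK], measurable, intro bdd_intros pb bdd_comp[OF cb], simp add: p0)
  have inner: "(\<integral>t. indicator (- Om) (x, t) * c x * dt \<phi> (x, t) \<partial>lborel) = c x * \<phi> (x, 0)" for x
  proof -
    \<comment> \<open>The test function vanishes at time -a and before, so integrating its time
      derivative over [-a, 0] leaves only its value at time 0.\<close>
    have "has_bochner_integral lborel (\<lambda>t. dt \<phi> (x, t) * indicator {-a..0} t) (\<phi> (x, 0) - \<phi> (x, -a))"
    proof (rule has_bochner_integral_FTC_Icc_real)
      show "((\<lambda>t. \<phi> (x, t)) has_real_derivative dt \<phi> (x, t)) (at t)" for t by (rule smooth_plane(2)[OF \<phi>(1)])
      show "isCont (\<lambda>t. dt \<phi> (x, t)) t" for t
      proof -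
        have "continuous_on UNIV (\<lambda>t. dt \<phi> (x, t))"
          by (rule continuous_on_compose2[OF smooth_plane(4)[OF \<phi>(1)]]) (auto intro!: continuous_intros)
        then show ?thesis by (simp add: continuous_on_eq_continuous_at)
      qed
    qed (use a in simp)
    moreover have "\<phi> (x, -a) = 0" using out[of "-a" x] \<phi>(3) by simp
    ultimately have h: "(\<integral>t. dt \<phi> (x, t) * indicator {-a..0} t \<partial>lborel) = \<phi> (x, 0)"
      by (simp add: has_bochner_integral_integral_eq)
    have eq: "indicator (- Om) (x, t) * c x * dt \<phi> (x, t) = c x * (dt \<phi> (x, t) * indicator {-a..0} t)" for t
      using p0[OF out, of t x] by (cases "t \<le> -a") (auto simp: indicator_def Om_def)
    show ?thesis unfolding eq integral_mult_right_zero h ..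
  qed
  have "(\<integral>z. indicator (- Om) z * c (fst z) * dt \<phi> z \<partial>lborel)
      = (\<integral>x. (\<integral>t. indicator (- Om) (x, t) * c x * dt \<phi> (x, t) \<partial>lborel) \<partial>lborel)"
    using lborel_pair.integral_fst[of "\<lambda>x t. indicator (- Om) (x, t) * c x * dt \<phi> (x, t)"] i
    by (simp add: lborel_prod case_prod_beta')
  then show ?thesis by (simp add: inner)
qed

definition clamp01 :: "real \<Rightarrow> real" where
  "clamp01 v = max 0 (min 1 v)"

lemma clamp01_range: "clamp01 v \<in> {0..1}"
  and clamp01_id: "v \<in> {0..1} \<Longrightarrow> clamp01 v = v"
  by (auto simp: clamp01_def)

lemma clamp01_measurable[measurable]: "clamp01 \<in> borel_measurable borel"
  unfolding clamp01_def by measurable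

lemma clamp01_lipschitz: "\<bar>clamp01 x - clamp01 y\<bar> \<le> \<bar>x - y\<bar>"
  by (auto simp: clamp01_def max_def min_def)

lemma Phi_eq_kflux:
  assumes "\<And>x. x \<in> {0..1} \<Longrightarrow> g x = f x" "a \<in> {0..1}" "b \<in> {0..1}"
  shows "Phi f s a b = kflux g a b - s * \<bar>a - b\<bar>"
  using assms by (auto simp: Phi_def F_def kflux_def max_def min_def sgn_if algebra_simps)

lemma Linf01_representative:
  fixes u :: "'a::euclidean_space \<Rightarrow> real"
  assumes "Linf01 S u" "S \<in> sets borel"
  obtains u0 where "u0 \<in> borel_measurable borel" "\<And>x. u0 x \<in> {0..1}"
    "AE x in lborel. x \<in> S \<longrightarrow> u x = u0 x"
proof -
  have S: "S \<in> sets lebesgue" using assms(2) by simp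
  have m: "u \<in> borel_measurable (lebesgue_on S)" and r: "AE x in lborel. x \<in> S \<longrightarrow> u x \<in> {0..1}"
    using assms(1) S by (auto simp: Linf01_def AE_lebesgue_on_iff)
  obtain v where v: "v \<in> borel_measurable borel" "AE x in lborel. x \<in> S \<longrightarrow> u x = v x"
    by (rule ex_borel_representative[OF m S])
  show thesis
  proof
    show "(\<lambda>x. clamp01 (v x)) \<in> borel_measurable borel" using v(1) by measurable
    show "clamp01 (v x) \<in> {0..1}" for x by (rule clamp01_range)
    show "AE x in lborel. x \<in> S \<longrightarrow> u x = clamp01 (v x)"
      using v(2) r by eventually_elim (auto simp: clamp01_id)
  qed
qed

text \<open>For t \<le> 0 the extended function does not depend on time and the flux is switched
  off, so that part of the integral is the integral of a time derivative and returns the initial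
  term. For t > 0 the integrand is that of the entropy inequality, up to null sets and the rewriting
  of \<open>Phi\<close> with s = 0 as \<open>kflux\<close>.\<close>

lemma (in lipschitz_flux) kruzkov_of_entropy_ineq:
  assumes gf: "\<And>x. x \<in> {0..1} \<Longrightarrow> g x = f x"
    and \<rho>\<^sub>o: "ro \<in> borel_measurable borel" "\<And>x. ro x \<in> {0..1}" "AE x in lborel. \<rho>\<^sub>o x = ro x"
    and \<rho>: "Linf01 Om \<rho>" and ent: "entropy_ineq f y \<rho>\<^sub>o \<rho>"
  obtains u where "kruzkov g (Gam y) u" "AE z in lborel. z \<in> Om \<longrightarrow> \<rho> z = u z"
    "\<And>z. z \<notin> Om \<Longrightarrow> u z = ro (fst z)"
proof -
  note [measurable] = \<rho>\<^sub>o(1)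
  obtain u0 where u0[measurable]: "u0 \<in> borel_measurable borel" and u0r: "\<And>x. u0 x \<in> {0..1}"
    and u0\<rho>: "AE z in lborel. z \<in> Om \<longrightarrow> \<rho> z = u0 z"
    using Linf01_representative[OF \<rho> Om_borel] by blast
  define u where "u z = (if z \<in> Om then u0 z else ro (fst z))" for z
  have um[measurable]: "u \<in> borel_measurable borel"
    unfolding u_def[abs_def] by measurable
  have ur: "u z \<in> {0..1}" for z using u0r \<rho>\<^sub>o(2) by (simp add: u_def)
  have ub: "bdd u" using ur by (intro bddI[of _ 1]) (simp add: abs_le_iff)
  have rb: "bdd ro" using \<rho>\<^sub>o(2) by (intro bddI[of _ 1]) (simp add: abs_le_iff)
  have "kruzkov g (Gam y) u"
    unfolding kruzkov_def
  proof (intro conjI allI impI um)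
    show "u z \<in> {0..1}" for z by (rule ur)
    fix \<phi> :: "real \<times> real \<Rightarrow> real" and K \<kappa>
    assume \<phi>: "smooth \<phi>" "compact K" "\<forall>z. z \<notin> K \<longrightarrow> \<phi> z = 0" "K \<inter> Gam y = {}" "\<forall>z. 0 \<le> \<phi> z"
      and \<kappa>: "\<kappa> \<in> {0..1::real}"
    have \<phi>0: "\<phi> z = 0" if "z \<notin> K" for z using \<phi>(3) that by blast
    have p0: "dx \<phi> z = 0" "dt \<phi> z = 0" if "z \<notin> K" for z
      using that \<phi>0 dx_dt_eq_0[OF compact_imp_closed[OF \<phi>(2)], of \<phi>] by auto
    have pm[measurable]: "dx \<phi> \<in> borel_measurable borel" "dt \<phi> \<in> borel_measurable borel"
      by (auto intro!: borel_measurable_continuous_onI smooth_plane \<phi>(1))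
    have pb: "bdd (dx \<phi>)" "bdd (dt \<phi>)"
      using bdd_compact_support[OF smooth_plane(3)[OF \<phi>(1)] \<phi>(2) p0(1)]
        bdd_compact_support[OF smooth_plane(4)[OF \<phi>(1)] \<phi>(2) p0(2)] by blast+
    have bK: "bounded K" by (rule compact_imp_bounded[OF \<phi>(2)])
    \<comment> \<open>\<open>Cc_infty\<close> asks for a compact support only inside the given set,
      so a test function on the plane may be nonzero at negative times; intersecting its support
      with the closed half-plane yields the required compact set.\<close>
    have "closed Om_bar" unfolding Om_bar_def by (intro closed_Times) auto
    then have "compact (K \<inter> Om_bar)" by (rule compact_Int_closed[OF \<phi>(2)])
    then have "\<phi> \<in> Cc_infty (Om_bar - Gam y)"
      using \<phi>(1,3,4) unfolding Cc_infty_def smooth_def by blast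
    then have I: "0 \<le> (LINT z:Om|lebesgue. \<bar>\<rho> z - \<kappa>\<bar> * dt \<phi> z + Phi f 0 (\<rho> z) \<kappa> * dx \<phi> z)
          + (LINT x|lebesgue. \<bar>\<rho>\<^sub>o x - \<kappa>\<bar> * \<phi> (x, 0))"
      using ent \<kappa> \<phi>(5) unfolding entropy_ineq_def by blast
    let ?A = "\<lambda>z. indicator Om z * (\<bar>u z - \<kappa>\<bar> * dt \<phi> z + kflux g (u z) \<kappa> * dx \<phi> z)"
    have A: "(LINT z:Om|lebesgue. \<bar>\<rho> z - \<kappa>\<bar> * dt \<phi> z + Phi f 0 (\<rho> z) \<kappa> * dx \<phi> z) = (\<integral>z. ?A z \<partial>lborel)"
      unfolding set_lebesgue_integral_def
    proof (rule lebesgue_integral_eq_lborel)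
      show "?A \<in> borel_measurable borel" by measurable
      show "AE z in lborel. indicator Om z *\<^sub>R (\<bar>\<rho> z - \<kappa>\<bar> * dt \<phi> z + Phi f 0 (\<rho> z) \<kappa> * dx \<phi> z) = ?A z"
        using u0\<rho>
      proof eventually_elim
        case (elim z)
        then show ?case using Phi_eq_kflux[where s=0, OF gf ur[of z] \<kappa>]
          by (cases "z \<in> Om") (auto simp: u_def)
      qed
    qed
    have B: "(LINT x|lebesgue. \<bar>\<rho>\<^sub>o x - \<kappa>\<bar> * \<phi> (x, 0)) = (\<integral>x. \<bar>ro x - \<kappa>\<bar> * \<phi> (x, 0) \<partial>lborel)"
    proof (rule lebesgue_integral_eq_lborel)
      have [measurable]: "\<phi> \<in> borel_measurable borel"
        by (intro borel_measurable_continuous_onI smooth_imp_continuous \<phi>(1))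
      have [measurable]: "(\<lambda>x. (x, 0::real)) \<in> borel_measurable (borel::real measure)"
        by (intro borel_measurable_continuous_onI continuous_intros)
      show "(\<lambda>x. \<bar>ro x - \<kappa>\<bar> * \<phi> (x, 0)) \<in> borel_measurable borel" by measurable
      show "AE x in lborel. \<bar>\<rho>\<^sub>o x - \<kappa>\<bar> * \<phi> (x, 0) = \<bar>ro x - \<kappa>\<bar> * \<phi> (x, 0)"
        using \<rho>\<^sub>o(3) by eventually_elim simp
    qed
    have C: "(\<integral>x. \<bar>ro x - \<kappa>\<bar> * \<phi> (x, 0) \<partial>lborel) = (\<integral>z. indicator (- Om) z * \<bar>ro (fst z) - \<kappa>\<bar> * dt \<phi> z \<partial>lborel)"
      by (rule integral_dt_initial[symmetric, OF _ _ \<phi>(1,2) \<phi>0]) (measurable, intro bdd_intros rb)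
    have iA: "integrable lborel ?A"
      by (rule integrable_bdd[OF _ _ bK], measurable, intro bdd_intros kflux_bdd ub pb, simp add: p0)
    have iC: "integrable lborel (\<lambda>z. indicator (- Om) z * \<bar>ro (fst z) - \<kappa>\<bar> * dt \<phi> z)"
      by (rule integrable_bdd[OF _ _ bK], measurable, intro bdd_intros bdd_comp[OF rb] pb, simp add: p0)
    have "(\<integral>z. \<bar>u z - \<kappa>\<bar> * dt \<phi> z + indicator Om z * kflux g (u z) \<kappa> * dx \<phi> z \<partial>lborel)
        = (\<integral>z. ?A z + indicator (- Om) z * \<bar>ro (fst z) - \<kappa>\<bar> * dt \<phi> z \<partial>lborel)"
      by (rule Bochner_Integration.integral_cong) (auto simp: u_def indicator_def)
    also have "\<dots> = (\<integral>z. ?A z \<partial>lborel) + (\<integral>z. indicator (- Om) z * \<bar>ro (fst z) - \<kappa>\<bar> * dt \<phi> z \<partial>lborel)"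
      by (rule Bochner_Integration.integral_add[OF iA iC])
    finally show "0 \<le> (\<integral>z. \<bar>u z - \<kappa>\<bar> * dt \<phi> z + indicator Om z * kflux g (u z) \<kappa> * dx \<phi> z \<partial>lborel)"
      using I by (simp add: A B C)
  qed
  moreover have "AE z in lborel. z \<in> Om \<longrightarrow> \<rho> z = u z"
    using u0\<rho> by eventually_elim (simp add: u_def)
  moreover have "u z = ro (fst z)" if "z \<notin> Om" for z using that by (simp add: u_def)
  ultimately show thesis by (rule that)
qed

subsection \<open>Smooth approximation of the trajectory\<close>

lemma smooth_derivative_smooth:
  assumes "smooth (g::real \<Rightarrow> real)"
  obtains g' where "\<And>x. (g has_real_derivative g' x) (at x)" "smooth g'"
proof -
  obtain g' where g': "\<And>x. (g has_real_derivative g' x) (at x)"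
    using smooth_derivative[OF assms] by blast
  have "Ck k g'" for k
  proof -
    obtain h where "\<And>x. (g has_real_derivative h x) (at x)" "Ck k h"
      using assms Ck_Suc_real[of k g] unfolding smooth_def by blast
    moreover from this(1) have "h = g'" using DERIV_unique g' by blast
    ultimately show ?thesis by simp
  qed
  then have "smooth g'" by (simp add: smooth_def)
  with g' show thesis by (rule that)
qed

lemma convolution_has_derivative:
  fixes c g :: "real \<Rightarrow> real"
  assumes c: "continuous_on {a..b} c" and g: "\<And>x. (g has_real_derivative g' x) (at x)"
    and g': "continuous_on UNIV g'"
  shows "((\<lambda>t. integral {a..b} (\<lambda>s. c s * g (s - t))) has_real_derivative
      integral {a..b} (\<lambda>s. c s * - g' (s - t))) (at t)"
proof -
  have gc: "continuous_on UNIV g"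
    using g by (intro continuous_at_imp_continuous_on ballI DERIV_isCont)
  have "((\<lambda>t. integral (cbox a b) (\<lambda>s. c s * g (s - t))) has_field_derivative
      integral (cbox a b) (\<lambda>s. c s * - g' (s - t))) (at t within UNIV)"
  proof (rule leibniz_rule_field_derivative)
    show "((\<lambda>t. c s * g (s - t)) has_field_derivative c s * - g' (s - t)) (at t within UNIV)" for t s
    proof -
      have "((\<lambda>t. g (s - t)) has_real_derivative g' (s - t) * - 1) (at t)"
        by (rule DERIV_chain2[OF g]) (auto intro!: derivative_eq_intros)
      from DERIV_cmult[OF this, of "c s"] show ?thesis by simp
    qed
    show "(\<lambda>s. c s * g (s - t)) integrable_on cbox a b" for t
      unfolding cbox_interval
      by (intro integrable_continuous_interval continuous_intros c continuous_on_compose2[OF gc]) auto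
    show "continuous_on (UNIV \<times> cbox a b) (\<lambda>(t, s). c s * - g' (s - t))"
      unfolding case_prod_beta cbox_interval
      by (intro continuous_intros continuous_on_compose2[OF c continuous_on_snd]
          continuous_on_compose2[OF g']) (auto intro!: continuous_intros)
  qed auto
  then show ?thesis by (simp add: cbox_interval)
qed

lemma smooth_convolution:
  assumes c: "continuous_on {a..b} c" and g: "smooth g"
  shows "smooth (\<lambda>t::real. integral {a..b} (\<lambda>s. c s * g (s - t)))"
proof -
  have "Ck k (\<lambda>t::real. integral {a..b} (\<lambda>s. c s * g (s - t)))" for k
    using g
  proof (induction k arbitrary: g)
    case 0
    obtain g' where g': "\<And>x. (g has_real_derivative g' x) (at x)" "smooth g'"
      using smooth_derivative_smooth[OF 0] by blast
    have "\<forall>t. isCont (\<lambda>t. integral {a..b} (\<lambda>s. c s * g (s - t))) t"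
      using DERIV_isCont[OF convolution_has_derivative[OF c g'(1) smooth_imp_continuous[OF g'(2)]]] by blast
    then show ?case by (simp add: continuous_on_eq_continuous_at)
  next
    case (Suc k)
    obtain g' where g': "\<And>x. (g has_real_derivative g' x) (at x)" "smooth g'"
      using smooth_derivative_smooth[OF Suc.prems] by blast
    have "smooth (\<lambda>x. - g' x)"
      using smooth_mult[OF smooth_const[of "-1"] g'(2)] by simp
    from Suc.IH[OF this] show ?case unfolding Ck_Suc_real
      using convolution_has_derivative[OF c g'(1) smooth_imp_continuous[OF g'(2)]]
      by (intro exI[of _ "\<lambda>t. integral {a..b} (\<lambda>s. c s * - g' (s - t))"]) simp
  qed
  then show ?thesis by (simp add: smooth_def)
qed

text \<open>The trajectory is convolved with a forward kernel of width \<open>h n\<close>. That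
  kernel is itself admissible in the weak formulation, so the derivative of the mollified trajectory
  is the mollification of the weak derivative. This yields the uniform bound \<open>C\<close> and,
  by continuity of translations, L^1 convergence of the derivatives; a subsequence converges almost
  everywhere, as dominated convergence will require.\<close>

lemma smooth_approximation:
  assumes W: "W1inf_loc y dy" and T: "0 < T"
  obtains e Y Y' C where
    "e \<in> borel_measurable borel" "0 \<le> C" "\<And>t. \<bar>e t\<bar> \<le> C" "AE t in lborel. t \<in> {0<..<T} \<longrightarrow> e t = dy t"
    "\<And>n. smooth (Y n)" "\<And>n t. (Y n has_real_derivative Y' n t) (at t)"
    "\<And>n t. t \<in> {0<..<T} \<Longrightarrow> \<bar>Y' n t\<bar> \<le> C"
    "\<And>\<eta>. 0 < \<eta> \<Longrightarrow> eventually (\<lambda>n::nat. \<forall>t\<in>{0..T}. \<bar>Y n t - y t\<bar> \<le> \<eta>) sequentially"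
    "AE t in lborel. t \<in> {0<..<T} \<longrightarrow> (\<lambda>n. Y' n t) \<longlonglongrightarrow> e t"
proof -
  have yc: "continuous_on {0..} y" and Ldy: "Linf_loc dy"
    and weak: "\<And>\<psi>. \<psi> \<in> Cc_infty {0<..} \<Longrightarrow>
        (LINT t:{0<..}|lebesgue. y t * deriv \<psi> t) = - (LINT t:{0<..}|lebesgue. dy t * \<psi> t)"
    using W unfolding W1inf_loc_def by blast+
  \<comment> \<open>The kernel width is at most 1, so for t \<le> T only times up to T + 1 are
    sampled; the margin puts them before \<open>S\<close>.\<close>
  define S where "S = T + 2"
  have S: "0 < S" "T + 1 < S" using T by (auto simp: S_def)
  have yS: "continuous_on {0..S} y" by (rule continuous_on_subset[OF yc]) auto
  obtain C0 where C0: "AE t in lborel. t \<in> {0<..<S} \<longrightarrow> \<bar>dy t\<bar> \<le> C0"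
    using Ldy S unfolding Linf_loc_def by (auto simp: AE_lebesgue_on_iff)
  define C where "C = \<bar>C0\<bar>"
  have C: "0 \<le> C" by (simp add: C_def)
  obtain e0 where e0[measurable]: "e0 \<in> borel_measurable borel" and e0dy: "AE t in lborel. t \<in> {0<..} \<longrightarrow> dy t = e0 t"
    using ex_borel_representative[of dy "{0<..}"] Ldy unfolding Linf_loc_def by auto
  \<comment> \<open>A bounded Borel function equal to \<open>dy\<close> almost everywhere on (0,S),
    set to 0 elsewhere so that its convolution is defined for every t.\<close>
  define e where "e t = (if t \<in> {0<..<S} then max (-C) (min C (e0 t)) else 0)" for t
  have em[measurable]: "e \<in> borel_measurable borel" unfolding e_def[abs_def] by measurable
  have eC: "\<bar>e t\<bar> \<le> C" for t using C by (auto simp: e_def)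
  have edy: "AE t in lborel. t \<in> {0<..<S} \<longrightarrow> e t = dy t"
    using C0 e0dy
  proof eventually_elim
    case (elim t)
    then show ?case by (auto simp: e_def C_def max_def min_def abs_if split: if_splits)
  qed
  define h where "h n = 1 / (real n + 1)" for n
  have h: "0 < h n" "h n \<le> 1" for n by (auto simp: h_def)
  define k where "k n s = bump (s / h n) / h n" for n s
  have ks: "smooth (k n)" for n
    unfolding k_def by (intro smooth_intros smooth_comp[OF smooth_bump])
  have kc: "continuous_on UNIV (k n)" for n by (rule smooth_imp_continuous[OF ks])
  have km[measurable]: "k n \<in> borel_measurable borel" for n by (rule borel_measurable_continuous_onI[OF kc])
  have k0: "k n s = 0" if "s \<notin> {0..h n}" for n s
    using that h[of n] by (auto simp: k_def divide_le_0_iff pos_le_divide_eq intro!: bump_eq_0)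
  have kb: "bdd (k n)" for n by (rule bdd_compact_support[OF kc, of "{0..h n}"]) (auto simp: k0)
  have k_nonneg: "0 \<le> k n s" for n s using h[of n] by (simp add: k_def bump_nonneg)
  have kint: "(\<integral>s. k n (s - t) \<partial>lborel) = 1" for n t
    using integral_bump_affine[of "h n" t] h[of n] by (simp add: k_def)
  have ik: "integrable lborel (\<lambda>s. k n (s - t))" for n t
  proof (rule integrable_bdd[of _ "{t..t + h n}"])
    show "bdd (\<lambda>s. k n (s - t))" by (rule bdd_comp[OF kb])
  qed (auto intro!: k0)
  obtain k' where k': "\<And>n x. (k n has_real_derivative k' n x) (at x)" "\<And>n. smooth (k' n)"
  proof -
    have "\<exists>k'. (\<forall>x. (k n has_real_derivative k' x) (at x)) \<and> smooth k'" for n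
      using smooth_derivative_smooth[OF ks[of n]] by blast
    then have "\<forall>n. \<exists>k'. (\<forall>x. (k n has_real_derivative k' x) (at x)) \<and> smooth k'" by blast
    from choice[OF this] show thesis using that by blast
  qed
  have k'0: "k' n s = 0" if "s \<notin> {0..h n}" for n s
  proof -
    have "eventually (\<lambda>s. k n s = 0) (nhds s)"
      by (rule eventually_mono[OF eventually_nhds_in_open[of "- {0..h n}"]]) (use that k0 in auto)
    then have "(k n has_real_derivative k' n s) (at s) \<longleftrightarrow> ((\<lambda>_. 0) has_real_derivative k' n s) (at s)"
      by (intro DERIV_cong_ev) auto
    then show ?thesis using k'(1) DERIV_unique[OF _ DERIV_const] by blast
  qed
  define Z where "Z n t = integral {0..S} (\<lambda>s. y s * k n (s - t))" for n t
  define Z' where "Z' n t = integral {0..S} (\<lambda>s. y s * - k' n (s - t))" for n t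
  have Zs: "smooth (Z n)" for n unfolding Z_def[abs_def] by (rule smooth_convolution[OF yS ks])
  have ZD: "(Z n has_real_derivative Z' n t) (at t)" for n t
    unfolding Z_def[abs_def] Z'_def by (rule convolution_has_derivative[OF yS k'(1) smooth_imp_continuous[OF k'(2)]])
  have Z'm[measurable]: "Z' n \<in> borel_measurable borel" for n
  proof -
    have "smooth (\<lambda>x. - k' n x)" using smooth_mult[OF smooth_const[of "-1"] k'(2)] by simp
    from smooth_imp_continuous[OF smooth_convolution[OF yS this]]
    show ?thesis unfolding Z'_def[abs_def] by (rule borel_measurable_continuous_onI)
  qed
  have Z'e: "Z' n t = (\<integral>s. e s * k n (s - t) \<partial>lborel)" if t: "t \<in> {0<..<T}" for n t
  proof -
    let ?\<psi> = "\<lambda>s. k n (s - t)"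
    have D: "(?\<psi> has_real_derivative k' n (s - t)) (at s)" for s
    proof -
      have "((\<lambda>s. s - t) has_real_derivative 1) (at s)" by (auto intro!: derivative_eq_intros)
      from DERIV_chain2[OF k'(1) this, of n] show ?thesis by simp
    qed
    have "smooth ?\<psi>" by (intro smooth_comp[OF ks] smooth_intros)
    moreover have "?\<psi> s = 0" if "s \<notin> {t..t + h n}" for s using that by (intro k0) auto
    ultimately have "?\<psi> \<in> Cc_infty {0<..}"
      using t unfolding Cc_infty_def smooth_def by (auto intro!: exI[of _ "{t..t + h n}"])
    from weak[OF this] have w: "(LINT s:{0<..}|lebesgue. y s * k' n (s - t)) = - (LINT s:{0<..}|lebesgue. dy s * k n (s - t))"
      by (simp add: DERIV_imp_deriv[OF D])
    have c: "continuous_on {0..S} (\<lambda>s. y s * k' n (s - t))"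
      by (intro continuous_intros yS continuous_on_compose2[OF smooth_imp_continuous[OF k'(2)]]) auto
    have out: "s - t \<notin> {0..h n}" if "s \<notin> {0<..<S}" for s
      using that t S h(2)[of n] by auto
    have "(LINT s:{0<..}|lebesgue. y s * k' n (s - t)) = (LINT s:{0..S}|lebesgue. y s * k' n (s - t))"
      unfolding set_lebesgue_integral_def
    proof (rule Bochner_Integration.integral_cong[OF refl])
      show "indicat_real {0<..} s *\<^sub>R (y s * k' n (s - t)) = indicat_real {0..S} s *\<^sub>R (y s * k' n (s - t))" for s
        using k'0[OF out, of s] by (cases "s \<in> {0<..<S}") auto
    qed
    also have "\<dots> = integral {0..S} (\<lambda>s. y s * k' n (s - t))"
      by (rule set_lebesgue_integral_eq_integral(2)[OF absolutely_integrable_continuous_real[OF c]])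
    also have "\<dots> = - Z' n t" by (simp add: Z'_def)
    finally have "Z' n t = (LINT s:{0<..}|lebesgue. dy s * k n (s - t))" using w by simp
    also have "\<dots> = (\<integral>s. e s * k n (s - t) \<partial>lborel)"
      unfolding set_lebesgue_integral_def
    proof (rule lebesgue_integral_eq_lborel)
      show "AE s in lborel. indicat_real {0<..} s *\<^sub>R (dy s * k n (s - t)) = e s * k n (s - t)"
        using edy
      proof eventually_elim
        case (elim s)
        then show ?case using k0[OF out, of s] by (cases "s \<in> {0<..<S}") auto
      qed
    qed measurable
    finally show ?thesis .
  qed
  have iek: "integrable lborel (\<lambda>s. e s * k n (s - t))" for n t
  proof (rule integrable_bdd[of _ "{t..t + h n}"])
    show "bdd (\<lambda>s. e s * k n (s - t))" by (intro bdd_mult bdd_comp[OF kb] bddI[of e, OF eC])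
  qed (auto intro!: k0)
  have Z'C: "\<bar>Z' n t\<bar> \<le> C" if "t \<in> {0<..<T}" for n t
  proof -
    have "\<bar>Z' n t\<bar> \<le> (\<integral>s. \<bar>e s * k n (s - t)\<bar> \<partial>lborel)"
      unfolding Z'e[OF that] by (rule integral_abs_bound)
    also have "\<dots> \<le> (\<integral>s. C * k n (s - t) \<partial>lborel)"
    proof (rule integral_mono)
      show "\<bar>e s * k n (s - t)\<bar> \<le> C * k n (s - t)" for s
        using k_nonneg eC by (simp add: abs_mult mult_right_mono)
    qed (use iek ik in \<open>simp_all only: integrable_abs integrable_mult_right\<close>)
    also have "\<dots> = C" by (simp add: kint)
    finally show ?thesis .
  qed
  have hlim: "h \<longlonglongrightarrow> 0"
    unfolding h_def using LIMSEQ_inverse_real_of_nat by (simp add: inverse_eq_divide add.commute)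
  have unif: "eventually (\<lambda>n. \<forall>t\<in>{0..T}. \<bar>Z n t - y t\<bar> \<le> \<eta>) sequentially" if \<eta>: "0 < \<eta>" for \<eta>
  proof -
    have "uniformly_continuous_on {0..S} y" by (intro compact_uniformly_continuous yS) auto
    then obtain d where d: "0 < d" "\<And>s t. s \<in> {0..S} \<Longrightarrow> t \<in> {0..S} \<Longrightarrow> dist s t < d \<Longrightarrow> dist (y s) (y t) < \<eta>"
      using \<eta> unfolding uniformly_continuous_on_def by metis
    show ?thesis using order_tendstoD(2)[OF hlim d(1)]
    proof (rule eventually_mono, intro ballI)
      fix n t assume hn: "h n < d" and t: "t \<in> {0..T}"
      have ki: "integral {0..S} (\<lambda>s. k n (s - t)) = 1"
      proof -
        have "integral {0..S} (\<lambda>s. k n (s - t)) = integral UNIV (\<lambda>s. if s \<in> {0..S} then k n (s - t) else 0)"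
          by (rule integral_restrict_UNIV[symmetric])
        also have "\<dots> = integral UNIV (\<lambda>s. k n (s - t))"
        proof (rule integral_cong)
          have "k n (s - t) = 0" if "s \<notin> {0..S}" for s
            using t S h(2)[of n] that by (intro k0) auto
          then show "(if s \<in> {0..S} then k n (s - t) else 0) = k n (s - t)" for s by simp
        qed
        also have "\<dots> = 1" using integral_lborel[OF ik] kint by simp
        finally show ?thesis .
      qed
      have kic: "continuous_on {0..S} (\<lambda>s. k n (s - t))"
        by (intro continuous_intros continuous_on_compose2[OF kc]) auto
      have "Z n t - y t = integral {0..S} (\<lambda>s. y s * k n (s - t)) - integral {0..S} (\<lambda>s. y t * k n (s - t))"
        by (simp add: Z_def ki)
      also have "\<dots> = integral {0..S} (\<lambda>s. y s * k n (s - t) - y t * k n (s - t))"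
        by (intro integral_diff[symmetric] integrable_continuous_interval continuous_intros yS kic)
      finally have "\<bar>Z n t - y t\<bar> = norm (integral {0..S} (\<lambda>s. y s * k n (s - t) - y t * k n (s - t)))" by simp
      also have "\<dots> \<le> integral {0..S} (\<lambda>s. \<eta> * k n (s - t))"
      proof (rule integral_norm_bound_integral)
        show "norm (y s * k n (s - t) - y t * k n (s - t)) \<le> \<eta> * k n (s - t)" if s: "s \<in> {0..S}" for s
        proof (cases "s - t \<in> {0..h n}")
          case True
          then have "\<bar>y s - y t\<bar> \<le> \<eta>" using d(2)[OF s, of t] t S hn by (auto simp: dist_real_def)
          then have "\<bar>y s - y t\<bar> * k n (s - t) \<le> \<eta> * k n (s - t)" by (intro mult_right_mono k_nonneg)
          then show ?thesis using k_nonneg[of n "s - t"] by (simp add: abs_mult flip: left_diff_distrib)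
        qed (simp add: k0)
      qed (intro integrable_continuous_interval continuous_intros yS kic)+
      also have "\<dots> = \<eta>" by (simp add: ki)
      finally show "\<bar>Z n t - y t\<bar> \<le> \<eta>" .
    qed
  qed
  let ?I = "indicat_real {0<..<T}"
  define U where "U n t = ?I t * (Z' n t - e t)" for n t
  have Um: "U n \<in> borel_measurable borel" for n unfolding U_def[abs_def] by measurable
  have Ub: "\<bar>U n t\<bar> \<le> 2 * C" for n t
    using Z'C[of t n] eC[of t] C by (cases "t \<in> {0<..<T}") (auto simp: U_def)
  have U_int: "integrable lborel (U n)" for n
    by (rule integrable_bounded_support[OF Um bounded_Ioo[of 0 T] Ub]) (simp add: U_def)
  define \<omega> where "\<omega> w = (\<integral>t. \<bar>e t - e (t - w)\<bar> * \<bar>?I t\<bar> \<partial>lborel)" for w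
  have \<omega>: "(\<omega> \<longlongrightarrow> 0) (at 0)"
    unfolding \<omega>_def[abs_def]
    by (rule integral_translation_tendsto[OF em eC _ _ _, of ?I 1 "{0<..<T}"]) (auto simp: bounded_Ioo)
  have \<omega>00: "\<omega> 0 = 0" by (simp add: \<omega>_def)
  have L1: "(\<lambda>n. \<integral>t. norm (U n t) \<partial>lborel) \<longlonglongrightarrow> 0"
  proof (rule LIMSEQ_I)
    fix \<eta> :: real assume \<eta>: "0 < \<eta>"
    have "eventually (\<lambda>w. \<omega> w < \<eta> / 2) (at 0)"
      using order_tendstoD(2)[OF \<omega>, of "\<eta> / 2"] \<eta> by simp
    then obtain d where d: "0 < d" "\<And>w. w \<noteq> 0 \<Longrightarrow> norm w < d \<Longrightarrow> \<omega> w < \<eta> / 2"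
      unfolding eventually_at by (auto simp: dist_norm)
    obtain N where N: "\<And>n. n \<ge> N \<Longrightarrow> h n < d"
      using order_tendstoD(2)[OF hlim d(1)] unfolding eventually_sequentially by blast
    have "(\<integral>t. norm (U n t) \<partial>lborel) < \<eta>" if "n \<ge> N" for n
    proof -
      \<comment> \<open>By Fubini, the L^1 distance is at most the kernel average of the translation
        modulus \<omega> over shifts of length at most \<open>h n\<close>.\<close>
      let ?H = "\<lambda>t w. \<bar>e t - e (t + w)\<bar> * ?I t * k n w"
      have iH: "integrable lborel (\<lambda>p. ?H (fst p) (snd p))"
      proof (rule integrable_bdd[of _ "{0<..<T} \<times> {0..h n}"])
        show "bdd (\<lambda>p. \<bar>e (fst p) - e (fst p + snd p)\<bar> * ?I (fst p) * k n (snd p))"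
          using bddI[of e, OF eC] kb[of n] by (intro bdd_intros) (auto intro: bdd_comp)
        show "bounded ({0<..<T} \<times> {0..h n})" by (intro bounded_Times bounded_Ioo bounded_closed_interval)
        show "?H (fst p) (snd p) = 0" if "p \<notin> {0<..<T} \<times> {0..h n}" for p
          using that k0[of "snd p" n] by (cases p) (auto simp: indicator_def)
      qed measurable
      have F: "integrable (lborel \<Otimes>\<^sub>M lborel) (\<lambda>(t, w). ?H t w)"
        using iH unfolding lborel_prod case_prod_beta' .
      have "(\<integral>t. norm (U n t) \<partial>lborel) \<le> (\<integral>t. (\<integral>w. ?H t w \<partial>lborel) \<partial>lborel)"
      proof (rule integral_mono)
        show "integrable lborel (\<lambda>t. norm (U n t))" using U_int by (rule integrable_norm)
        show "integrable lborel (\<lambda>t. \<integral>w. ?H t w \<partial>lborel)" using lborel_pair.integrable_fst[OF F] .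
        fix t
        show "norm (U n t) \<le> (\<integral>w. ?H t w \<partial>lborel)"
        proof (cases "t \<in> {0<..<T}")
          case True
          have ikt: "integrable lborel (\<lambda>s. e t * k n (s - t))" using ik by simp
          have "Z' n t - e t = (\<integral>s. e s * k n (s - t) \<partial>lborel) - (\<integral>s. e t * k n (s - t) \<partial>lborel)"
            by (simp add: Z'e[OF True] kint)
          also have "\<dots> = (\<integral>s. e s * k n (s - t) - e t * k n (s - t) \<partial>lborel)"
            by (rule Bochner_Integration.integral_diff[OF iek ikt, symmetric])
          finally have "norm (U n t) = \<bar>\<integral>s. e s * k n (s - t) - e t * k n (s - t) \<partial>lborel\<bar>"
            using True by (simp add: U_def)
          also have "\<dots> \<le> (\<integral>s. \<bar>e s * k n (s - t) - e t * k n (s - t)\<bar> \<partial>lborel)"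
            by (rule integral_abs_bound)
          also have "\<dots> = (\<integral>s. \<bar>e t - e s\<bar> * k n (s - t) \<partial>lborel)"
            using k_nonneg by (intro Bochner_Integration.integral_cong refl)
              (simp add: abs_mult abs_minus_commute flip: left_diff_distrib)
          also have "\<dots> = (\<integral>w. \<bar>e t - e (t + w)\<bar> * k n (t + w - t) \<partial>lborel)"
            by (rule lborel_integral_translation') measurable
          also have "\<dots> = (\<integral>w. ?H t w \<partial>lborel)" using True by simp
          finally show ?thesis .
        qed (simp add: U_def)
      qed
      also have "\<dots> = (\<integral>w. (\<integral>t. ?H t w \<partial>lborel) \<partial>lborel)"
        by (rule lborel_pair.Fubini_integral[OF F, symmetric])
      also have "\<dots> = (\<integral>w. \<omega> (- w) * k n w \<partial>lborel)"
        by (simp add: \<omega>_def)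
      also have "\<dots> \<le> (\<integral>w. \<eta> / 2 * k n w \<partial>lborel)"
      proof (rule integral_mono)
        show "integrable lborel (\<lambda>w. \<omega> (- w) * k n w)"
          using lborel_pair.integrable_snd[OF F] by (simp add: \<omega>_def)
        show "integrable lborel (\<lambda>w. \<eta> / 2 * k n w)" using ik[of n 0] by simp
        show "\<omega> (- w) * k n w \<le> \<eta> / 2 * k n w" for w
        proof (cases "w \<in> {0..h n}")
          case True
          then have "\<omega> (- w) \<le> \<eta> / 2"
            using d(2)[of "- w"] N[OF that] \<omega>00 \<eta> by (cases "w = 0") auto
          then show ?thesis by (intro mult_right_mono k_nonneg)
        qed (simp add: k0)
      qed
      also have "\<dots> = \<eta> / 2" using kint[of n 0] by simp
      also have "\<dots> < \<eta>" using \<eta> by simp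
      finally show ?thesis .
    qed
    then show "\<exists>no. \<forall>n\<ge>no. norm ((\<integral>t. norm (U n t) \<partial>lborel) - 0) < \<eta>"
      by (intro exI[of _ N]) (simp add: integral_nonneg_AE)
  qed
  obtain r :: "nat \<Rightarrow> nat" where r: "strict_mono r" "AE t in lborel. (\<lambda>n. U (r n) t) \<longlonglongrightarrow> 0"
    using tendsto_L1_AE_subseq[OF U_int L1] by blast
  show thesis
  proof (rule that[of e C "\<lambda>n. Z (r n)" "\<lambda>n. Z' (r n)"])
    show "AE t in lborel. t \<in> {0<..<T} \<longrightarrow> e t = dy t"
      using edy by eventually_elim (use S in auto)
    show "eventually (\<lambda>n. \<forall>t\<in>{0..T}. \<bar>Z (r n) t - y t\<bar> \<le> \<eta>) sequentially" if "0 < \<eta>" for \<eta>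
      by (rule eventually_subseq[OF r(1) unif[OF that]])
    show "AE t in lborel. t \<in> {0<..<T} \<longrightarrow> (\<lambda>n. Z' (r n) t) \<longlonglongrightarrow> e t"
      using r(2)
    proof eventually_elim
      case (elim t)
      then show ?case
        using Lim_null[of "\<lambda>n. Z' (r n) t" "e t" sequentially] by (auto simp: U_def)
    qed
  qed (use em C eC Zs ZD Z'C in auto)
qed

subsection \<open>Traces along the trajectory\<close>

text \<open>In the rescaled variable (x - y(t)) / h one definition serves both sides of the
  trajectory: I = (0,1) is the right strip of width h and I = (-1,0) the left one.\<close>

definition strip :: "(real \<Rightarrow> real) \<Rightarrow> real \<Rightarrow> real set \<Rightarrow> real \<Rightarrow> (real \<times> real) set" where
  "strip y T I h = {(x, t). 0 < t \<and> t < T \<and> (x - y t) / h \<in> I}"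

lemma strip_borel:
  assumes [measurable]: "y \<in> borel_measurable borel" "I \<in> sets borel"
  shows "strip y T I h \<in> sets borel"
proof -
  have "strip y T I h = {z \<in> space borel. snd z \<in> {0<..<T} \<and> (fst z - y (snd z)) / h \<in> I}"
    by (auto simp: strip_def)
  also have "\<dots> \<in> sets borel" by measurable
  finally show ?thesis .
qed

lemma bounded_strip:
  assumes y: "continuous_on UNIV y" and h: "0 < h" "h \<le> 1" and I: "I \<subseteq> {-1..1}"
  shows "bounded (strip y T I h)"
proof -
  have "bounded (y ` {0..T})"
    by (intro compact_imp_bounded compact_continuous_image continuous_on_subset[OF y]) auto
  then obtain B where "\<forall>s\<in>y ` {0..T}. norm s \<le> B" unfolding bounded_iff by blast
  then have B: "\<bar>y t\<bar> \<le> B" if "t \<in> {0..T}" for t using that by simp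
  have "strip y T I h \<subseteq> {- (B + 1)..B + 1} \<times> {0..T}"
  proof
    fix z assume z: "z \<in> strip y T I h"
    obtain x t where xt: "z = (x, t)" by (cases z)
    have t: "0 < t" "t < T" and i: "(x - y t) / h \<in> {-1..1}" using z I by (auto simp: xt strip_def)
    have "\<bar>x - y t\<bar> \<le> h" using i h by (auto simp: field_simps abs_le_iff)
    then show "z \<in> {- (B + 1)..B + 1} \<times> {0..T}" using B[of t] t h by (auto simp: xt abs_le_iff)
  qed
  moreover have "bounded ({- (B + 1)..B + 1} \<times> {0..T})" by (intro bounded_Times bounded_closed_interval)
  ultimately show ?thesis using bounded_subset by blast
qed

text \<open>At fixed t the substitution x = y(t) + h s has Jacobian h, which cancels the factor 1 /
  h; what remains is a product of two one-dimensional integrals.\<close>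

lemma integral_strip:
  fixes y m c :: "real \<Rightarrow> real"
  assumes y: "continuous_on UNIV y" and h: "0 < h" "h \<le> 1"
    and m[measurable]: "m \<in> borel_measurable borel" and mb: "bdd m" and I: "I \<subseteq> {-1..1}" "\<And>z. z \<notin> I \<Longrightarrow> m z = 0"
    and c[measurable]: "c \<in> borel_measurable borel" and cb: "bdd c"
  shows "integrable lborel (\<lambda>z. indicat_real {0<..<T} (snd z) * c (snd z) * (m ((fst z - y (snd z)) / h) / h))"
    and "(\<integral>z. indicator {0<..<T} (snd z) * c (snd z) * (m ((fst z - y (snd z)) / h) / h) \<partial>lborel)
      = (\<integral>x. m x \<partial>lborel) * (\<integral>t. indicator {0<..<T} t * c t \<partial>lborel)"
proof -
  let ?f = "\<lambda>z. indicat_real {0<..<T} (snd z) * c (snd z) * (m ((fst z - y (snd z)) / h) / h)"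
  have ym[measurable]: "y \<in> borel_measurable borel" by (rule borel_measurable_continuous_onI[OF y])
  show i: "integrable lborel ?f"
  proof (rule integrable_bdd[OF _ _ bounded_strip[OF y h I(1), of T]])
    show "bdd ?f" unfolding divide_inverse by (intro bdd_intros bdd_comp[OF cb] bdd_comp[OF mb])
    show "?f z = 0" if "z \<notin> strip y T I h" for z
      using that I(2) by (cases z) (auto simp: strip_def indicator_def)
  qed measurable
  have inner: "(\<integral>x. ?f (x, t) \<partial>lborel) = (\<integral>x. m x \<partial>lborel) * (indicator {0<..<T} t * c t)" for t
  proof -
    have "(\<integral>x. m ((x - y t) / h) / h \<partial>lborel) = (\<integral>x. m x \<partial>lborel)"
      using lborel_integral_real_affine[of h "\<lambda>x. m ((x - y t) / h) / h" "y t"] h by simp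
    then have "(\<integral>x. (indicat_real {0<..<T} t * c t) * (m ((x - y t) / h) / h) \<partial>lborel)
        = (indicat_real {0<..<T} t * c t) * (\<integral>x. m x \<partial>lborel)"
      by (simp only: integral_mult_right_zero)
    then show ?thesis by (simp only: fst_conv snd_conv mult.commute)
  qed
  have "(\<integral>z. ?f z \<partial>lborel) = (\<integral>t. (\<integral>x. ?f (x, t) \<partial>lborel) \<partial>lborel)"
  proof -
    have "integrable (lborel \<Otimes>\<^sub>M lborel) (\<lambda>(x, t). ?f (x, t))"
      using i unfolding lborel_prod case_prod_beta' prod.collapse .
    from lborel_pair.integral_snd[OF this] show ?thesis
      unfolding lborel_prod case_prod_beta' prod.collapse ..
  qed
  then show "(\<integral>z. ?f z \<partial>lborel) = (\<integral>x. m x \<partial>lborel) * (\<integral>t. indicator {0<..<T} t * c t \<partial>lborel)"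
    unfolding inner by simp
qed

definition has_trace :: "(real \<Rightarrow> real) \<Rightarrow> real \<Rightarrow> real set \<Rightarrow> (real \<times> real \<Rightarrow> real) \<Rightarrow> (real \<Rightarrow> real) \<Rightarrow> bool" where
  "has_trace y T I u \<gamma> \<longleftrightarrow> \<gamma> \<in> borel_measurable borel \<and> (\<forall>t. \<gamma> t \<in> {0..1}) \<and>
     ((\<lambda>h. (\<integral>z. indicator (strip y T I h) z * \<bar>u z - \<gamma> (snd z)\<bar> \<partial>lborel) / h) \<longlongrightarrow> 0) (at_right 0)"

text \<open>The factor m((x - y(t)) / h) / h is an approximate Dirac mass on one side of the
  trajectory. Freezing psi at the trajectory costs O(h), since psi is Lipschitz in x; replacing the
  functions by their traces costs a multiple of the strip averages, which vanish by the definition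
  of a trace.\<close>

lemma (in lipschitz_flux) one_sided_limit:
  assumes y: "continuous_on UNIV y"
    and m[measurable]: "m \<in> borel_measurable borel" and mb: "bdd m"
    and I: "I \<in> sets borel" "I \<subseteq> {-1..1}" "\<And>z. z \<notin> I \<Longrightarrow> m z = 0" and m1: "(\<integral>x. m x \<partial>lborel) = 1"
    and u[measurable]: "u \<in> borel_measurable borel" and ur: "\<And>z. u z \<in> {0..1}"
    and v[measurable]: "v \<in> borel_measurable borel" and vr: "\<And>z. v z \<in> {0..1}"
    and \<gamma>: "has_trace y T I u \<gamma>" and \<delta>: "has_trace y T I v \<delta>"
    and e[measurable]: "e \<in> borel_measurable borel" and eC: "\<And>t. \<bar>e t\<bar> \<le> C"
    and \<psi>: "smooth \<psi>" "bdd \<psi>" "bdd (dx \<psi>)"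
  defines "E \<equiv> \<lambda>t. kflux g (\<gamma> t) (\<delta> t) - e t * \<bar>\<gamma> t - \<delta> t\<bar>"
  shows "((\<lambda>h. \<integral>z. indicator {0<..<T} (snd z) * (\<psi> z * (m ((fst z - y (snd z)) / h) / h)
            * (kflux g (u z) (v z) - e (snd z) * \<bar>u z - v z\<bar>)) \<partial>lborel)
          \<longlongrightarrow> (\<integral>t. indicator {0<..<T} t * (\<psi> (y t, t) * E t) \<partial>lborel)) (at_right 0)"
proof -
  have ym[measurable]: "y \<in> borel_measurable borel" by (rule borel_measurable_continuous_onI[OF y])
  have \<gamma>m[measurable]: "\<gamma> \<in> borel_measurable borel" and \<gamma>r: "\<And>t. \<gamma> t \<in> {0..1}" 
    and \<delta>m[measurable]: "\<delta> \<in> borel_measurable borel" and \<delta>r: "\<And>t. \<delta> t \<in> {0..1}"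
    using \<gamma> \<delta> by (auto simp: has_trace_def)
  have \<psi>m[measurable]: "\<psi> \<in> borel_measurable borel"
    by (rule borel_measurable_continuous_onI[OF smooth_imp_continuous[OF \<psi>(1)]])
  have ub: "bdd u" "bdd v" "bdd \<gamma>" "bdd \<delta>" "bdd e"
    using ur vr \<gamma>r \<delta>r eC by (auto intro!: bddI[of _ 1] bddI[of e C] simp: abs_le_iff)
  have C0: "0 \<le> C" using eC[of 0] by simp
  obtain P where P: "0 \<le> P" "\<And>z. \<bar>\<psi> z\<bar> \<le> P" using bddE[OF \<psi>(2)] by blast
  obtain P' where P': "0 \<le> P'" "\<And>z. \<bar>dx \<psi> z\<bar> \<le> P'" using bddE[OF \<psi>(3)] by blast
  obtain B where B: "0 \<le> B" "\<And>z. \<bar>m z\<bar> \<le> B" using bddE[OF mb] by blast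
  have lip\<psi>: "\<bar>\<psi> (x, t) - \<psi> (x', t)\<bar> \<le> P' * \<bar>x - x'\<bar>" for x x' t
  proof -
    have "norm (\<psi> (x, t) - \<psi> (x', t)) \<le> P' * norm (x - x')"
      by (rule field_differentiable_bound[of UNIV "\<lambda>x. \<psi> (x, t)" "\<lambda>x. dx \<psi> (x, t)"])
         (auto intro: smooth_plane(1)[OF \<psi>(1)] P' has_field_derivative_at_within)
    then show ?thesis by simp
  qed
  let ?I = "indicat_real {0<..<T}"
  define Eu where "Eu z = kflux g (u z) (v z) - e (snd z) * \<bar>u z - v z\<bar>" for z
  have Eum[measurable]: "Eu \<in> borel_measurable borel" unfolding Eu_def[abs_def] by measurable
  have Em[measurable]: "E \<in> borel_measurable borel" unfolding E_def by measurable
  have Eub: "\<bar>Eu z\<bar> \<le> L + C" for z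
  proof -
    have "\<bar>e (snd z)\<bar> * \<bar>u z - v z\<bar> \<le> C * 1"
      using eC ur[of z] vr[of z] C0 by (intro mult_mono) (auto simp: abs_le_iff)
    then show ?thesis
      using abs_triangle_ineq4[of "kflux g (u z) (v z)" "e (snd z) * \<bar>u z - v z\<bar>"] kflux_le_unit[OF ur[of z] vr[of z]]
      by (simp add: Eu_def abs_mult)
  qed
  have Eb: "bdd E" unfolding E_def by (intro bdd_intros kflux_bdd ub)
  \<comment> \<open>The interface flux is Lipschitz in each of its two values: 2 L comes from
    \<open>kflux\<close> and C from the speed times the absolute difference.\<close>
  define X where "X = 2 * L + C"
  have X: "0 \<le> X" using L_nonneg C0 by (simp add: X_def)
  have EE: "\<bar>Eu z - E (snd z)\<bar> \<le> X * (\<bar>u z - \<gamma> (snd z)\<bar> + \<bar>v z - \<delta> (snd z)\<bar>)" for z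
  proof -
    let ?a = "u z" and ?b = "v z" and ?c = "\<gamma> (snd z)" and ?d = "\<delta> (snd z)"
    have "\<bar>kflux g ?a ?b - kflux g ?a ?d\<bar> \<le> 2 * L * \<bar>?b - ?d\<bar>" by (rule kflux_lipschitz)
    moreover have "\<bar>kflux g ?a ?d - kflux g ?c ?d\<bar> \<le> 2 * L * \<bar>?a - ?c\<bar>"
      using kflux_lipschitz[of ?d ?a ?c] by (simp add: kflux_commute[of g _ ?d])
    ultimately have 1: "\<bar>kflux g ?a ?b - kflux g ?c ?d\<bar> \<le> 2 * L * (\<bar>?a - ?c\<bar> + \<bar>?b - ?d\<bar>)"
      by (simp add: distrib_left)
    have "\<bar>e (snd z)\<bar> * \<bar>\<bar>?a - ?b\<bar> - \<bar>?c - ?d\<bar>\<bar> \<le> C * (\<bar>?a - ?c\<bar> + \<bar>?b - ?d\<bar>)"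
      using C0 eC by (intro mult_mono) auto
    then have 2: "\<bar>e (snd z) * \<bar>?a - ?b\<bar> - e (snd z) * \<bar>?c - ?d\<bar>\<bar> \<le> C * (\<bar>?a - ?c\<bar> + \<bar>?b - ?d\<bar>)"
      by (simp add: abs_mult flip: right_diff_distrib)
    show ?thesis
      using 1 2 unfolding Eu_def E_def X_def distrib_right by linarith
  qed
  define trace where "trace h w \<eta> = (\<integral>z. indicator (strip y T I h) z * \<bar>w z - \<eta> (snd z)\<bar> \<partial>lborel) / h"
    for h and w :: "real \<times> real \<Rightarrow> real" and \<eta> :: "real \<Rightarrow> real"
  \<comment> \<open>The mass of the normalised indicator of the strip: \<open>integral_strip\<close>
    with m the indicator of I and c = 1.\<close>
  define Tm where "Tm = measure lborel I * (\<integral>t. ?I t * 1 \<partial>lborel)"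
  define lhs where "lhs h = (\<integral>z. ?I (snd z) * (\<psi> z * (m ((fst z - y (snd z)) / h) / h) * Eu z) \<partial>lborel)" for h
  define rhs where "rhs = (\<integral>t. ?I t * (\<psi> (y t, t) * E t) \<partial>lborel)"
  have est: "\<bar>lhs h - rhs\<bar> \<le> B * P' * (L + C) * Tm * h + B * P * X * (trace h u \<gamma> + trace h v \<delta>)"
    if h: "0 < h" "h \<le> 1" for h
  proof -
    let ?k = "\<lambda>z. m ((fst z - y (snd z)) / h) / h"
    let ?S = "strip y T I h"
    note [measurable] = strip_borel[OF ym I(1), of T h]
    have bS: "bounded ?S" by (rule bounded_strip[OF y h I(2)])
    have out: "?I (snd z) * c * ?k z = 0" if "z \<notin> ?S" for z c
      using that I(3) by (cases z) (auto simp: strip_def indicator_def)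
    have out': "?I (snd z) * (a * ?k z * c) = 0" if "z \<notin> ?S" for z a c
      using out[OF that, of "a * c"] by (simp add: ac_simps)
    have i1: "integrable lborel (\<lambda>z. ?I (snd z) * (\<psi> z * ?k z * Eu z))"
    proof (rule integrable_bdd[OF _ _ bS])
      show "bdd (\<lambda>z. ?I (snd z) * (\<psi> z * ?k z * Eu z))"
        unfolding divide_inverse using bddI[of Eu, OF Eub] by (intro bdd_intros bdd_comp[OF mb] \<psi>(2)) auto
    qed (measurable, rule out')
    have yt[measurable]: "(\<lambda>t. (y t, t)) \<in> borel_measurable borel"
      by (intro borel_measurable_continuous_onI continuous_intros y)
    have cm: "(\<lambda>t. \<psi> (y t, t) * E t) \<in> borel_measurable borel" by measurable
    have cb: "bdd (\<lambda>t. \<psi> (y t, t) * E t)" by (intro bdd_mult Eb bdd_comp[OF \<psi>(2)])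
    note s = integral_strip[OF y h m mb I(2,3) cm cb, of T]
    have rhs: "rhs = (\<integral>z. ?I (snd z) * (\<psi> (y (snd z), snd z) * E (snd z)) * ?k z \<partial>lborel)"
      using s(2) unfolding rhs_def m1 mult_1_left by (rule sym)
    have eq: "lhs h - rhs = (\<integral>z. ?I (snd z) * (\<psi> z * ?k z * Eu z)
        - ?I (snd z) * (\<psi> (y (snd z), snd z) * E (snd z)) * ?k z \<partial>lborel)"
      unfolding lhs_def rhs by (rule Bochner_Integration.integral_diff[OF i1 s(1), symmetric])
    have "\<bar>lhs h - rhs\<bar> \<le> (\<integral>z. \<bar>?I (snd z) * (\<psi> z * ?k z * Eu z)
        - ?I (snd z) * (\<psi> (y (snd z), snd z) * E (snd z)) * ?k z\<bar> \<partial>lborel)"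
      unfolding eq by (rule integral_abs_bound)
    also have "\<dots> \<le> (\<integral>z. B * P' * (L + C) * h * (?I (snd z) * 1 * (indicator I ((fst z - y (snd z)) / h) / h))
        + B * P * X / h * (indicator ?S z * \<bar>u z - \<gamma> (snd z)\<bar> + indicator ?S z * \<bar>v z - \<delta> (snd z)\<bar>) \<partial>lborel)"
    proof (rule integral_mono)
      show "integrable lborel (\<lambda>z. \<bar>?I (snd z) * (\<psi> z * ?k z * Eu z)
        - ?I (snd z) * (\<psi> (y (snd z), snd z) * E (snd z)) * ?k z\<bar>)"
        by (intro integrable_abs Bochner_Integration.integrable_diff i1 s(1))
      show "integrable lborel (\<lambda>z. B * P' * (L + C) * h * (?I (snd z) * 1 * (indicator I ((fst z - y (snd z)) / h) / h))
        + B * P * X / h * (indicator ?S z * \<bar>u z - \<gamma> (snd z)\<bar> + indicator ?S z * \<bar>v z - \<delta> (snd z)\<bar>))"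
      proof (intro Bochner_Integration.integrable_add integrable_mult_right)
        show "integrable lborel (\<lambda>z. ?I (snd z) * 1 * (indicator I ((fst z - y (snd z)) / h) / h))"
          using I by (intro integral_strip(1)[OF y h _ _ I(2)] bdd_intros) (auto simp: indicator_def)
        show "integrable lborel (\<lambda>z. indicator ?S z * \<bar>u z - \<gamma> (snd z)\<bar>)"
          by (rule integrable_bdd[OF _ _ bS], measurable, intro bdd_intros ub bdd_comp[OF ub(3)]) auto
        show "integrable lborel (\<lambda>z. indicator ?S z * \<bar>v z - \<delta> (snd z)\<bar>)"
          by (rule integrable_bdd[OF _ _ bS], measurable, intro bdd_intros ub bdd_comp[OF ub(4)]) auto
      qed
      fix z :: "real \<times> real"
      obtain x t where z: "z = (x, t)" by (cases z)
      show "\<bar>?I (snd z) * (\<psi> z * ?k z * Eu z) - ?I (snd z) * (\<psi> (y (snd z), snd z) * E (snd z)) * ?k z\<bar>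
        \<le> B * P' * (L + C) * h * (?I (snd z) * 1 * (indicator I ((fst z - y (snd z)) / h) / h))
        + B * P * X / h * (indicator ?S z * \<bar>u z - \<gamma> (snd z)\<bar> + indicator ?S z * \<bar>v z - \<delta> (snd z)\<bar>)"
      proof (cases "z \<in> ?S")
        case True
        then have t: "t \<in> {0<..<T}" and i: "(x - y t) / h \<in> I" by (auto simp: z strip_def)
        then have "(x - y t) / h \<in> {-1..1}" using I(2) by blast
        then have xh: "\<bar>x - y t\<bar> \<le> h" using h by (auto simp: field_simps abs_le_iff)
        have "\<bar>\<psi> z * Eu z - \<psi> (y t, t) * E t\<bar> = \<bar>(\<psi> (x, t) - \<psi> (y t, t)) * Eu z + \<psi> (y t, t) * (Eu z - E t)\<bar>"
          by (simp add: z algebra_simps)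
        also have "\<dots> \<le> \<bar>\<psi> (x, t) - \<psi> (y t, t)\<bar> * \<bar>Eu z\<bar> + \<bar>\<psi> (y t, t)\<bar> * \<bar>Eu z - E t\<bar>"
          unfolding abs_mult[symmetric] by (rule abs_triangle_ineq)
        also have "\<dots> \<le> (P' * h) * (L + C) + P * (X * (\<bar>u z - \<gamma> t\<bar> + \<bar>v z - \<delta> t\<bar>))"
        proof (intro add_mono mult_mono P Eub)
          have "P' * \<bar>x - y t\<bar> \<le> P' * h" using xh P' by (intro mult_left_mono)
          then show "\<bar>\<psi> (x, t) - \<psi> (y t, t)\<bar> \<le> P' * h" using lip\<psi>[of x t "y t"] by linarith
          show "\<bar>Eu z - E t\<bar> \<le> X * (\<bar>u z - \<gamma> t\<bar> + \<bar>v z - \<delta> t\<bar>)" using EE[of z] by (simp add: z)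
        qed (use P' h in auto)
        finally have 1: "\<bar>\<psi> z * Eu z - \<psi> (y t, t) * E t\<bar> \<le> (P' * h) * (L + C) + P * (X * (\<bar>u z - \<gamma> t\<bar> + \<bar>v z - \<delta> t\<bar>))" .
        have "\<bar>?I (snd z) * (\<psi> z * ?k z * Eu z) - ?I (snd z) * (\<psi> (y (snd z), snd z) * E (snd z)) * ?k z\<bar>
            = \<bar>\<psi> z * Eu z - \<psi> (y t, t) * E t\<bar> * \<bar>?k z\<bar>"
          unfolding abs_mult[symmetric] using t by (simp add: z algebra_simps)
        also have "\<dots> \<le> ((P' * h) * (L + C) + P * (X * (\<bar>u z - \<gamma> t\<bar> + \<bar>v z - \<delta> t\<bar>))) * (B / h)"
        proof (intro mult_mono 1)
          show "\<bar>?k z\<bar> \<le> B / h" using B h by (simp add: divide_right_mono)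
          show "0 \<le> (P' * h) * (L + C) + P * (X * (\<bar>u z - \<gamma> t\<bar> + \<bar>v z - \<delta> t\<bar>))"
            using 1 by linarith
        qed simp
        also have "\<dots> = B * P' * (L + C) * h * (1 / h) + B * P * X / h * (\<bar>u z - \<gamma> t\<bar> + \<bar>v z - \<delta> t\<bar>)"
          by (simp add: algebra_simps)
        finally show ?thesis using True t i by (simp add: z)
      next
        case False
        have nn: "0 \<le> B * P' * (L + C) * h * (?I (snd z) * 1 * (indicator I ((fst z - y (snd z)) / h) / h))"
          using B P' h L_nonneg C0 by simp
        have i0: "indicat_real ?S z = 0" using False by simp
        show ?thesis
          unfolding i0 out'[OF False] out[OF False]
          using nn by (simp only: mult_zero_left mult_zero_right add_0_right diff_0_right abs_zero)
      qed
    qed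
    also have "\<dots> = B * P' * (L + C) * Tm * h + B * P * X * (trace h u \<gamma> + trace h v \<delta>)"
    proof -
      have a: "integrable lborel (\<lambda>z. ?I (snd z) * 1 * (indicator I ((fst z - y (snd z)) / h) / h))"
        and a': "(\<integral>z. ?I (snd z) * 1 * (indicator I ((fst z - y (snd z)) / h) / h) \<partial>lborel) = Tm"
        unfolding Tm_def using I integral_strip[OF y h _ bdd_indicator I(2), of "\<lambda>_. I" "\<lambda>x. x" "\<lambda>_. 1" T] bdd_const
        by auto
      have b: "integrable lborel (\<lambda>z. indicator ?S z * \<bar>u z - \<gamma> (snd z)\<bar>)"
        by (rule integrable_bdd[OF _ _ bS], measurable, intro bdd_intros ub bdd_comp[OF ub(3)]) auto
      have c: "integrable lborel (\<lambda>z. indicator ?S z * \<bar>v z - \<delta> (snd z)\<bar>)"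
        by (rule integrable_bdd[OF _ _ bS], measurable, intro bdd_intros ub bdd_comp[OF ub(4)]) auto
      show ?thesis
        unfolding Bochner_Integration.integral_add[OF integrable_mult_right[OF a] integrable_mult_right[OF Bochner_Integration.integrable_add[OF b c]]]
          integral_mult_right_zero Bochner_Integration.integral_add[OF b c] a' trace_def
        by (simp add: add_divide_distrib distrib_left)
    qed
    finally show ?thesis .
  qed
  have t0: "((\<lambda>h. trace h u \<gamma>) \<longlongrightarrow> 0) (at_right 0)" "((\<lambda>h. trace h v \<delta>) \<longlongrightarrow> 0) (at_right 0)"
    using \<gamma> \<delta> by (auto simp: has_trace_def trace_def)
  have h0: "((\<lambda>h::real. h) \<longlongrightarrow> 0) (at_right 0)" by (rule tendsto_ident_at)
  have "((\<lambda>h. B * P' * (L + C) * Tm * h + B * P * X * (trace h u \<gamma> + trace h v \<delta>))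
      \<longlongrightarrow> B * P' * (L + C) * Tm * 0 + B * P * X * (0 + 0)) (at_right 0)"
    by (intro tendsto_intros t0 h0)
  then have lim: "((\<lambda>h. B * P' * (L + C) * Tm * h + B * P * X * (trace h u \<gamma> + trace h v \<delta>)) \<longlongrightarrow> 0) (at_right 0)"
    by simp
  have ev: "eventually (\<lambda>h::real. 0 < h \<and> h \<le> 1) (at_right 0)"
    using eventually_at_right_real[of 0 1] by (auto elim: eventually_mono)
  have "((\<lambda>h. lhs h - rhs) \<longlongrightarrow> 0) (at_right 0)"
    by (rule Lim_null_comparison[OF _ lim]) (use ev est in \<open>auto elim!: eventually_mono\<close>)
  then have "(lhs \<longlongrightarrow> rhs) (at_right 0)" by (simp add: Lim_null[of lhs])
  then show ?thesis unfolding lhs_def[abs_def] rhs_def Eu_def[abs_def] .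
qed

section \<open>Cutting out a neighbourhood of the trajectory\<close>

definition cut :: "real \<Rightarrow> real" where
  "cut z = step (2 * z - 1) + step (- 2 * z - 1)"

lemma smooth_cut: "smooth cut"
  unfolding cut_def by (intro smooth_intros smooth_comp[OF smooth_step])

text \<open>The derivative is the difference of two profiles of unit mass, supported in [1/2, 1] and
  in [-1, -1/2]. After rescaling they concentrate on the two sides of the trajectory and produce the
  right and the left interface flux with opposite signs.\<close>

lemma cut_has_derivative:
  "(cut has_real_derivative 2 * bump (2 * z - 1) - 2 * bump (- 2 * z - 1)) (at z)"
proof -
  have "((\<lambda>z. step (2 * z - 1)) has_real_derivative bump (2 * z - 1) * 2) (at z)"
    by (rule DERIV_chain2[OF step_has_derivative]) (auto intro!: derivative_eq_intros)
  moreover have "((\<lambda>z. step (- 2 * z - 1)) has_real_derivative bump (- 2 * z - 1) * - 2) (at z)"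
    by (rule DERIV_chain2[OF step_has_derivative]) (auto intro!: derivative_eq_intros)
  ultimately have "(cut has_real_derivative bump (2 * z - 1) * 2 + bump (- 2 * z - 1) * - 2) (at z)"
    unfolding cut_def[abs_def] by (rule DERIV_add)
  then show ?thesis by (simp add: mult.commute)
qed

lemma cut_range: "0 \<le> cut z" "cut z \<le> 1"
proof -
  show "0 \<le> cut z" using step_bounds by (simp add: cut_def)
  show "cut z \<le> 1"
    using step_bounds(2)[of "2 * z - 1"] step_bounds(2)[of "- 2 * z - 1"]
      step_eq_0[of "2 * z - 1"] step_eq_0[of "- 2 * z - 1"]
    by (cases "0 \<le> z") (auto simp: cut_def)
qed

lemma cut_eq_0: "\<bar>z\<bar> \<le> 1 / 2 \<Longrightarrow> cut z = 0"
  using step_eq_0[of "2 * z - 1"] step_eq_0[of "- 2 * z - 1"] by (auto simp: cut_def abs_le_iff)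

lemma cut_eq_1: "1 \<le> \<bar>z\<bar> \<Longrightarrow> cut z = 1"
  using step_eq_1[of "2 * z - 1"] step_eq_1[of "- 2 * z - 1"] step_eq_0[of "2 * z - 1"] step_eq_0[of "- 2 * z - 1"]
  by (cases "0 \<le> z") (auto simp: cut_def)

lemma continuous_bump: "continuous_on UNIV bump"
  by (rule smooth_imp_continuous[OF smooth_bump])

lemma bump_measurable[measurable]: "bump \<in> borel_measurable borel"
  by (rule borel_measurable_continuous_onI[OF continuous_bump])

lemma bdd_bump: "bdd bump"
  by (rule bdd_compact_support[OF continuous_bump, of "{0..1}"]) (auto simp: bump_eq_0)

text \<open>The Kato inequality is tested with psi times \<open>cut\<close> of (x - Y n(t)) / h.
  Differentiating the cutoff in x and t produces the flux relative to the moving curve,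
  \<open>kflux\<close> minus the speed times |u - v|. At fixed h the mollified curves are replaced
  by the true one through dominated convergence (\<open>stage1\<close>). As h tends to 0 the cutoff
  tends to 1 off the trajectory, and \<open>one_sided_limit\<close> evaluates the two halves of its
  derivative.\<close>

lemma (in lipschitz_flux) interface_inequality:
  fixes \<psi> :: "real \<times> real \<Rightarrow> real"
  assumes u: "kruzkov g (Gam y) u" and v: "kruzkov g (Gam y) v"
    and ro: "ro \<in> borel_measurable borel" "\<And>x. ro x \<in> {0..1}" "\<And>z. z \<notin> Om \<Longrightarrow> u z = ro (fst z)"
    and so: "so \<in> borel_measurable borel" "\<And>x. so x \<in> {0..1}" "\<And>z. z \<notin> Om \<Longrightarrow> v z = so (fst z)"
    and W: "W1inf_loc y dy" and T: "0 < T" and yy: "yy = (\<lambda>t. y (max 0 t))"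
    and tr: "has_trace yy T {0<..<1} u \<gamma>r" "has_trace yy T {0<..<1} v \<delta>r"
      "has_trace yy T {-1<..<0} u \<gamma>l" "has_trace yy T {-1<..<0} v \<delta>l"
    and D: "D \<in> borel_measurable borel" "bdd D" "\<And>t. 0 \<le> D t"
    and diss: "AE t in lborel. t \<in> {0<..<T} \<longrightarrow>
      (kflux g (\<gamma>r t) (\<delta>r t) - dy t * \<bar>\<gamma>r t - \<delta>r t\<bar>) - (kflux g (\<gamma>l t) (\<delta>l t) - dy t * \<bar>\<gamma>l t - \<delta>l t\<bar>) \<le> 2 * D t"
    and \<psi>: "smooth \<psi>" "compact K" "\<And>z. z \<notin> K \<Longrightarrow> \<psi> z = 0" "\<And>z. z \<in> K \<Longrightarrow> snd z < T"
      "\<And>z. 0 \<le> \<psi> z" "\<And>z. \<psi> z \<le> 1"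
  shows "0 \<le> (\<integral>z. indicator Om z * (\<bar>u z - v z\<bar> * dt \<psi> z + kflux g (u z) (v z) * dx \<psi> z) \<partial>lborel)
     + (\<integral>x. \<bar>ro x - so x\<bar> * \<psi> (x, 0) \<partial>lborel) + 2 * (\<integral>t. indicator {0<..<T} t * D t \<partial>lborel)"
proof -
  obtain e Y Y' C where e[measurable]: "e \<in> borel_measurable borel" and C: "0 \<le> C" "\<And>t. \<bar>e t\<bar> \<le> C"
    and edy: "AE t in lborel. t \<in> {0<..<T} \<longrightarrow> e t = dy t"
    and Ys: "\<And>n. smooth (Y n)" and YD: "\<And>n t. (Y n has_real_derivative Y' n t) (at t)"
    and Y'C: "\<And>n t. t \<in> {0<..<T} \<Longrightarrow> \<bar>Y' n t\<bar> \<le> C"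
    and Yunif: "\<And>\<eta>. 0 < \<eta> \<Longrightarrow> eventually (\<lambda>n::nat. \<forall>t\<in>{0..T}. \<bar>Y n t - y t\<bar> \<le> \<eta>) sequentially"
    and Y'lim: "AE t in lborel. t \<in> {0<..<T} \<longrightarrow> (\<lambda>n. Y' n t) \<longlonglongrightarrow> e t"
    by (rule smooth_approximation[OF W T], (rule that; assumption))
  have eb: "bdd e" using C(2) by (rule bddI)
  \<comment> \<open>The trajectory is known to be continuous at nonnegative times; freezing it at
    its initial position gives a function continuous on the whole line.\<close>
  have yyc: "continuous_on UNIV yy"
  proof -
    have yc: "continuous_on {0..} y" using W unfolding W1inf_loc_def by blast
    show ?thesis unfolding yy
      by (rule continuous_on_compose2[OF yc, of UNIV "\<lambda>t. max 0 t"]) (auto intro!: continuous_intros)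
  qed
  have yym[measurable]: "yy \<in> borel_measurable borel" by (rule borel_measurable_continuous_onI[OF yyc])
  have closed: "closed (Gam y)"
  proof -
    have "Gam y = {z. fst z - yy (snd z) = 0} \<inter> {z. 0 \<le> snd z}"
    proof (rule set_eqI)
      show "z \<in> Gam y \<longleftrightarrow> z \<in> {z. fst z - yy (snd z) = 0} \<inter> {z. 0 \<le> snd z}" for z
        unfolding yy Gam_def by (cases z) auto
    qed
    moreover have "continuous_on UNIV (\<lambda>z::real \<times> real. fst z - yy (snd z))"
      by (intro continuous_intros continuous_on_compose2[OF yyc]) auto
    then have "closed {z::real \<times> real. fst z - yy (snd z) = 0}"
      by (rule closed_Collect_eq[OF _ continuous_on_const])
    moreover have "closed {z::real \<times> real. 0 \<le> snd z}"
      by (intro closed_Collect_le continuous_intros)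
    ultimately show ?thesis by (simp only: closed_Int)
  qed
  note um[measurable] = kruzkov_measurable[OF u] and vm[measurable] = kruzkov_measurable[OF v]
  note ur = kruzkov_range[OF u] and vr = kruzkov_range[OF v]
  note [measurable] = ro(1) so(1) D(1)
  have ub: "bdd u" "bdd v" using kruzkov_bdd u v by auto
  have rb: "bdd ro" "bdd so" using ro(2) so(2) by (auto intro!: bddI[of _ 1] simp: abs_le_iff)
  have p0: "dx \<psi> z = 0" "dt \<psi> z = 0" if "z \<notin> K" for z
    using that \<psi>(3) dx_dt_eq_0[OF compact_imp_closed[OF \<psi>(2)], of \<psi>] by auto
  have pm[measurable]: "\<psi> \<in> borel_measurable borel" "dx \<psi> \<in> borel_measurable borel" "dt \<psi> \<in> borel_measurable borel"
    by (auto intro!: borel_measurable_continuous_onI smooth_imp_continuous smooth_plane \<psi>(1))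
  have pb: "bdd \<psi>" "bdd (dx \<psi>)" "bdd (dt \<psi>)"
    by (auto intro!: bdd_compact_support[OF _ \<psi>(2)] smooth_imp_continuous smooth_plane \<psi>(1) simp: p0 \<psi>(3))
  have bK: "bounded K" by (rule compact_imp_bounded[OF \<psi>(2)])
  define cut' where "cut' z = 2 * bump (2 * z - 1) - 2 * bump (- 2 * z - 1)" for z
  have cut'm[measurable]: "cut' \<in> borel_measurable borel" unfolding cut'_def[abs_def] by measurable
  have cutm[measurable]: "cut \<in> borel_measurable borel"
    by (rule borel_measurable_continuous_onI[OF smooth_imp_continuous[OF smooth_cut]])
  have cut'c: "continuous_on UNIV cut'"
    unfolding cut'_def[abs_def] by (intro continuous_intros continuous_on_compose2[OF continuous_bump]) auto
  have cut'b: "bdd cut'" unfolding cut'_def[abs_def] by (intro bdd_intros bdd_comp[OF bdd_bump])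
  have cutb: "bdd cut"
  proof (rule bddI)
    show "\<bar>cut z\<bar> \<le> 1" for z using cut_range[of z] by simp
  qed
  let ?a = "indicator Om :: real \<times> real \<Rightarrow> real"
  define N where "N z = \<bar>u z - v z\<bar> * dt \<psi> z + kflux g (u z) (v z) * dx \<psi> z" for z
  have Nm[measurable]: "N \<in> borel_measurable borel" unfolding N_def[abs_def] by measurable
  have Nb: "bdd N" unfolding N_def[abs_def] by (intro bdd_intros kflux_bdd ub pb)
  have N0: "N z = 0" if "z \<notin> K" for z using p0[OF that] by (simp add: N_def)
  obtain BN where BN: "0 \<le> BN" "\<And>z. \<bar>N z\<bar> \<le> BN" using bddE[OF Nb] by blast
  obtain Bc where Bc: "0 \<le> Bc" "\<And>z. \<bar>cut' z\<bar> \<le> Bc" using bddE[OF cut'b] by blast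
  define I0 where "I0 = (\<integral>x. \<bar>ro x - so x\<bar> * \<psi> (x, 0) \<partial>lborel)"
  \<comment> \<open>The integrand for a general curve \<open>Z\<close> with speed \<open>Z'\<close>,
    so that the mollified curves and their limit are instances of one expression.\<close>
  define Q where "Q h Z Z' z = ?a z * (cut ((fst z - Z (snd z)) / h) * N z
      + \<psi> z * (cut' ((fst z - Z (snd z)) / h) / h) * (kflux g (u z) (v z) - Z' (snd z) * \<bar>u z - v z\<bar>))"
    for h :: real and Z Z' :: "real \<Rightarrow> real" and z
  have tK: "snd z \<in> {0<..<T}" if "z \<in> K" "z \<in> Om" for z
    using \<psi>(4)[OF that(1)] that(2) by (cases z) (auto simp: Om_def)
  \<comment> \<open>The bound depends on the curve only through the bound \<open>C\<close> on its
    speed and hence dominates all n at once. It may blow up as h tends to 0, which is why n tends to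
    infinity first.\<close>
  have Qb: "\<bar>Q h Z Z' z\<bar> \<le> (BN + Bc / h * (L + C)) * indicator K z"
    if h: "0 < h" and Z': "\<And>t. t \<in> {0<..<T} \<Longrightarrow> \<bar>Z' t\<bar> \<le> C" for h Z Z' z
  proof (cases "z \<in> K \<and> z \<in> Om")
    case True
    then have t: "snd z \<in> {0<..<T}" using tK by blast
    have uv: "\<bar>u z - v z\<bar> \<le> 1" using ur[of z] vr[of z] by (auto simp: abs_le_iff)
    have 1: "\<bar>cut ((fst z - Z (snd z)) / h) * N z\<bar> \<le> 1 * BN"
      unfolding abs_mult using cut_range BN by (intro mult_mono) auto
    have "\<bar>Z' (snd z)\<bar> * \<bar>u z - v z\<bar> \<le> C * 1" using Z'[OF t] uv C by (intro mult_mono) auto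
    then have 2: "\<bar>kflux g (u z) (v z) - Z' (snd z) * \<bar>u z - v z\<bar>\<bar> \<le> L + C"
      using abs_triangle_ineq4[of "kflux g (u z) (v z)" "Z' (snd z) * \<bar>u z - v z\<bar>"] kflux_le_unit[OF ur[of z] vr[of z]]
      by (simp add: abs_mult)
    have "\<bar>\<psi> z\<bar> * \<bar>cut' ((fst z - Z (snd z)) / h) / h\<bar> \<le> 1 * (Bc / h)"
      using \<psi>(5,6) Bc h by (intro mult_mono) (auto simp: divide_right_mono)
    then have 3: "\<bar>\<psi> z * (cut' ((fst z - Z (snd z)) / h) / h) * (kflux g (u z) (v z) - Z' (snd z) * \<bar>u z - v z\<bar>)\<bar>
        \<le> Bc / h * (L + C)"
      unfolding abs_mult[of "\<psi> z * _"] abs_mult[of "\<psi> z"] using 2 Bc h by (intro mult_mono) auto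
    have "\<bar>Q h Z Z' z\<bar> \<le> 1 * BN + Bc / h * (L + C)"
      unfolding Q_def using True
      by (simp only: indicator_simps mult_1_left) (rule order_trans[OF abs_triangle_ineq add_mono[OF 1 3, unfolded mult_1_left]])
    then show ?thesis using True by simp
  next
    case False
    have "0 \<le> BN + Bc / h * (L + C)" using BN Bc h L_nonneg C by simp
    moreover have "Q h Z Z' z = 0" using False N0 \<psi>(3) by (cases "z \<in> K") (auto simp: Q_def)
    ultimately show ?thesis by simp
  qed
  have domint: "integrable lborel (\<lambda>z. c * indicator K z :: real)" for c
    using bK compact_imp_closed[OF \<psi>(2)] by (intro integrable_bdd[of _ K] bdd_intros) auto
  have stage1: "0 \<le> (\<integral>z. Q h yy e z \<partial>lborel) + I0" if h: "0 < h" for h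
  proof -
    \<comment> \<open>The cutoff vanishes within h / 2 of the mollified curve, which up to time
      \<open>T\<close> lies within h / 4 of the trajectory; so the support of the test function
      misses \<open>Gam y\<close>.\<close>
    have Qn: "0 \<le> (\<integral>z. Q h (Y n) (Y' n) z \<partial>lborel) + I0"
      if close: "\<forall>t\<in>{0..T}. \<bar>Y n t - y t\<bar> \<le> h / 4" for n
    proof -
      let ?w = "\<lambda>z. (fst z - Y n (snd z)) / h"
      define \<phi> where "\<phi> z = \<psi> z * cut (?w z)" for z
      have Yc: "continuous_on UNIV (\<lambda>z::real\<times>real. Y n (snd z))"
        by (intro continuous_on_compose2[OF smooth_imp_continuous[OF Ys]]) (auto intro!: continuous_intros)
      define K1 where "K1 = K \<inter> {z. h / 2 \<le> \<bar>fst z - Y n (snd z)\<bar>}"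
      have K1: "compact K1" unfolding K1_def
        by (intro compact_Int_closed \<psi>(2) closed_Collect_le continuous_intros Yc)
      have sc: "smooth (\<lambda>z. cut (?w z))"
        by (intro smooth_comp[OF smooth_cut] smooth_intros smooth_comp[OF Ys])
      have \<phi>s: "smooth \<phi>" unfolding \<phi>_def[abs_def] by (intro smooth_mult \<psi>(1) sc)
      have \<phi>0: "\<phi> z = 0" if "z \<notin> K1" for z
      proof (cases "z \<in> K")
        case True
        then have "\<bar>?w z\<bar> \<le> 1 / 2" using that h by (simp add: K1_def field_simps)
        then show ?thesis by (simp add: \<phi>_def cut_eq_0)
      qed (simp add: \<phi>_def \<psi>(3))
      have "K1 \<inter> Gam y = {}"
      proof -
        have False if z: "z \<in> K1" "z \<in> Gam y" for z
        proof -
          obtain t where t: "z = (y t, t)" "0 \<le> t" using z(2) by (auto simp: Gam_def)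
          have "t < T" using \<psi>(4)[of z] z(1) by (simp add: K1_def t)
          then have "\<bar>Y n t - y t\<bar> \<le> h / 4" using close t(2) by simp
          moreover have "h / 2 \<le> \<bar>y t - Y n t\<bar>" using z(1) by (simp add: K1_def t)
          ultimately show False using h by linarith
        qed
        then show ?thesis by blast
      qed
      then have kt: "0 \<le> (\<integral>z. \<bar>u z - v z\<bar> * dt \<phi> z + ?a z * kflux g (u z) (v z) * dx \<phi> z \<partial>lborel)"
        using \<phi>0 \<psi>(5) cut_range by (intro kato[OF u v closed \<phi>s K1]) (auto simp: \<phi>_def)
      have cD: "(cut has_real_derivative cut' z) (at z)" for z
        unfolding cut'_def by (rule cut_has_derivative)
      have dxc: "dx (\<lambda>z. cut (?w z)) (x, t) = cut' (?w (x, t)) / h" for x t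
      proof (rule dx_eqI[where g="\<lambda>x t. cut' (?w (x, t)) / h"])
        fix x t
        have "((\<lambda>x. ?w (x, t)) has_real_derivative 1 / h) (at x)" using h by (auto intro!: derivative_eq_intros)
        from DERIV_chain2[OF cD this]
        show "((\<lambda>x. cut (?w (x, t))) has_real_derivative cut' (?w (x, t)) / h) (at x)" by simp
      qed
      have dtc: "dt (\<lambda>z. cut (?w z)) (x, t) = cut' (?w (x, t)) / h * - Y' n t" for x t
      proof (rule dt_eqI[where g="\<lambda>x t. cut' (?w (x, t)) / h * - Y' n t"])
        fix x t
        have "((\<lambda>t. ?w (x, t)) has_real_derivative - Y' n t / h) (at t)"
          using h by (auto intro!: derivative_eq_intros YD)
        from DERIV_chain2[OF cD this]
        show "((\<lambda>t. cut (?w (x, t))) has_real_derivative cut' (?w (x, t)) / h * - Y' n t) (at t)" by simp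
      qed
      have dx\<phi>: "dx \<phi> z = dx \<psi> z * cut (?w z) + \<psi> z * (cut' (?w z) / h)" for z
        unfolding \<phi>_def[abs_def] dx_mult(1)[OF \<psi>(1) sc] using dxc[of "fst z" "snd z"] by simp
      have dt\<phi>: "dt \<phi> z = dt \<psi> z * cut (?w z) + \<psi> z * (cut' (?w z) / h * - Y' n (snd z))" for z
        unfolding \<phi>_def[abs_def] dx_mult(2)[OF \<psi>(1) sc] using dtc[of "fst z" "snd z"] by simp
      have q0: "dx \<phi> z = 0" "dt \<phi> z = 0" if "z \<notin> K1" for z
        using that \<phi>0 dx_dt_eq_0[OF compact_imp_closed[OF K1], of \<phi>] by auto
      have qm[measurable]: "dx \<phi> \<in> borel_measurable borel" "dt \<phi> \<in> borel_measurable borel"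
        by (auto intro!: borel_measurable_continuous_onI smooth_plane \<phi>s)
      have qb: "bdd (dx \<phi>)" "bdd (dt \<phi>)"
        by (auto intro!: bdd_compact_support[OF _ K1] smooth_plane \<phi>s simp: q0)
      have bK1: "bounded K1" by (rule compact_imp_bounded[OF K1])
      have Qeq: "Q h (Y n) (Y' n) z = ?a z * (\<bar>u z - v z\<bar> * dt \<phi> z + kflux g (u z) (v z) * dx \<phi> z)" for z
        by (simp add: Q_def N_def dx\<phi> dt\<phi> algebra_simps)
      have i1: "integrable lborel (\<lambda>z. Q h (Y n) (Y' n) z)"
        unfolding Qeq
        by (rule integrable_bdd[OF _ _ bK1], measurable, intro bdd_intros kflux_bdd ub qb, simp add: q0)
      have i2: "integrable lborel (\<lambda>z. indicator (- Om) z * \<bar>ro (fst z) - so (fst z)\<bar> * dt \<phi> z)"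
        by (rule integrable_bdd[OF _ _ bK1], measurable, intro bdd_intros bdd_comp[OF rb(1)] bdd_comp[OF rb(2)] qb, simp add: q0)
      have "(\<integral>z. \<bar>u z - v z\<bar> * dt \<phi> z + ?a z * kflux g (u z) (v z) * dx \<phi> z \<partial>lborel)
          = (\<integral>z. Q h (Y n) (Y' n) z + indicator (- Om) z * \<bar>ro (fst z) - so (fst z)\<bar> * dt \<phi> z \<partial>lborel)"
      proof (rule Bochner_Integration.integral_cong[OF refl])
        fix z
        show "\<bar>u z - v z\<bar> * dt \<phi> z + ?a z * kflux g (u z) (v z) * dx \<phi> z
          = Q h (Y n) (Y' n) z + indicator (- Om) z * \<bar>ro (fst z) - so (fst z)\<bar> * dt \<phi> z"
          using ro(3)[of z] so(3)[of z] unfolding Qeq by (cases "z \<in> Om") auto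
      qed
      also have "\<dots> = (\<integral>z. Q h (Y n) (Y' n) z \<partial>lborel) + (\<integral>z. indicator (- Om) z * \<bar>ro (fst z) - so (fst z)\<bar> * dt \<phi> z \<partial>lborel)"
        by (rule Bochner_Integration.integral_add[OF i1 i2])
      also have "(\<integral>z. indicator (- Om) z * \<bar>ro (fst z) - so (fst z)\<bar> * dt \<phi> z \<partial>lborel) = (\<integral>x. \<bar>ro x - so x\<bar> * \<phi> (x, 0) \<partial>lborel)"
        by (rule integral_dt_initial[OF _ _ \<phi>s K1 \<phi>0]) (measurable, intro bdd_intros rb)
      finally have eq: "(\<integral>z. \<bar>u z - v z\<bar> * dt \<phi> z + ?a z * kflux g (u z) (v z) * dx \<phi> z \<partial>lborel)
          = (\<integral>z. Q h (Y n) (Y' n) z \<partial>lborel) + (\<integral>x. \<bar>ro x - so x\<bar> * \<phi> (x, 0) \<partial>lborel)" .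
      have "(\<integral>x. \<bar>ro x - so x\<bar> * \<phi> (x, 0) \<partial>lborel) \<le> I0"
        unfolding I0_def
      proof (rule integral_mono)
        have pair[measurable]: "(\<lambda>x. (x, 0::real)) \<in> borel_measurable (borel::real measure)"
          by (intro borel_measurable_continuous_onI continuous_intros)
        have [measurable]: "\<phi> \<in> borel_measurable borel"
          by (intro borel_measurable_continuous_onI smooth_imp_continuous \<phi>s)
        have bf: "bounded (fst ` K)" "bounded (fst ` K1)"
          using bK bK1 by (auto intro: bounded_fst)
        have fb: "bdd \<phi>" by (rule bdd_compact_support[OF smooth_imp_continuous[OF \<phi>s] K1 \<phi>0])
        show "integrable lborel (\<lambda>x. \<bar>ro x - so x\<bar> * \<phi> (x, 0))"
        proof (rule integrable_bdd[OF _ _ bf(2)])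
          show "\<bar>ro x - so x\<bar> * \<phi> (x, 0) = 0" if "x \<notin> fst ` K1" for x
          proof -
            have "(x, 0) \<notin> K1" using image_eqI[of x fst "(x, 0)" K1] that by auto
            then show ?thesis by (simp add: \<phi>0)
          qed
          show "bdd (\<lambda>x. \<bar>ro x - so x\<bar> * \<phi> (x, 0))" by (intro bdd_intros rb bdd_comp[OF fb])
        qed measurable
        show "integrable lborel (\<lambda>x. \<bar>ro x - so x\<bar> * \<psi> (x, 0))"
        proof (rule integrable_bdd[OF _ _ bf(1)])
          show "\<bar>ro x - so x\<bar> * \<psi> (x, 0) = 0" if "x \<notin> fst ` K" for x
          proof -
            have "(x, 0) \<notin> K" using image_eqI[of x fst "(x, 0)" K] that by auto
            then show ?thesis by (simp add: \<psi>(3))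
          qed
          show "bdd (\<lambda>x. \<bar>ro x - so x\<bar> * \<psi> (x, 0))" by (intro bdd_intros rb bdd_comp[OF pb(1)])
        qed measurable
        show "\<bar>ro x - so x\<bar> * \<phi> (x, 0) \<le> \<bar>ro x - so x\<bar> * \<psi> (x, 0)" for x
          unfolding \<phi>_def using cut_range \<psi>(5) by (intro mult_left_mono mult_left_le) auto
      qed
      then show ?thesis using kt eq by linarith
    qed
    have "(\<lambda>n. \<integral>z. Q h (Y n) (Y' n) z \<partial>lborel) \<longlonglongrightarrow> (\<integral>z. Q h yy e z \<partial>lborel)"
    proof (rule integral_dominated_convergence[where w="\<lambda>z. (BN + Bc / h * (L + C)) * indicator K z"])
      have [measurable]: "Y n \<in> borel_measurable borel" for n
        by (intro borel_measurable_continuous_onI smooth_imp_continuous Ys)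
      have [measurable]: "Y' n \<in> borel_measurable borel" for n
      proof -
        obtain h' where "\<And>x. (Y n has_real_derivative h' x) (at x)" "continuous_on UNIV h'"
          using smooth_derivative[OF Ys] by blast
        moreover from this(1) have "h' = Y' n" using DERIV_unique YD by blast
        ultimately show ?thesis by (auto intro: borel_measurable_continuous_onI)
      qed
      show "Q h yy e \<in> borel_measurable lborel" unfolding Q_def[abs_def] by measurable
      show "Q h (Y n) (Y' n) \<in> borel_measurable lborel" for n unfolding Q_def[abs_def] by measurable
      show "integrable lborel (\<lambda>z. (BN + Bc / h * (L + C)) * indicator K z)" by (rule domint)
      show "AE z in lborel. norm (Q h (Y n) (Y' n) z) \<le> (BN + Bc / h * (L + C)) * indicator K z" for n
        using Qb[OF h Y'C] by simp
      have Ylim: "(\<lambda>n. Y n t) \<longlonglongrightarrow> yy t" if t: "t \<in> {0<..<T}" for t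
      proof (rule LIMSEQ_I)
        fix \<eta> :: real assume \<eta>: "0 < \<eta>"
        obtain n0 where n0: "\<And>n. n0 \<le> n \<Longrightarrow> \<forall>t\<in>{0..T}. \<bar>Y n t - y t\<bar> \<le> \<eta> / 2"
          using Yunif[OF half_gt_zero[OF \<eta>]] unfolding eventually_sequentially by blast
        have "norm (Y n t - yy t) < \<eta>" if "n0 \<le> n" for n
        proof -
          have "yy t = y t" using t by (simp add: yy)
          moreover have "\<bar>Y n t - y t\<bar> \<le> \<eta> / 2" using n0[OF that] t by simp
          ultimately show ?thesis using \<eta> by simp
        qed
        then show "\<exists>no. \<forall>n\<ge>no. norm (Y n t - yy t) < \<eta>" by blast
      qed
      show "AE z in lborel. (\<lambda>n. Q h (Y n) (Y' n) z) \<longlonglongrightarrow> Q h yy e z"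
        using AE_snd_lborel[OF Y'lim]
      proof eventually_elim
        case (elim z)
        show ?case
        proof (cases "z \<in> K \<and> z \<in> Om")
          case True
          then have t: "snd z \<in> {0<..<T}" using tK by blast
          have w: "(\<lambda>n. (fst z - Y n (snd z)) / h) \<longlonglongrightarrow> (fst z - yy (snd z)) / h"
            using h by (intro tendsto_intros Ylim t) auto
          have c: "(\<lambda>n. cut ((fst z - Y n (snd z)) / h)) \<longlonglongrightarrow> cut ((fst z - yy (snd z)) / h)"
            by (rule isCont_tendsto_compose[OF DERIV_isCont[OF cut_has_derivative] w])
          have "isCont cut' ((fst z - yy (snd z)) / h)"
            using cut'c by (simp add: continuous_on_eq_continuous_at)
          then have c': "(\<lambda>n. cut' ((fst z - Y n (snd z)) / h)) \<longlonglongrightarrow> cut' ((fst z - yy (snd z)) / h)"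
            by (rule isCont_tendsto_compose[OF _ w])
          show ?thesis unfolding Q_def
            using elim t h by (intro tendsto_intros c c') auto
        next
          case False
          then have "Q h Z Z' z = 0" for Z Z'
            using N0 \<psi>(3) by (cases "z \<in> K") (auto simp: Q_def)
          then show ?thesis by simp
        qed
      qed
    qed
    then have "(\<lambda>n. (\<integral>z. Q h (Y n) (Y' n) z \<partial>lborel) + I0) \<longlonglongrightarrow> (\<integral>z. Q h yy e z \<partial>lborel) + I0"
      by (intro tendsto_intros)
    moreover have "eventually (\<lambda>n. 0 \<le> (\<integral>z. Q h (Y n) (Y' n) z \<partial>lborel) + I0) sequentially"
      by (rule eventually_mono[OF Yunif[of "h / 4"] Qn]) (use h in simp)
    ultimately show ?thesis by (rule tendsto_lowerbound) simp
  qed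
  define mr where "mr x = 2 * bump (2 * x - 1)" for x
  define ml where "ml x = 2 * bump (- 2 * x - 1)" for x
  have mm[measurable]: "mr \<in> borel_measurable borel" "ml \<in> borel_measurable borel"
    unfolding mr_def[abs_def] ml_def[abs_def] by measurable
  have mb: "bdd mr" "bdd ml"
    unfolding mr_def[abs_def] ml_def[abs_def] by (intro bdd_intros bdd_comp[OF bdd_bump])+
  have m0: "mr x = 0" if "x \<notin> {0<..<1}" for x
    unfolding mr_def using that by (auto intro!: bump_eq_0)
  have m0': "ml x = 0" if "x \<notin> {-1<..<0}" for x
    unfolding ml_def using that by (auto intro!: bump_eq_0)
  have m1: "(\<integral>x. mr x \<partial>lborel) = 1" "(\<integral>x. ml x \<partial>lborel) = 1"
  proof -
    have e: "bump (-1 + 2 * x) = bump (2 * x - 1)" "bump (-1 + -2 * x) = bump (-2 * x - 1)" for x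
    proof -
      have "-1 + 2 * x = 2 * x - 1" "-1 + -2 * x = -2 * x - 1" by simp_all
      then show "bump (-1 + 2 * x) = bump (2 * x - 1)" "bump (-1 + -2 * x) = bump (-2 * x - 1)"
        by (simp_all only:)
    qed
    show "(\<integral>x. mr x \<partial>lborel) = 1"
      using lborel_integral_real_affine[of 2 bump "-1"] unfolding e mr_def by (simp add: integral_bump)
    show "(\<integral>x. ml x \<partial>lborel) = 1"
      using lborel_integral_real_affine[of "-2" bump "-1"] unfolding e ml_def by (simp add: integral_bump)
  qed
  let ?I = "indicat_real {0<..<T}"
  define Eu where "Eu z = kflux g (u z) (v z) - e (snd z) * \<bar>u z - v z\<bar>" for z
  define Er where "Er t = kflux g (\<gamma>r t) (\<delta>r t) - e t * \<bar>\<gamma>r t - \<delta>r t\<bar>" for t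
  define El where "El t = kflux g (\<gamma>l t) (\<delta>l t) - e t * \<bar>\<gamma>l t - \<delta>l t\<bar>" for t
  define A where "A h = (\<integral>z. ?a z * (cut ((fst z - yy (snd z)) / h) * N z) \<partial>lborel)" for h
  define R where "R m h = (\<integral>z. ?I (snd z) * (\<psi> z * (m ((fst z - yy (snd z)) / h) / h) * Eu z) \<partial>lborel)"
    for m :: "real \<Rightarrow> real" and h :: real
  have Eum[measurable]: "Eu \<in> borel_measurable borel" unfolding Eu_def[abs_def] by measurable
  have Eub: "bdd Eu" unfolding Eu_def[abs_def]
    by (intro bdd_intros kflux_bdd ub bdd_comp[OF eb])
  have split: "0 \<le> A h + (R mr h - R ml h) + I0" if h: "0 < h" for h
  proof -
    have iA: "integrable lborel (\<lambda>z. ?a z * (cut ((fst z - yy (snd z)) / h) * N z))"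
      by (rule integrable_bdd[OF _ _ bK], measurable, intro bdd_intros bdd_comp[OF cutb] Nb, simp add: N0)
    have iR: "integrable lborel (\<lambda>z. ?I (snd z) * (\<psi> z * (m ((fst z - yy (snd z)) / h) / h) * Eu z))"
      if m[measurable]: "m \<in> borel_measurable borel" and mb: "bdd m" for m
    proof (rule integrable_bdd[OF _ _ bK])
      show "bdd (\<lambda>z. ?I (snd z) * (\<psi> z * (m ((fst z - yy (snd z)) / h) / h) * Eu z))"
        unfolding divide_inverse by (intro bdd_intros bdd_comp[OF mb] pb Eub)
    qed (measurable, simp add: \<psi>(3))
    have "(\<integral>z. Q h yy e z \<partial>lborel) = (\<integral>z. ?a z * (cut ((fst z - yy (snd z)) / h) * N z)
       + (?I (snd z) * (\<psi> z * (mr ((fst z - yy (snd z)) / h) / h) * Eu z)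
         - ?I (snd z) * (\<psi> z * (ml ((fst z - yy (snd z)) / h) / h) * Eu z)) \<partial>lborel)"
    proof (rule Bochner_Integration.integral_cong[OF refl])
      fix z
      show "Q h yy e z = ?a z * (cut ((fst z - yy (snd z)) / h) * N z)
       + (?I (snd z) * (\<psi> z * (mr ((fst z - yy (snd z)) / h) / h) * Eu z)
         - ?I (snd z) * (\<psi> z * (ml ((fst z - yy (snd z)) / h) / h) * Eu z))"
      proof (cases "z \<in> K")
        case True
        \<comment> \<open>The support of psi ends before \<open>T\<close>, so there the half-plane
          indicator is the indicator of (0,T), the form that \<open>one_sided_limit\<close>
          expects.\<close>
        then have ai: "?a z = ?I (snd z)" using \<psi>(4)[of z] by (cases z) (auto simp: Om_def indicator_def)
        have c: "cut' w = mr w - ml w" for w by (simp add: cut'_def mr_def ml_def)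
        have alg: "i * (p + k * ((a - b) / h) * E) = i * p + (i * (k * (a / h) * E) - i * (k * (b / h) * E))"
          for i p k a b E :: real by (simp add: diff_divide_distrib algebra_simps)
        show ?thesis unfolding Q_def Eu_def c ai by (rule alg)
      qed (simp add: Q_def N0 \<psi>(3))
    qed
    also have "\<dots> = A h + (R mr h - R ml h)"
      unfolding A_def R_def
        Bochner_Integration.integral_add[OF iA Bochner_Integration.integrable_diff[OF iR[OF mm(1) mb(1)] iR[OF mm(2) mb(2)]]]
        Bochner_Integration.integral_diff[OF iR[OF mm(1) mb(1)] iR[OF mm(2) mb(2)]] ..
    finally show ?thesis using stage1[OF h] by simp
  qed
  have R: "((\<lambda>h. R mr h) \<longlongrightarrow> (\<integral>t. ?I t * (\<psi> (yy t, t) * Er t) \<partial>lborel)) (at_right 0)"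
    unfolding R_def Eu_def Er_def
    by (rule one_sided_limit[OF yyc mm(1) mb(1) _ _ m0 m1(1) um ur vm vr tr(1,2) e C(2) \<psi>(1) pb(1,2)]) auto
  have Rl: "((\<lambda>h. R ml h) \<longlongrightarrow> (\<integral>t. ?I t * (\<psi> (yy t, t) * El t) \<partial>lborel)) (at_right 0)"
    unfolding R_def Eu_def El_def
    by (rule one_sided_limit[OF yyc mm(2) mb(2) _ _ m0' m1(2) um ur vm vr tr(3,4) e C(2) \<psi>(1) pb(1,2)]) auto
  define hn where "hn n = 1 / (real n + 1)" for n
  have hn: "0 < hn n" for n by (simp add: hn_def)
  have hlim: "hn \<longlonglongrightarrow> 0"
    unfolding hn_def using LIMSEQ_inverse_real_of_nat by (simp add: inverse_eq_divide add.commute)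
  have hfl: "filterlim hn (at_right 0) sequentially"
  proof -
    have "hn n \<in> {0<..} \<and> hn n \<noteq> 0" for n using hn[of n] by simp
    then show ?thesis using hlim by (simp only: filterlim_at always_eventually simp_thms)
  qed
  have Alim: "(\<lambda>n. A (hn n)) \<longlonglongrightarrow> (\<integral>z. ?a z * N z \<partial>lborel)"
    unfolding A_def
  proof (rule integral_dominated_convergence[where w="\<lambda>z. BN * indicator K z"])
    show "AE z in lborel. norm (?a z * (cut ((fst z - yy (snd z)) / hn n) * N z)) \<le> BN * indicator K z" for n
    proof (rule AE_I2)
      fix z
      have "\<bar>?a z\<bar> * (\<bar>cut ((fst z - yy (snd z)) / hn n)\<bar> * \<bar>N z\<bar>) \<le> 1 * (1 * BN)"
        using cut_range BN by (intro mult_mono) (auto simp: indicator_def)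
      then show "norm (?a z * (cut ((fst z - yy (snd z)) / hn n) * N z)) \<le> BN * indicator K z"
        using N0[of z] by (cases "z \<in> K") (auto simp: abs_mult)
    qed
    \<comment> \<open>The graph of the trajectory is a null set: its section at each time is a
      single point.\<close>
    have "AE z in lborel. fst z \<noteq> yy (snd z)"
      by (rule AE_pair_swap) (measurable, simp add: AE_lborel_singleton)
    then show "AE z in lborel. (\<lambda>n. ?a z * (cut ((fst z - yy (snd z)) / hn n) * N z)) \<longlonglongrightarrow> ?a z * N z"
    proof eventually_elim
      case (elim z)
      define d where "d = \<bar>fst z - yy (snd z)\<bar>"
      have d: "0 < d" using elim by (simp add: d_def)
      have "eventually (\<lambda>n. hn n < d) sequentially" by (rule order_tendstoD(2)[OF hlim d])
      then have "eventually (\<lambda>n. ?a z * (cut ((fst z - yy (snd z)) / hn n) * N z) = ?a z * N z) sequentially"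
      proof (rule eventually_mono)
        fix n assume "hn n < d"
        then have "1 \<le> \<bar>(fst z - yy (snd z)) / hn n\<bar>" using hn[of n] by (simp add: d_def)
        then show "?a z * (cut ((fst z - yy (snd z)) / hn n) * N z) = ?a z * N z" by (simp add: cut_eq_1)
      qed
      then show ?case by (rule tendsto_eventually)
    qed
    show "integrable lborel (\<lambda>z. BN * indicator K z)" by (rule domint)
  qed measurable
  have "(\<lambda>n. A (hn n) + (R mr (hn n) - R ml (hn n)) + I0) \<longlonglongrightarrow> (\<integral>z. ?a z * N z \<partial>lborel)
     + ((\<integral>t. ?I t * (\<psi> (yy t, t) * Er t) \<partial>lborel) - (\<integral>t. ?I t * (\<psi> (yy t, t) * El t) \<partial>lborel)) + I0"
    by (intro tendsto_intros Alim filterlim_compose[OF R hfl] filterlim_compose[OF Rl hfl])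
  then have lim: "0 \<le> (\<integral>z. ?a z * N z \<partial>lborel)
     + ((\<integral>t. ?I t * (\<psi> (yy t, t) * Er t) \<partial>lborel) - (\<integral>t. ?I t * (\<psi> (yy t, t) * El t) \<partial>lborel)) + I0"
    by (rule tendsto_lowerbound[OF _ always_eventually[OF allI[OF split[OF hn]]]]) simp
  have yt[measurable]: "(\<lambda>t. (yy t, t)) \<in> borel_measurable borel"
    by (intro borel_measurable_continuous_onI continuous_intros yyc)
  have \<gamma>m[measurable]: "\<gamma>r \<in> borel_measurable borel" "\<delta>r \<in> borel_measurable borel" "\<gamma>l \<in> borel_measurable borel" "\<delta>l \<in> borel_measurable borel"
    using tr by (auto simp: has_trace_def)
  have \<gamma>b: "bdd \<gamma>r" "bdd \<delta>r" "bdd \<gamma>l" "bdd \<delta>l"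
    using tr by (auto simp: has_trace_def abs_le_iff intro!: bddI[of _ 1])

  have Em[measurable]: "Er \<in> borel_measurable borel" "El \<in> borel_measurable borel"
    unfolding Er_def[abs_def] El_def[abs_def] by measurable
  have Eb: "bdd Er" "bdd El" unfolding Er_def[abs_def] El_def[abs_def] by (intro bdd_intros kflux_bdd \<gamma>b eb)+
  have iE: "integrable lborel (\<lambda>t. ?I t * (\<psi> (yy t, t) * Er t))" "integrable lborel (\<lambda>t. ?I t * (\<psi> (yy t, t) * El t))"
    by (rule integrable_bdd[OF _ _ bounded_Ioo[of 0 T]], measurable, intro bdd_intros bdd_comp[OF pb(1)] Eb, auto)+
  have iD: "integrable lborel (\<lambda>t. 2 * (?I t * D t))"
    by (rule integrable_bdd[OF _ _ bounded_Ioo[of 0 T]], measurable, intro bdd_intros D(2), auto)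
  have "(\<integral>t. ?I t * (\<psi> (yy t, t) * Er t) \<partial>lborel) - (\<integral>t. ?I t * (\<psi> (yy t, t) * El t) \<partial>lborel)
      = (\<integral>t. ?I t * (\<psi> (yy t, t) * Er t) - ?I t * (\<psi> (yy t, t) * El t) \<partial>lborel)"
    by (rule Bochner_Integration.integral_diff[OF iE, symmetric])
  also have "\<dots> \<le> (\<integral>t. 2 * (?I t * D t) \<partial>lborel)"
  proof (rule integral_mono_AE[OF Bochner_Integration.integrable_diff[OF iE] iD])
    show "AE t in lborel. ?I t * (\<psi> (yy t, t) * Er t) - ?I t * (\<psi> (yy t, t) * El t) \<le> 2 * (?I t * D t)"
      using diss edy
    proof eventually_elim
      case (elim t)
      show ?case
      proof (cases "t \<in> {0<..<T}")
        case True
        then have "Er t - El t \<le> 2 * D t" using elim by (simp add: Er_def El_def)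
        then have "\<psi> (yy t, t) * (Er t - El t) \<le> \<psi> (yy t, t) * (2 * D t)"
          by (intro mult_left_mono \<psi>(5))
        also have "\<dots> \<le> 1 * (2 * D t)" using D(3) \<psi>(6) by (intro mult_right_mono) auto
        finally show ?thesis using True by (simp add: right_diff_distrib)
      qed simp
    qed
  qed
  also have "\<dots> = 2 * (\<integral>t. ?I t * D t \<partial>lborel)" by simp
  finally show ?thesis using lim unfolding N_def I0_def by linarith
qed

subsection \<open>Dissipativity of the germ\<close>

lemma germ_properties:
  assumes "(a, b) \<in> germ f s q"
  shows "a \<in> {0..1}" "b \<in> {0..1}" "F f s a = F f s b" "F f s a \<le> q" "b < a \<Longrightarrow> F f s a = q"
proof -
  have "a \<in> {0..1} \<and> b \<in> {0..1} \<and> F f s a = F f s b \<and> F f s a \<le> q \<and> (b < a \<longrightarrow> F f s a = q)"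
  proof -
    have "(a > b \<and> {u\<in>{0..1}. F f s u = q} = {a, b}) \<or> (\<exists>k. (a, b) = (k, k) \<and> k \<in> {0..1} \<and> F f s k \<le> q) \<or>
        (a \<in> {0..1} \<and> b \<in> {0..1} \<and> a < b \<and> F f s a = F f s b \<and> F f s b \<le> q)"
      using assms unfolding germ_def Un_iff mem_Collect_eq case_prod_conv by (simp only: disj_assoc)
    then show ?thesis
    proof (elim disjE)
      assume 1: "a > b \<and> {u\<in>{0..1}. F f s u = q} = {a, b}"
      have "a \<in> {u\<in>{0..1}. F f s u = q}" "b \<in> {u\<in>{0..1}. F f s u = q}"
        unfolding conjunct2[OF 1] by simp_all
      then show ?thesis by simp
    next
      assume "\<exists>k. (a, b) = (k, k) \<and> k \<in> {0..1} \<and> F f s k \<le> q"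
      then obtain k where "a = k" "b = k" "k \<in> {0..1}" "F f s k \<le> q" by blast
      then show ?thesis by simp
    next
      assume "a \<in> {0..1} \<and> b \<in> {0..1} \<and> a < b \<and> F f s a = F f s b \<and> F f s b \<le> q"
      then show ?thesis by simp
    qed
  qed
  then show "a \<in> {0..1}" "b \<in> {0..1}" "F f s a = F f s b" "F f s a \<le> q" "b < a \<Longrightarrow> F f s a = q"
    by auto
qed

text \<open>The term - s a is affine, so \<open>F f s\<close> inherits concavity from
  \<open>f\<close> and its superlevel sets are intervals.\<close>

lemma concave_F:
  assumes f: "concave_on {0..1} f" and a: "a \<in> {0..1}" and c: "c \<in> {0..1}" and b: "a \<le> b" "b \<le> c"
    and m: "m \<le> F f s a" "m \<le> F f s c"
  shows "m \<le> F f s b"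
proof (cases "a = c")
  case False
  define u where "u = (c - b) / (c - a)"
  define v where "v = (b - a) / (c - a)"
  have ac: "0 < c - a" using b False by simp
  have uv: "0 \<le> u" "0 \<le> v" "u + v = 1"
  proof -
    show "0 \<le> u" "0 \<le> v" using b ac by (simp_all add: u_def v_def)
    have "u + v = ((c - b) + (b - a)) / (c - a)" by (simp only: u_def v_def add_divide_distrib)
    then show "u + v = 1" using ac by simp
  qed
  have "u * a + v * c = ((c - b) * a + (b - a) * c) / (c - a)"
    by (simp add: u_def v_def add_divide_distrib)
  moreover have "(c - b) * a + (b - a) * c = b * (c - a)" by (simp add: algebra_simps)
  ultimately have bb: "u * a + v * c = b" using ac by simp
  have "f (u *\<^sub>R a + v *\<^sub>R c) \<ge> u * f a + v * f c"
    by (rule conjunct2[OF f[unfolded concave_on_iff], rule_format, OF a c uv])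
  then have "u * f a + v * f c \<le> f b" using bb by simp
  moreover have "u * m \<le> u * F f s a" "v * m \<le> v * F f s c" using m uv by (auto intro: mult_left_mono)
  moreover have "u * F f s a + v * F f s c = u * f a + v * f c - s * (u * a + v * c)"
    by (simp add: F_def algebra_simps)
  moreover have "u * m + v * m = m" using uv(3) by (simp flip: distrib_right)
  ultimately have "m \<le> f b - s * b" unfolding bb by linarith
  then show ?thesis by (simp only: F_def)
qed (use b m in auto)

text \<open>If the pair with the smaller flux is nonclassical, br < bl, its flux equals r while the
  other flux is at most q; the flux gap is then at most |q - r| and the sign jump at most 2. If bl
  \<le> br, the sign jump cannot be positive: that would need al < bl \<le> br < ar, and concavity
  on [al, ar], whose end points both carry the larger flux, would force the flux at bl up to that
  value.\<close>

lemma germ_dissipative_aux: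
  assumes f: "concave_on {0..1} f"
    and a: "(al, ar) \<in> germ f s q" and b: "(bl, br) \<in> germ f s r"
    and AB: "F f s bl < F f s al"
  shows "(F f s al - F f s bl) * (sgn (ar - br) - sgn (al - bl)) \<le> 2 * \<bar>q - r\<bar>"
proof -
  note A = germ_properties[OF a] and B = germ_properties[OF b]
  have sb: "- 1 \<le> sgn x" "sgn x \<le> 1" for x :: real by (auto simp: sgn_if)
  show ?thesis
  proof (cases "br < bl")
    case True
    then have "F f s al - F f s bl \<le> \<bar>q - r\<bar>" using A(4) B(5) by linarith
    moreover have "sgn (ar - br) - sgn (al - bl) \<le> 2" using sb(2)[of "ar - br"] sb(1)[of "al - bl"] by linarith
    ultimately have "(F f s al - F f s bl) * (sgn (ar - br) - sgn (al - bl)) \<le> (F f s al - F f s bl) * 2"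
      using AB by (intro mult_left_mono) auto
    then show ?thesis
      by (rule order_trans) (use \<open>F f s al - F f s bl \<le> \<bar>q - r\<bar>\<close> in simp)
  next
    case False
    have "sgn (ar - br) \<le> sgn (al - bl)"
    proof (rule ccontr)
      assume n: "\<not> sgn (ar - br) \<le> sgn (al - bl)"
      have ne: "ar \<noteq> br" "al \<noteq> bl" using A(3) B(3) AB by auto
      with n have "br < ar" "al < bl" by (auto simp: sgn_if split: if_splits)
      then have "F f s al \<le> F f s bl"
        using False by - (rule concave_F[OF f A(1,2)], auto simp: A(3))
      then show False using AB by simp
    qed
    then have "(F f s al - F f s bl) * (sgn (ar - br) - sgn (al - bl)) \<le> 0"
      using AB by (intro mult_nonneg_nonpos) auto
    then show ?thesis by (rule order_trans) simp
  qed
qed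

text \<open>Each pair has one common flux, so the interface term factors into the flux gap times the
  jump of the sign of the difference. This product is symmetric in the two pairs, which allows
  ordering the fluxes.\<close>

lemma germ_dissipative:
  assumes f: "concave_on {0..1} f"
    and a: "(al, ar) \<in> germ f s q" and b: "(bl, br) \<in> germ f s r"
  shows "Phi f s ar br - Phi f s al bl \<le> 2 * \<bar>q - r\<bar>"
proof -
  note A = germ_properties[OF a] and B = germ_properties[OF b]
  have alg: "a * (x - y) - b * (x - y) = (x - y) * (a - b)" for a b x y :: real
    by (subst left_diff_distrib[symmetric]) (rule mult.commute)
  have alg': "(x - y) * (a - b) = (y - x) * ((- a) - (- b))" for a b x y :: real
    using minus_mult_minus[of "x - y" "a - b"] by simp
  have sg: "sgn (br - ar) = - sgn (ar - br)" "sgn (bl - al) = - sgn (al - bl)"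
    using sgn_minus[of "ar - br"] sgn_minus[of "al - bl"] by simp_all
  have Phi: "Phi f s ar br - Phi f s al bl = (F f s al - F f s bl) * (sgn (ar - br) - sgn (al - bl))"
    unfolding Phi_def A(3)[symmetric] B(3)[symmetric] by (rule alg)
  have swap: "(F f s al - F f s bl) * (sgn (ar - br) - sgn (al - bl))
      = (F f s bl - F f s al) * (sgn (br - ar) - sgn (bl - al))"
    unfolding sg by (rule alg')
  show ?thesis
  proof (rule linorder_cases[of "F f s bl" "F f s al"])
    assume "F f s bl < F f s al"
    then show ?thesis unfolding Phi by (rule germ_dissipative_aux[OF f a b])
  next
    assume "F f s al < F f s bl"
    then show ?thesis unfolding Phi swap abs_minus_commute[of q] by (rule germ_dissipative_aux[OF f b a])
  next
    assume "F f s bl = F f s al"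
    then show ?thesis unfolding Phi by simp
  qed
qed

text \<open>The first derivative is continuous and hence bounded on [0,1], and
  \<open>clamp01\<close> does not increase distances.\<close>

lemma admissible_flux_extension:
  assumes "admissible_flux f"
  obtains L where "lipschitz_flux (\<lambda>x. f (clamp01 x)) L"
proof -
  obtain f1 f2 where d: "\<And>u. u \<in> {0..1} \<Longrightarrow> (f has_real_derivative f1 u) (at u within {0..1})"
    and d2: "\<And>u. u \<in> {0..1} \<Longrightarrow> (f1 has_real_derivative f2 u) (at u within {0..1})"
  proof -
    have "\<exists>f1 f2. (\<forall>u\<in>{0..1}. (f has_real_derivative f1 u) (at u within {0..1})) \<and>
        (\<forall>u\<in>{0..1}. (f1 has_real_derivative f2 u) (at u within {0..1})) \<and> continuous_on {0..1} f2"
      using assms unfolding admissible_flux_def by (rule conjunct1)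
    then show thesis using that by blast
  qed
  have "continuous_on {0..1} f1"
    unfolding continuous_on_eq_continuous_within using DERIV_continuous[OF d2] by blast
  then have "bounded (f1 ` {0..1})" by (intro compact_imp_bounded compact_continuous_image) auto
  then obtain L where L: "\<forall>x\<in>f1 ` {0..1}. norm x \<le> L" unfolding bounded_iff by blast
  have l: "norm (f x - f y) \<le> L * norm (x - y)" if "x \<in> {0..1}" "y \<in> {0..1}" for x y
  proof (rule field_differentiable_bound[of "{0..1}" f f1])
    show "norm (f1 z) \<le> L" if "z \<in> {0..1}" for z using L that by blast
  qed (use that d in simp_all)
  have "norm (f1 0) \<le> L" using L by simp
  then have L0: "0 \<le> L" using norm_ge_zero[of "f1 0"] by linarith
  have "\<bar>f (clamp01 x) - f (clamp01 y)\<bar> \<le> L * \<bar>x - y\<bar>" for x y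
    using l[OF clamp01_range clamp01_range, of x y] mult_left_mono[OF clamp01_lipschitz[of x y] L0] by simp
  then show thesis by (intro that[of L] lipschitz_flux.intro)
qed

subsection \<open>The weighted contraction estimate\<close>

text \<open>The order of the two quantifiers can be exchanged only for measurable sets, and
  \<open>P\<close> need not be measurable; the argument is run for a measurable null set containing
  the exceptional set.\<close>

lemma AE_sections:
  fixes P :: "real \<times> real \<Rightarrow> bool"
  assumes "AE z in lborel. P z"
  shows "AE t in lborel. AE x in lborel. P (x, t)"
proof -
  obtain N where N: "{z. \<not> P z} \<subseteq> N" "N \<in> null_sets lborel"
    using assms by (auto elim!: AE_E simp: null_sets_def)
  have Nb: "N \<in> sets borel" using N(2) by auto
  have "AE z in lborel \<Otimes>\<^sub>M lborel. z \<notin> N" using AE_not_in[OF N(2)] by (simp only: lborel_prod)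
  from lborel_pair.AE_pair[OF this] have a: "AE x in lborel. AE t in lborel. (x, t) \<notin> N" .
  have m: "{z \<in> space (lborel \<Otimes>\<^sub>M lborel). (fst z, snd z) \<notin> N} \<in> sets (lborel \<Otimes>\<^sub>M (lborel :: real measure))"
    using Nb unfolding lborel_prod by (simp add: sets.compl_sets[of N, simplified] Collect_neg_eq Compl_eq_Diff_UNIV)
  have "AE t in lborel. AE x in lborel. (x, t) \<notin> N"
    using a lborel_pair.AE_commute[OF m] by simp
  then show ?thesis
  proof eventually_elim
    case (elim t)
    then show ?case by eventually_elim (use N(1) in blast)
  qed
qed

section \<open>Solutions and traces through Borel representatives\<close>

lemma has_trace_representative:
  assumes \<gamma>: "Linf_loc \<gamma>" "AE t in lborel. t \<in> {0<..} \<longrightarrow> \<gamma> t \<in> {0..1}"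
    and u[measurable]: "u \<in> borel_measurable borel" and \<rho>u: "AE z in lborel. z \<in> Om \<longrightarrow> \<rho> z = u z"
    and y[measurable]: "yy \<in> borel_measurable borel" and I: "I \<in> sets borel"
    and lim: "\<And>T. 0 < T \<Longrightarrow> ((\<lambda>h. (LINT z:S T h|lebesgue. \<bar>\<rho> z - \<gamma> (snd z)\<bar>) / h) \<longlongrightarrow> 0) (at_right 0)"
    and S: "\<And>T h. 0 < h \<Longrightarrow> S T h = strip yy T I h"
  obtains \<gamma>' where "\<And>T. 0 < T \<Longrightarrow> has_trace yy T I u \<gamma>'" "AE t in lborel. t \<in> {0<..} \<longrightarrow> \<gamma> t = \<gamma>' t"
proof -
  have "Linf01 {0<..} \<gamma>"
    unfolding Linf01_def
  proof
    show "\<gamma> \<in> borel_measurable (lebesgue_on {0<..})" using \<gamma>(1) by (simp only: Linf_loc_def)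
    show "AE t in lebesgue_on {0<..}. \<gamma> t \<in> {0..1}"
      by (subst AE_lebesgue_on_iff, simp, rule \<gamma>(2))
  qed
  then obtain \<gamma>' where \<gamma>'[measurable]: "\<gamma>' \<in> borel_measurable borel" and r: "\<And>t. \<gamma>' t \<in> {0..1}"
    and eq: "AE t in lborel. t \<in> {0<..} \<longrightarrow> \<gamma> t = \<gamma>' t"
    using Linf01_representative[of "{0<..}" \<gamma>] by auto
  have "has_trace yy T I u \<gamma>'" if T: "0 < T" for T
    unfolding has_trace_def
  proof (intro conjI allI \<gamma>' r)
    have "(LINT z:S T h|lebesgue. \<bar>\<rho> z - \<gamma> (snd z)\<bar>) = (\<integral>z. indicator (strip yy T I h) z * \<bar>u z - \<gamma>' (snd z)\<bar> \<partial>lborel)"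
      if "0 < h" for h
      unfolding set_lebesgue_integral_def S[OF that]
    proof (rule lebesgue_integral_eq_lborel)
      note [measurable] = strip_borel[OF y I, of T h]
      show "(\<lambda>z. indicator (strip yy T I h) z * \<bar>u z - \<gamma>' (snd z)\<bar>) \<in> borel_measurable borel" by measurable
      show "AE z in lborel. indicator (strip yy T I h) z *\<^sub>R \<bar>\<rho> z - \<gamma> (snd z)\<bar>
          = indicator (strip yy T I h) z * \<bar>u z - \<gamma>' (snd z)\<bar>"
        using \<rho>u AE_snd_lborel[OF eq]
      proof eventually_elim
        case (elim z)
        then show ?case by (cases z) (auto simp: strip_def Om_def indicator_def)
      qed
    qed
    then have "eventually (\<lambda>h. (LINT z:S T h|lebesgue. \<bar>\<rho> z - \<gamma> (snd z)\<bar>) / h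
        = (\<integral>z. indicator (strip yy T I h) z * \<bar>u z - \<gamma>' (snd z)\<bar> \<partial>lborel) / h) (at_right 0)"
      by (intro eventually_at_rightI[of 0 1]) auto
    then show "((\<lambda>h. (\<integral>z. indicator (strip yy T I h) z * \<bar>u z - \<gamma>' (snd z)\<bar> \<partial>lborel) / h) \<longlongrightarrow> 0) (at_right 0)"
      by (rule Lim_transform_eventually[OF lim[OF T]])
  qed
  then show thesis using eq that by blast
qed

lemma left_trace_representative:
  assumes tr: "left_trace y \<rho> \<gamma>" and r: "AE t in lborel. t \<in> {0<..} \<longrightarrow> \<gamma> t \<in> {0..1}"
    and u: "u \<in> borel_measurable borel" "AE z in lborel. z \<in> Om \<longrightarrow> \<rho> z = u z"
    and yy: "yy = (\<lambda>t. y (max 0 t))" "yy \<in> borel_measurable borel"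
  obtains \<gamma>' where "\<And>T. 0 < T \<Longrightarrow> has_trace yy T {-1<..<0} u \<gamma>'" "AE t in lborel. t \<in> {0<..} \<longrightarrow> \<gamma> t = \<gamma>' t"
proof (rule has_trace_representative[OF _ r u yy(2), of "{-1<..<0}" "\<lambda>T h. {(x, t). 0 < t \<and> t < T \<and> y t - h < x \<and> x < y t}"])
  show "{(x, t). 0 < t \<and> t < T \<and> y t - h < x \<and> x < y t} = strip yy T {-1<..<0} h" if "0 < h" for T h
    using that by (auto simp: strip_def yy(1) field_simps)
  show "((\<lambda>h. (LINT z:{(x, t). 0 < t \<and> t < T \<and> y t - h < x \<and> x < y t}|lebesgue. \<bar>\<rho> z - \<gamma> (snd z)\<bar>) / h) \<longlongrightarrow> 0) (at_right 0)"
    if "0 < T" for T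
    using tr that unfolding left_trace_def by blast
qed (use tr that in \<open>auto simp: left_trace_def\<close>)

lemma right_trace_representative:
  assumes tr: "right_trace y \<rho> \<gamma>" and r: "AE t in lborel. t \<in> {0<..} \<longrightarrow> \<gamma> t \<in> {0..1}"
    and u: "u \<in> borel_measurable borel" "AE z in lborel. z \<in> Om \<longrightarrow> \<rho> z = u z"
    and yy: "yy = (\<lambda>t. y (max 0 t))" "yy \<in> borel_measurable borel"
  obtains \<gamma>' where "\<And>T. 0 < T \<Longrightarrow> has_trace yy T {0<..<1} u \<gamma>'" "AE t in lborel. t \<in> {0<..} \<longrightarrow> \<gamma> t = \<gamma>' t"
proof (rule has_trace_representative[OF _ r u yy(2), of "{0<..<1}" "\<lambda>T h. {(x, t). 0 < t \<and> t < T \<and> y t < x \<and> x < y t + h}"])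
  show "{(x, t). 0 < t \<and> t < T \<and> y t < x \<and> x < y t + h} = strip yy T {0<..<1} h" if "0 < h" for T h
    using that by (auto simp: strip_def yy(1) field_simps)
  show "((\<lambda>h. (LINT z:{(x, t). 0 < t \<and> t < T \<and> y t < x \<and> x < y t + h}|lebesgue. \<bar>\<rho> z - \<gamma> (snd z)\<bar>) / h) \<longlongrightarrow> 0) (at_right 0)"
    if "0 < T" for T
    using tr that unfolding right_trace_def by blast
qed (use tr that in \<open>auto simp: right_trace_def\<close>)

text \<open>By definition the traces are only locally bounded. Membership in the germ confines them
  to [0,1] at almost every time, which permits Borel representatives with values in [0,1] at every
  time.\<close>

lemma (in lipschitz_flux) solution_representative:
  assumes gf: "\<And>x. x \<in> {0..1} \<Longrightarrow> g x = f x"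
    and ro: "ro \<in> borel_measurable borel" "\<And>x. ro x \<in> {0..1}" "AE x in lborel. \<rho>\<^sub>o x = ro x"
    and yy: "yy = (\<lambda>t. y (max 0 t))" "yy \<in> borel_measurable borel"
    and sol: "germ_entropy_solution f y dy q \<rho>\<^sub>o \<rho>"
  obtains u \<gamma>l \<gamma>r where "kruzkov g (Gam y) u" "AE z in lborel. z \<in> Om \<longrightarrow> \<rho> z = u z"
    "\<And>z. z \<notin> Om \<Longrightarrow> u z = ro (fst z)"
    "\<And>T. 0 < T \<Longrightarrow> has_trace yy T {-1<..<0} u \<gamma>l" "\<And>T. 0 < T \<Longrightarrow> has_trace yy T {0<..<1} u \<gamma>r"
    "AE t in lborel. t \<in> {0<..} \<longrightarrow> (\<gamma>l t, \<gamma>r t) \<in> germ f (dy t) (q t)"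
proof -
  have \<rho>: "Linf01 Om \<rho>" "entropy_ineq f y \<rho>\<^sub>o \<rho>" using sol by (auto simp: germ_entropy_solution_def)
  obtain u where u: "kruzkov g (Gam y) u" "AE z in lborel. z \<in> Om \<longrightarrow> \<rho> z = u z" "\<And>z. z \<notin> Om \<Longrightarrow> u z = ro (fst z)"
    by (rule kruzkov_of_entropy_ineq[OF gf ro \<rho>, simplified], (rule that; assumption))
  obtain \<gamma>l \<gamma>r where tr: "left_trace y \<rho> \<gamma>l" "right_trace y \<rho> \<gamma>r"
    and germ: "AE t in lborel. t \<in> {0<..} \<longrightarrow> (\<gamma>l t, \<gamma>r t) \<in> germ f (dy t) (q t)"
    using sol by (auto simp: germ_entropy_solution_def AE_lebesgue_on_iff)
  have rl: "AE t in lborel. t \<in> {0<..} \<longrightarrow> \<gamma>l t \<in> {0..1}" and rr: "AE t in lborel. t \<in> {0<..} \<longrightarrow> \<gamma>r t \<in> {0..1}"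
    using germ by (rule eventually_mono, use germ_properties(1,2) in blast)+
  obtain \<gamma>l' where l: "\<And>T. 0 < T \<Longrightarrow> has_trace yy T {-1<..<0} u \<gamma>l'" "AE t in lborel. t \<in> {0<..} \<longrightarrow> \<gamma>l t = \<gamma>l' t"
    by (rule left_trace_representative[OF tr(1) rl kruzkov_measurable[OF u(1)] u(2) yy], (rule that; assumption))
  obtain \<gamma>r' where r: "\<And>T. 0 < T \<Longrightarrow> has_trace yy T {0<..<1} u \<gamma>r'" "AE t in lborel. t \<in> {0<..} \<longrightarrow> \<gamma>r t = \<gamma>r' t"
    by (rule right_trace_representative[OF tr(2) rr kruzkov_measurable[OF u(1)] u(2) yy], (rule that; assumption))
  have "AE t in lborel. t \<in> {0<..} \<longrightarrow> (\<gamma>l' t, \<gamma>r' t) \<in> germ f (dy t) (q t)"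
    using germ l(2) r(2) by eventually_elim auto
  from that[OF u l(1) r(1) this] show thesis .
qed

section \<open>The cutoff in the backward light cone\<close>

lemma step_affine_derivative:
  "((\<lambda>x. step (a + b * x)) has_real_derivative b * bump (a + b * x)) (at x)"
proof -
  have "((\<lambda>x. a + b * x) has_real_derivative b) (at x)" by (auto intro!: derivative_eq_intros)
  from DERIV_chain2[OF step_has_derivative this] show ?thesis by (simp add: mult.commute)
qed

text \<open>Equal to 1 where |x| + L t \<le> M - 1 and to 0 where |x| + L t \<ge> M. The lateral
  boundary moves inwards at speed L, the bound on the speed of propagation.\<close>

definition space_cutoff :: "real \<Rightarrow> real \<Rightarrow> real \<times> real \<Rightarrow> real" where
  "space_cutoff L M z = step (M - fst z - L * snd z) * step (M + fst z - L * snd z)"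

lemma smooth_space_cutoff: "smooth (space_cutoff L M)"
  unfolding space_cutoff_def by (intro smooth_intros smooth_comp[OF smooth_step])

lemma space_cutoff_range: "0 \<le> space_cutoff L M z" "space_cutoff L M z \<le> 1"
  using step_bounds by (auto simp: space_cutoff_def intro: mult_le_one)

lemma space_cutoff_eq_1: "\<bar>fst z\<bar> + L * snd z + 1 \<le> M \<Longrightarrow> space_cutoff L M z = 1"
  by (simp add: space_cutoff_def step_eq_1)

text \<open>Used with d = |u - v| and k the entropy flux. The two lateral faces contribute
  nonnegative multiples of -(L d + k) and -(L d - k), so finite speed of propagation gives them the
  favourable sign.\<close>

lemma space_cutoff_dissipation:
  assumes "\<bar>k\<bar> \<le> L * d"
  shows "d * dt (space_cutoff L M) z + k * dx (space_cutoff L M) z \<le> 0"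
proof -
  obtain x t where z: "z = (x, t)" by (cases z)
  define a b where "a = M - x - L * t" and "b = M + x - L * t"
  have "dx (space_cutoff L M) (x, t) = - bump (M - x - L * t) * step (M + x - L * t) + step (M - x - L * t) * bump (M + x - L * t)" for x t
  proof (rule dx_eqI)
    fix x t
    show "((\<lambda>x. space_cutoff L M (x, t)) has_real_derivative
        - bump (M - x - L * t) * step (M + x - L * t) + step (M - x - L * t) * bump (M + x - L * t)) (at x)"
      using DERIV_mult[OF step_affine_derivative[of "M - L * t" "-1" x] step_affine_derivative[of "M - L * t" 1 x]]
      by (simp add: space_cutoff_def algebra_simps)
  qed
  then have X: "dx (space_cutoff L M) z = - bump a * step b + step a * bump b" by (simp add: z a_def b_def)
  have "dt (space_cutoff L M) (x, t) = - L * (bump (M - x - L * t) * step (M + x - L * t) + step (M - x - L * t) * bump (M + x - L * t))" for x t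
  proof (rule dt_eqI)
    fix x t
    show "((\<lambda>t. space_cutoff L M (x, t)) has_real_derivative
        - L * (bump (M - x - L * t) * step (M + x - L * t) + step (M - x - L * t) * bump (M + x - L * t))) (at t)"
      using DERIV_mult[OF step_affine_derivative[of "M - x" "-L" t] step_affine_derivative[of "M + x" "-L" t]]
      by (simp add: space_cutoff_def algebra_simps)
  qed
  then have T: "dt (space_cutoff L M) z = - L * (bump a * step b + step a * bump b)" by (simp add: z a_def b_def)
  have "d * dt (space_cutoff L M) z + k * dx (space_cutoff L M) z
      = - ((bump a * step b) * (L * d + k) + (step a * bump b) * (L * d - k))"
    unfolding X T by (simp add: algebra_simps)
  moreover have "0 \<le> (bump a * step b) * (L * d + k)" "0 \<le> (step a * bump b) * (L * d - k)"
    using assms bump_nonneg step_bounds by (auto intro!: mult_nonneg_nonneg)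
  ultimately show ?thesis by linarith
qed

text \<open>The time cutoff decreases from 1 at T - 1/k to 0 at T - 1/(2k), so minus its derivative
  is a weight of unit mass on that interval. The estimate therefore bounds a time average of the
  localised L^1 distance before \<open>T\<close> by the data.\<close>

lemma (in lipschitz_flux) weighted_contraction:
  assumes u: "kruzkov g (Gam y) u" and v: "kruzkov g (Gam y) v"
    and ro: "ro \<in> borel_measurable borel" "\<And>x. ro x \<in> {0..1}" "\<And>z. z \<notin> Om \<Longrightarrow> u z = ro (fst z)"
    and so: "so \<in> borel_measurable borel" "\<And>x. so x \<in> {0..1}" "\<And>z. z \<notin> Om \<Longrightarrow> v z = so (fst z)"
    and W: "W1inf_loc y dy" and T: "0 < T" and yy: "yy = (\<lambda>t. y (max 0 t))"
    and tr: "has_trace yy T {0<..<1} u \<gamma>r" "has_trace yy T {0<..<1} v \<delta>r"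
      "has_trace yy T {-1<..<0} u \<gamma>l" "has_trace yy T {-1<..<0} v \<delta>l"
    and D: "D \<in> borel_measurable borel" "bdd D" "\<And>t. 0 \<le> D t"
    and diss: "AE t in lborel. t \<in> {0<..<T} \<longrightarrow>
      (kflux g (\<gamma>r t) (\<delta>r t) - dy t * \<bar>\<gamma>r t - \<delta>r t\<bar>) - (kflux g (\<gamma>l t) (\<delta>l t) - dy t * \<bar>\<gamma>l t - \<delta>l t\<bar>) \<le> 2 * D t"
    and k: "0 < k" and int: "integrable lborel (\<lambda>x. \<bar>ro x - so x\<bar>)"
  shows "integrable lborel (\<lambda>z. indicator Om z * (\<bar>u z - v z\<bar> * (2 * k * bump (2 * k * (T - snd z) - 1)) * space_cutoff L M z))"
    and "(\<integral>z. indicator Om z * (\<bar>u z - v z\<bar> * (2 * k * bump (2 * k * (T - snd z) - 1)) * space_cutoff L M z) \<partial>lborel)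
      \<le> (\<integral>x. \<bar>ro x - so x\<bar> \<partial>lborel) + 2 * (\<integral>t. indicator {0<..<T} t * D t \<partial>lborel)"
proof -
  \<comment> \<open>The factor step(t + 2) equals 1 for t \<ge> -1 and serves to make the support
    compact in the past. The second factor ends at T - 1/(2k), strictly before \<open>T\<close>, as
    the interface inequality demands.\<close>
  let ?th = "\<lambda>t. step (t + 2) * step (2 * k * (T - t) - 1)"
  define \<theta> where "\<theta> z = ?th (snd z)" for z :: "real \<times> real"
  define \<psi> where "\<psi> z = \<theta> z * space_cutoff L M z" for z
  have \<theta>s: "smooth \<theta>" unfolding \<theta>_def by (intro smooth_intros smooth_comp[OF smooth_step])
  have \<psi>s: "smooth \<psi>" unfolding \<psi>_def by (intro smooth_mult \<theta>s smooth_space_cutoff)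
  have \<theta>r: "0 \<le> \<theta> z" "\<theta> z \<le> 1" for z using step_bounds by (auto simp: \<theta>_def intro: mult_le_one)
  \<comment> \<open>For t \<ge> -2 the cone is at most 2 L wider on each side than at time 0; the
    absolute value covers negative M.\<close>
  define K where "K = {- (\<bar>M\<bar> + 2 * L)..\<bar>M\<bar> + 2 * L} \<times> {-2..T - 1 / (2 * k)}"
  have K: "compact K" unfolding K_def by (intro compact_Times) auto
  have K0: "\<psi> z = 0" if "z \<notin> K" for z
  proof -
    obtain x t where z: "z = (x, t)" by (cases z)
    have split: "s < -2 \<or> d < s \<or> (-2 \<le> s \<and> c < w) \<or> (-2 \<le> s \<and> w < - c)"
      if "\<not> (- c \<le> w \<and> w \<le> c \<and> -2 \<le> s \<and> s \<le> d)" for c d s w :: real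
      using that by (auto simp: not_le)
    have "\<not> (- (\<bar>M\<bar> + 2 * L) \<le> x \<and> x \<le> \<bar>M\<bar> + 2 * L \<and> -2 \<le> t \<and> t \<le> T - 1 / (2 * k))"
      using \<open>z \<notin> K\<close> unfolding K_def z by simp
    from split[OF this] consider "t < -2" | "T - 1 / (2 * k) < t" | "-2 \<le> t" "\<bar>M\<bar> + 2 * L < x" | "-2 \<le> t" "x < - (\<bar>M\<bar> + 2 * L)"
      by blast
    then show ?thesis
    proof cases
      case 1
      then show ?thesis by (simp add: \<psi>_def \<theta>_def z step_eq_0)
    next
      case 2
      then have "2 * k * (T - t) - 1 \<le> 0" using k by (simp add: field_simps)
      then show ?thesis by (simp add: \<psi>_def \<theta>_def z step_eq_0)
    next
      case 3
      have "L * -2 \<le> L * t" using 3 L_nonneg by (intro mult_left_mono)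
      then have "M - x - L * t \<le> 0" using 3 by linarith
      then show ?thesis by (simp add: \<psi>_def space_cutoff_def z step_eq_0)
    next
      case 4
      have "L * -2 \<le> L * t" using 4 L_nonneg by (intro mult_left_mono)
      then have "M + x - L * t \<le> 0" using 4 by linarith
      then show ?thesis by (simp add: \<psi>_def space_cutoff_def z step_eq_0)
    qed
  qed
  have KT: "snd z < T" if "z \<in> K" for z 
  proof -
    have "snd z \<le> T - 1 / (2 * k)" using that by (auto simp: K_def)
    moreover have "0 < 1 / (2 * k)" using k by simp
    ultimately show ?thesis by linarith
  qed
  note um[measurable] = kruzkov_measurable[OF u] and vm[measurable] = kruzkov_measurable[OF v]
  have ub: "bdd u" "bdd v" using kruzkov_bdd u v by auto
  have cm[measurable]: "space_cutoff L M \<in> borel_measurable borel"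
    by (intro borel_measurable_continuous_onI smooth_imp_continuous smooth_space_cutoff)
  have cb: "bdd (space_cutoff L M)"
  proof (rule bddI)
    show "\<bar>space_cutoff L M z\<bar> \<le> 1" for z using space_cutoff_range[of L M z] by simp
  qed
  let ?B = "\<lambda>z. indicat_real Om z * (\<bar>u z - v z\<bar> * (2 * k * bump (2 * k * (T - snd z) - 1)) * space_cutoff L M z)"
  have bK2: "bounded ({- \<bar>M\<bar>..\<bar>M\<bar>} \<times> {0..T})" by (intro bounded_Times bounded_closed_interval)
  have B0: "?B z = 0" if out: "z \<notin> {- \<bar>M\<bar>..\<bar>M\<bar>} \<times> {0..T}" for z
  proof -
    obtain x t where z: "z = (x, t)" by (cases z)
    show ?thesis
    proof (cases "0 < t")
      case True
      then have Lt: "0 \<le> L * t" using L_nonneg by simp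
      consider "T < t" | "\<bar>M\<bar> < x" | "x < - \<bar>M\<bar>" using out True unfolding z by (auto simp: not_le)
      then show ?thesis
      proof cases
        case 1
        then have "k * (T - t) \<le> 0" using k by (intro mult_nonneg_nonpos) auto
        then have "bump (2 * k * (T - t) - 1) = 0" by (intro bump_eq_0) simp
        then show ?thesis by (simp add: z)
      next
        case 2
        then have "M - x - L * t \<le> 0" using Lt by linarith
        then show ?thesis by (simp add: space_cutoff_def z step_eq_0)
      next
        case 3
        then have "M + x - L * t \<le> 0" using Lt by linarith
        then show ?thesis by (simp add: space_cutoff_def z step_eq_0)
      qed
    qed (simp add: z Om_def)
  qed
  have bK: "bounded K" by (rule compact_imp_bounded[OF K])
  show iB: "integrable lborel ?B"
    by (rule integrable_bdd[OF _ _ bK2], measurable, intro bdd_intros ub cb bdd_comp[OF bdd_bump], rule B0)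
  have p0: "dx \<psi> z = 0" "dt \<psi> z = 0" if "z \<notin> K" for z
    using that K0 dx_dt_eq_0[OF compact_imp_closed[OF K], of \<psi>] by auto
  have pm[measurable]: "\<psi> \<in> borel_measurable borel" "dx \<psi> \<in> borel_measurable borel" "dt \<psi> \<in> borel_measurable borel"
    by (auto intro!: borel_measurable_continuous_onI smooth_imp_continuous smooth_plane \<psi>s)
  have pb: "bdd \<psi>" "bdd (dx \<psi>)" "bdd (dt \<psi>)"
    by (auto intro!: bdd_compact_support[OF _ K] smooth_imp_continuous smooth_plane \<psi>s simp: p0 K0)
  have \<psi>r: "0 \<le> \<psi> z" "\<psi> z \<le> 1" for z
    using \<theta>r[of z] space_cutoff_range[of L M z] by (auto simp: \<psi>_def intro: mult_le_one)
  let ?A = "\<lambda>z. indicat_real Om z * (\<bar>u z - v z\<bar> * dt \<psi> z + kflux g (u z) (v z) * dx \<psi> z)"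
  have iA: "integrable lborel ?A"
    by (rule integrable_bdd[OF _ _ bK], measurable, intro bdd_intros kflux_bdd ub pb, simp add: p0)
  have main: "0 \<le> (\<integral>z. ?A z \<partial>lborel) + (\<integral>x. \<bar>ro x - so x\<bar> * \<psi> (x, 0) \<partial>lborel)
      + 2 * (\<integral>t. indicator {0<..<T} t * D t \<partial>lborel)"
    by (rule interface_inequality[OF u v ro so W T yy tr D diss \<psi>s K K0 KT \<psi>r])
  have "(\<integral>z. ?A z \<partial>lborel) \<le> (\<integral>z. - ?B z \<partial>lborel)"
  proof (rule integral_mono[OF iA])
    show "integrable lborel (\<lambda>z. - ?B z)" using iB by simp
    fix z :: "real \<times> real"
    obtain x t where z: "z = (x, t)" by (cases z)
    show "?A z \<le> - ?B z"
    proof (cases "0 < t")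
      case True
      have dx\<theta>: "dx \<theta> z = 0" unfolding z
        by (rule dx_eqI[where g="\<lambda>_ _. 0"]) (simp add: \<theta>_def)
      have "dt \<theta> (x, t) = bump (t + 2) * step (2 * k * (T - t) - 1) + step (t + 2) * (- 2 * k * bump (2 * k * (T - t) - 1))" for x t
      proof (rule dt_eqI)
        fix x t
        show "((\<lambda>t. \<theta> (x, t)) has_real_derivative
          bump (t + 2) * step (2 * k * (T - t) - 1) + step (t + 2) * (- 2 * k * bump (2 * k * (T - t) - 1))) (at t)"
          using DERIV_mult[OF step_affine_derivative[of 2 1 t] step_affine_derivative[of "2 * k * T - 1" "- 2 * k" t]]
          by (simp add: \<theta>_def algebra_simps)
      qed
      then have dt\<theta>: "dt \<theta> z = - 2 * k * bump (2 * k * (T - snd z) - 1)"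
        using True by (simp add: z bump_eq_0 step_eq_1)
      \<comment> \<open>The product rule separates the derivative of the time cutoff, which gives
        minus \<open>?B\<close>, from the derivatives of the cone cutoff, whose contribution is
        nonpositive.\<close>
      have "?A z = \<theta> z * (\<bar>u z - v z\<bar> * dt (space_cutoff L M) z + kflux g (u z) (v z) * dx (space_cutoff L M) z) - ?B z"
        using True unfolding \<psi>_def dx_mult[OF \<theta>s smooth_space_cutoff] dx\<theta> dt\<theta>
        by (simp add: z Om_def algebra_simps)
      moreover have "\<theta> z * (\<bar>u z - v z\<bar> * dt (space_cutoff L M) z + kflux g (u z) (v z) * dx (space_cutoff L M) z) \<le> 0"
        by (intro mult_nonneg_nonpos \<theta>r space_cutoff_dissipation kflux_le)
      ultimately show ?thesis by linarith
    qed (simp add: z Om_def)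
  qed
  moreover have "(\<integral>x. \<bar>ro x - so x\<bar> * \<psi> (x, 0) \<partial>lborel) \<le> (\<integral>x. \<bar>ro x - so x\<bar> \<partial>lborel)"
  proof (rule integral_mono'[OF int])
    show "\<bar>ro x - so x\<bar> * \<psi> (x, 0) \<le> \<bar>ro x - so x\<bar>" for x using \<psi>r by (intro mult_left_le) auto
  qed auto
  ultimately show "(\<integral>z. ?B z \<partial>lborel) \<le> (\<integral>x. \<bar>ro x - so x\<bar> \<partial>lborel) + 2 * (\<integral>t. indicator {0<..<T} t * D t \<partial>lborel)"
    using main by simp
qed

section \<open>From the averaged estimate to uniqueness and contraction\<close>

lemma constraint_gap:
  assumes q: "Linf_loc q" and r: "Linf_loc r" and T: "0 < T"
  obtains D where "D \<in> borel_measurable borel" "bdd D" "\<And>t. 0 \<le> D t"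
    "AE t in lborel. t \<in> {0<..<T} \<longrightarrow> D t = \<bar>q t - r t\<bar>"
    "(\<integral>\<^sup>+t\<in>{0<..<T}. ennreal \<bar>q t - r t\<bar> \<partial>lebesgue) = ennreal (\<integral>t. indicator {0<..<T} t * D t \<partial>lborel)"
proof -
  have m: "q \<in> borel_measurable (lebesgue_on {0<..})" "r \<in> borel_measurable (lebesgue_on {0<..})"
    using q r by (auto simp: Linf_loc_def)
  obtain q0 where q0[measurable]: "q0 \<in> borel_measurable borel" and qq: "AE t in lborel. t \<in> {0<..} \<longrightarrow> q t = q0 t"
    by (rule ex_borel_representative[OF m(1)], simp, (rule that; assumption))
  obtain r0 where r0[measurable]: "r0 \<in> borel_measurable borel" and rr: "AE t in lborel. t \<in> {0<..} \<longrightarrow> r t = r0 t"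
    by (rule ex_borel_representative[OF m(2)], simp, (rule that; assumption))
  have "\<exists>C. AE t in lebesgue_on {0<..<T}. \<bar>q t\<bar> \<le> C" "\<exists>C. AE t in lebesgue_on {0<..<T}. \<bar>r t\<bar> \<le> C"
    using q r T unfolding Linf_loc_def by blast+
  then obtain A B where A: "AE t in lborel. t \<in> {0<..<T} \<longrightarrow> \<bar>q t\<bar> \<le> A"
    and B: "AE t in lborel. t \<in> {0<..<T} \<longrightarrow> \<bar>r t\<bar> \<le> B"
    by (auto simp: AE_lebesgue_on_iff)
  \<comment> \<open>The truncation changes nothing almost everywhere on (0,T) and makes
    \<open>D\<close> bounded at all times; |q - r| itself is only essentially bounded there.\<close>
  define D where "D t = min (\<bar>A\<bar> + \<bar>B\<bar>) \<bar>q0 t - r0 t\<bar>" for t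
  have Dm[measurable]: "D \<in> borel_measurable borel" unfolding D_def[abs_def] by measurable
  have Db: "bdd D" by (rule bddI[of _ "\<bar>A\<bar> + \<bar>B\<bar>"]) (auto simp: D_def)
  have D0: "0 \<le> D t" for t by (auto simp: D_def)
  have Dq: "AE t in lborel. t \<in> {0<..<T} \<longrightarrow> D t = \<bar>q t - r t\<bar>"
    using qq rr A B
  proof eventually_elim
    case (elim t)
    show ?case
    proof
      assume t: "t \<in> {0<..<T}"
      then have e: "q t = q0 t" "r t = r0 t" "\<bar>q t\<bar> \<le> A" "\<bar>r t\<bar> \<le> B" using elim by auto
      then have "\<bar>q0 t - r0 t\<bar> \<le> \<bar>A\<bar> + \<bar>B\<bar>" by linarith
      then show "D t = \<bar>q t - r t\<bar>" by (simp add: D_def e(1,2))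
    qed
  qed
  have i: "integrable lborel (\<lambda>t. indicator {0<..<T} t * D t)"
    by (rule integrable_bdd[OF _ _ bounded_Ioo[of 0 T]], measurable, intro bdd_intros Db, simp)
  have "(\<integral>\<^sup>+t\<in>{0<..<T}. ennreal \<bar>q t - r t\<bar> \<partial>lebesgue)
      = (\<integral>\<^sup>+t. ennreal (indicator {0<..<T} t * D t) \<partial>lborel)"
    unfolding nn_integral_completion
  proof (rule nn_integral_cong_AE)
    show "AE t in lborel. ennreal \<bar>q t - r t\<bar> * indicator {0<..<T} t = ennreal (indicator {0<..<T} t * D t)"
      using Dq by eventually_elim (auto simp: indicator_def)
  qed
  also have "\<dots> = ennreal (\<integral>t. indicator {0<..<T} t * D t \<partial>lborel)"
    by (rule nn_integral_eq_integral[OF i]) (simp add: D0)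
  finally show thesis by (rule that[OF Dm Db D0 Dq])
qed

text \<open>The representatives are chosen before \<open>T\<close>, \<open>k\<close> and
  \<open>M\<close>: both conclusions of the theorem let these parameters vary for one fixed pair of
  functions.\<close>

lemma contraction_estimate:
  assumes adm: "admissible_flux f" and init: "Linf01 UNIV \<rho>\<^sub>o" "Linf01 UNIV \<sigma>\<^sub>o"
    and W: "W1inf_loc y dy" and q: "Linf_loc q" and r: "Linf_loc r"
    and sol: "germ_entropy_solution f y dy q \<rho>\<^sub>o \<rho>" "germ_entropy_solution f y dy r \<sigma>\<^sub>o \<sigma>"
  obtains u v ro so L where "u \<in> borel_measurable borel" "\<And>z. u z \<in> {0..1}" "AE z in lborel. z \<in> Om \<longrightarrow> \<rho> z = u z"
    "v \<in> borel_measurable borel" "\<And>z. v z \<in> {0..1}" "AE z in lborel. z \<in> Om \<longrightarrow> \<sigma> z = v z"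
    "ro \<in> borel_measurable borel" "AE x in lborel. \<rho>\<^sub>o x = ro x"
    "so \<in> borel_measurable borel" "AE x in lborel. \<sigma>\<^sub>o x = so x" "(0::real) \<le> L"
    "\<And>T k M. 0 < T \<Longrightarrow> 0 < k \<Longrightarrow> integrable lborel (\<lambda>x. \<bar>ro x - so x\<bar>) \<Longrightarrow>
      integrable lborel (\<lambda>z. indicator Om z * (\<bar>u z - v z\<bar> * (2 * k * bump (2 * k * (T - snd z) - 1)) * space_cutoff L M z)) \<and>
      ennreal (\<integral>z. indicator Om z * (\<bar>u z - v z\<bar> * (2 * k * bump (2 * k * (T - snd z) - 1)) * space_cutoff L M z) \<partial>lborel)
        \<le> ennreal (\<integral>x. \<bar>ro x - so x\<bar> \<partial>lborel) + 2 * (\<integral>\<^sup>+t\<in>{0<..<T}. ennreal \<bar>q t - r t\<bar> \<partial>lebesgue)"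
proof -
  obtain L where lf: "lipschitz_flux (\<lambda>x. f (clamp01 x)) L"
    by (rule admissible_flux_extension[OF adm])
  interpret lipschitz_flux "\<lambda>x. f (clamp01 x)" L by (rule lf)
  let ?g = "\<lambda>x. f (clamp01 x)"
  have gf: "?g x = f x" if "x \<in> {0..1}" for x using that by (simp add: clamp01_id)
  have conc: "concave_on {0..1} f" using adm unfolding admissible_flux_def by (elim conjE)
  obtain ro where ro: "ro \<in> borel_measurable borel" "\<And>x. ro x \<in> {0..1}" "AE x in lborel. \<rho>\<^sub>o x = ro x"
    using Linf01_representative[OF init(1)] by auto
  obtain so where so: "so \<in> borel_measurable borel" "\<And>x. so x \<in> {0..1}" "AE x in lborel. \<sigma>\<^sub>o x = so x"
    using Linf01_representative[OF init(2)] by auto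
  define yy where "yy = (\<lambda>t. y (max 0 t))"
  have yyc: "continuous_on UNIV yy"
  proof -
    have yc: "continuous_on {0..} y" using W unfolding W1inf_loc_def by (elim conjE)
    show ?thesis unfolding yy_def
      by (rule continuous_on_compose2[OF yc, of UNIV "\<lambda>t. max 0 t"]) (auto intro!: continuous_intros)
  qed
  have yym: "yy \<in> borel_measurable borel" by (rule borel_measurable_continuous_onI[OF yyc])
  obtain u \<gamma>l \<gamma>r where u: "kruzkov ?g (Gam y) u" "AE z in lborel. z \<in> Om \<longrightarrow> \<rho> z = u z"
    "\<And>z. z \<notin> Om \<Longrightarrow> u z = ro (fst z)"
    and \<gamma>: "\<And>T. 0 < T \<Longrightarrow> has_trace yy T {-1<..<0} u \<gamma>l" "\<And>T. 0 < T \<Longrightarrow> has_trace yy T {0<..<1} u \<gamma>r"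
    and g\<gamma>: "AE t in lborel. t \<in> {0<..} \<longrightarrow> (\<gamma>l t, \<gamma>r t) \<in> germ f (dy t) (q t)"
    by (rule solution_representative[OF gf ro yy_def yym sol(1)], simp, (rule that; assumption))
  obtain v \<delta>l \<delta>r where v: "kruzkov ?g (Gam y) v" "AE z in lborel. z \<in> Om \<longrightarrow> \<sigma> z = v z"
    "\<And>z. z \<notin> Om \<Longrightarrow> v z = so (fst z)"
    and \<delta>: "\<And>T. 0 < T \<Longrightarrow> has_trace yy T {-1<..<0} v \<delta>l" "\<And>T. 0 < T \<Longrightarrow> has_trace yy T {0<..<1} v \<delta>r"
    and g\<delta>: "AE t in lborel. t \<in> {0<..} \<longrightarrow> (\<delta>l t, \<delta>r t) \<in> germ f (dy t) (r t)"
    by (rule solution_representative[OF gf so yy_def yym sol(2)], simp, (rule that; assumption))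
  show thesis
  proof (rule that[OF kruzkov_measurable[OF u(1)] kruzkov_range[OF u(1)] u(2)
        kruzkov_measurable[OF v(1)] kruzkov_range[OF v(1)] v(2) ro(1,3) so(1,3) L_nonneg])
    fix T k M :: real
    assume T: "0 < T" and k: "0 < k" and int: "integrable lborel (\<lambda>x. \<bar>ro x - so x\<bar>)"
    obtain D where D: "D \<in> borel_measurable borel" "bdd D" "\<And>t. 0 \<le> D t"
      and Dq: "AE t in lborel. t \<in> {0<..<T} \<longrightarrow> D t = \<bar>q t - r t\<bar>"
      and Dint: "(\<integral>\<^sup>+t\<in>{0<..<T}. ennreal \<bar>q t - r t\<bar> \<partial>lebesgue) = ennreal (\<integral>t. indicator {0<..<T} t * D t \<partial>lborel)"
      by (rule constraint_gap[OF q r T], (rule that; assumption))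
    have diss: "AE t in lborel. t \<in> {0<..<T} \<longrightarrow>
      (kflux ?g (\<gamma>r t) (\<delta>r t) - dy t * \<bar>\<gamma>r t - \<delta>r t\<bar>) - (kflux ?g (\<gamma>l t) (\<delta>l t) - dy t * \<bar>\<gamma>l t - \<delta>l t\<bar>) \<le> 2 * D t"
      using g\<gamma> g\<delta> Dq
    proof eventually_elim
      case (elim t)
      show ?case
      proof
        assume t: "t \<in> {0<..<T}"
        then have a: "(\<gamma>l t, \<gamma>r t) \<in> germ f (dy t) (q t)" and b: "(\<delta>l t, \<delta>r t) \<in> germ f (dy t) (r t)"
          and d: "D t = \<bar>q t - r t\<bar>" using elim by auto
        show "(kflux ?g (\<gamma>r t) (\<delta>r t) - dy t * \<bar>\<gamma>r t - \<delta>r t\<bar>) - (kflux ?g (\<gamma>l t) (\<delta>l t) - dy t * \<bar>\<gamma>l t - \<delta>l t\<bar>) \<le> 2 * D t"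
        proof -
          have "Phi f (dy t) (\<gamma>r t) (\<delta>r t) = kflux ?g (\<gamma>r t) (\<delta>r t) - dy t * \<bar>\<gamma>r t - \<delta>r t\<bar>"
            by (rule Phi_eq_kflux[OF gf germ_properties(2)[OF a] germ_properties(2)[OF b]])
          moreover have "Phi f (dy t) (\<gamma>l t) (\<delta>l t) = kflux ?g (\<gamma>l t) (\<delta>l t) - dy t * \<bar>\<gamma>l t - \<delta>l t\<bar>"
            by (rule Phi_eq_kflux[OF gf germ_properties(1)[OF a] germ_properties(1)[OF b]])
          ultimately show ?thesis using germ_dissipative[OF conc a b] unfolding d by simp
        qed
      qed
    qed
    note wc = weighted_contraction[OF u(1) v(1) ro(1,2) u(3) so(1,2) v(3) W T yy_def
        \<gamma>(2)[OF T] \<delta>(2)[OF T] \<gamma>(1)[OF T] \<delta>(1)[OF T] D diss k int, of M]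
    have "0 \<le> (\<integral>x. \<bar>ro x - so x\<bar> \<partial>lborel)" "0 \<le> (\<integral>t. indicat_real {0<..<T} t * D t \<partial>lborel)"
      using D(3) by (auto intro!: integral_nonneg_AE)
    then have "ennreal (\<integral>x. \<bar>ro x - so x\<bar> \<partial>lborel) + 2 * ennreal (\<integral>t. indicat_real {0<..<T} t * D t \<partial>lborel)
        = ennreal ((\<integral>x. \<bar>ro x - so x\<bar> \<partial>lborel) + 2 * (\<integral>t. indicat_real {0<..<T} t * D t \<partial>lborel))"
      by (simp add: ennreal_mult)
    then show "integrable lborel (\<lambda>z. indicator Om z * (\<bar>u z - v z\<bar> * (2 * k * bump (2 * k * (T - snd z) - 1)) * space_cutoff L M z)) \<and>
      ennreal (\<integral>z. indicator Om z * (\<bar>u z - v z\<bar> * (2 * k * bump (2 * k * (T - snd z) - 1)) * space_cutoff L M z) \<partial>lborel)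
        \<le> ennreal (\<integral>x. \<bar>ro x - so x\<bar> \<partial>lborel) + 2 * (\<integral>\<^sup>+t\<in>{0<..<T}. ennreal \<bar>q t - r t\<bar> \<partial>lebesgue)"
      unfolding Dint using wc by (auto intro!: ennreal_leI)
  qed
qed

text \<open>With equal data and constraints the right-hand side is 0, so for every choice of
  parameters the nonnegative integrand vanishes almost everywhere. Countably many choices suffice
  for every point of the half-plane to have at least one positive weight.\<close>

lemma germ_entropy_solution_unique:
  assumes adm: "admissible_flux f" and init: "Linf01 UNIV \<rho>\<^sub>o"
    and W: "W1inf_loc y dy" and q: "Linf_loc q"
    and sol: "germ_entropy_solution f y dy q \<rho>\<^sub>o \<rho>" "germ_entropy_solution f y dy q \<rho>\<^sub>o \<rho>'"
  shows "AE z in lebesgue_on Om. \<rho> z = \<rho>' z"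
proof -
  obtain u v ro so L where u[measurable]: "u \<in> borel_measurable borel" "\<And>z. u z \<in> {0..1}" and u\<rho>: "AE z in lborel. z \<in> Om \<longrightarrow> \<rho> z = u z"
    and v[measurable]: "v \<in> borel_measurable borel" "\<And>z. v z \<in> {0..1}" and v\<rho>: "AE z in lborel. z \<in> Om \<longrightarrow> \<rho>' z = v z"
    and ro[measurable]: "ro \<in> borel_measurable borel" and ro\<rho>: "AE x in lborel. \<rho>\<^sub>o x = ro x"
    and so[measurable]: "so \<in> borel_measurable borel" and so\<rho>: "AE x in lborel. \<rho>\<^sub>o x = so x" and L: "(0::real) \<le> L"
    and est: "\<And>T k M. 0 < T \<Longrightarrow> 0 < k \<Longrightarrow> integrable lborel (\<lambda>x. \<bar>ro x - so x\<bar>) \<Longrightarrow>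
      integrable lborel (\<lambda>z. indicator Om z * (\<bar>u z - v z\<bar> * (2 * k * bump (2 * k * (T - snd z) - 1)) * space_cutoff L M z)) \<and>
      ennreal (\<integral>z. indicator Om z * (\<bar>u z - v z\<bar> * (2 * k * bump (2 * k * (T - snd z) - 1)) * space_cutoff L M z) \<partial>lborel)
        \<le> ennreal (\<integral>x. \<bar>ro x - so x\<bar> \<partial>lborel) + 2 * (\<integral>\<^sup>+t\<in>{0<..<T}. ennreal \<bar>q t - q t\<bar> \<partial>lebesgue)"
    by (rule contraction_estimate[OF adm init init W q q sol], (rule that; assumption))
  have z: "AE x in lborel. \<bar>ro x - so x\<bar> = 0" using ro\<rho> so\<rho> by eventually_elim simp
  have int: "integrable lborel (\<lambda>x. \<bar>ro x - so x\<bar>)"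
    by (subst integrable_cong_AE[of _ _ "\<lambda>_. 0"]) (use z in auto)
  have i0: "(\<integral>x. \<bar>ro x - so x\<bar> \<partial>lborel) = 0" by (rule integral_eq_zero_AE[OF z])
  \<comment> \<open>With N = n + 1, the choice T = N and k = 1/N makes the time weight positive for
    0 < t < N/2, and M = (L + 1) N + 1 makes the cone cutoff equal to 1 where |x| \<le> N and 0 < t
    \<le> N.\<close>
  define B where "B n z = indicator Om z * (\<bar>u z - v z\<bar> * (2 * (1 / (real n + 1)) * bump (2 * (1 / (real n + 1)) * ((real n + 1) - snd z) - 1))
      * space_cutoff L ((L + 1) * (real n + 1) + 1) z)" for n z
  have Bz: "AE z in lborel. B n z = 0" for n
  proof -
    have e: "integrable lborel (B n)" "ennreal (\<integral>z. B n z \<partial>lborel) \<le> 0"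
      using est[of "real n + 1" "1 / (real n + 1)" "(L + 1) * (real n + 1) + 1"] int
      unfolding B_def by (simp_all add: i0)
    have nn: "0 \<le> B n z" for z unfolding B_def by (intro mult_nonneg_nonneg space_cutoff_range bump_nonneg) auto
    have "0 \<le> (\<integral>z. B n z \<partial>lborel)" by (rule Bochner_Integration.integral_nonneg) (rule nn)
    then have "(\<integral>z. B n z \<partial>lborel) = 0" using e(2) by simp
    then show ?thesis using integral_nonneg_eq_0_iff_AE[OF e(1)] nn by simp
  qed
  have "AE z in lborel. \<forall>n. B n z = 0" using Bz by (simp add: AE_all_countable)
  then have "AE z in lborel. z \<in> Om \<longrightarrow> \<rho> z = \<rho>' z"
    using u\<rho> v\<rho>
  proof eventually_elim
    case (elim z)
    show ?case
    proof
      assume zO: "z \<in> Om"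
      obtain x t where zxt: "z = (x, t)" by (cases z)
      have t: "0 < t" using zO by (simp add: zxt Om_def)
      obtain n :: nat where n: "\<bar>x\<bar> + 2 * t < real n" using reals_Archimedean2 by blast
      define N where "N = real n + 1"
      have N: "0 < N" "\<bar>x\<bar> \<le> N" "2 * t < N" using n t by (auto simp: N_def)
      have "2 * (1 / N) * (N - t) - 1 = 1 - 2 * t / N" using N by (simp add: field_simps)
      moreover have "0 < 1 - 2 * t / N" "1 - 2 * t / N < 1" using N t by simp_all
      ultimately have b: "0 < bump (2 * (1 / N) * (N - t) - 1)" by (simp only: bump_pos)
      have "L * t \<le> L * N" using L N t by (intro mult_left_mono) auto
      then have "\<bar>x\<bar> + L * t + 1 \<le> (L + 1) * N + 1" using N by (simp add: distrib_right)
      then have c: "space_cutoff L ((L + 1) * N + 1) z = 1" by (intro space_cutoff_eq_1) (simp add: zxt)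
      have "B n z = 0" using elim by blast
      then have "\<bar>u z - v z\<bar> * (2 * (1 / N) * bump (2 * (1 / N) * (N - t) - 1)) = 0"
        using zO unfolding B_def N_def[symmetric] c by (simp only: indicator_simps mult_1_left mult_1_right zxt snd_conv)
      then have "u z = v z" using b N by (simp only: mult_eq_0_iff) auto
      then show "\<rho> z = \<rho>' z" using elim zO by simp
    qed
  qed
  moreover have "Om \<in> sets lebesgue" by simp
  ultimately show ?thesis by (simp add: AE_lebesgue_on_iff)
qed

lemma set_integral_abs_triangle:
  fixes a b c d :: "real \<Rightarrow> real"
  assumes "set_integrable M A a" "set_integrable M A b" "set_integrable M A c" "set_integrable M A d"
  shows "(LINT x:A|M. \<bar>a x - b x\<bar>) \<le> (LINT x:A|M. \<bar>c x - d x\<bar>) + (LINT x:A|M. \<bar>c x - a x\<bar>) + (LINT x:A|M. \<bar>d x - b x\<bar>)"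
proof -
  have i: "set_integrable M A (\<lambda>x. \<bar>a x - b x\<bar>)" "set_integrable M A (\<lambda>x. \<bar>c x - d x\<bar>)"
    "set_integrable M A (\<lambda>x. \<bar>c x - a x\<bar>)" "set_integrable M A (\<lambda>x. \<bar>d x - b x\<bar>)"
    by (intro set_integrable_abs set_integral_diff(1) assms)+
  have "(LINT x:A|M. \<bar>a x - b x\<bar>) \<le> (LINT x:A|M. (\<bar>c x - d x\<bar> + \<bar>c x - a x\<bar>) + \<bar>d x - b x\<bar>)"
    by (rule set_integral_mono[OF i(1) set_integral_add(1)[OF set_integral_add(1)[OF i(2,3)] i(4)]]) linarith
  also have "\<dots> = (LINT x:A|M. \<bar>c x - d x\<bar>) + (LINT x:A|M. \<bar>c x - a x\<bar>) + (LINT x:A|M. \<bar>d x - b x\<bar>)"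
    using set_integral_add(2)[OF set_integral_add(1)[OF i(2,3)] i(4)] set_integral_add(2)[OF i(2,3)] by simp
  finally show ?thesis .
qed

text \<open>The representatives agree with the solutions only at almost every time, so the value at
  \<open>T\<close> is reached through averages: on a short interval before \<open>T\<close> the L^1
  distance on [-M, M] is at least its value at \<open>T\<close> minus an epsilon, and the averaged
  estimate bounds it from above. The intervals [-M, M] then exhaust the line by monotone
  convergence.\<close>

lemma germ_entropy_solution_contraction:
  assumes adm: "admissible_flux f" and init: "Linf01 UNIV \<rho>\<^sub>o" "Linf01 UNIV \<sigma>\<^sub>o"
    and W: "W1inf_loc y dy" and q: "Linf_loc q" and r: "Linf_loc r"
    and sol: "germ_entropy_solution f y dy q \<rho>\<^sub>o \<rho>" "germ_entropy_solution f y dy r \<sigma>\<^sub>o \<sigma>"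
    and R: "time_continuous_rep \<rho> R" and S: "time_continuous_rep \<sigma> S" and T: "0 < T"
  shows "(\<integral>\<^sup>+x. ennreal \<bar>R T x - S T x\<bar> \<partial>lebesgue)
      \<le> (\<integral>\<^sup>+x. ennreal \<bar>\<rho>\<^sub>o x - \<sigma>\<^sub>o x\<bar> \<partial>lebesgue) + 2 * (\<integral>\<^sup>+t\<in>{0<..<T}. ennreal \<bar>q t - r t\<bar> \<partial>lebesgue)"
proof -
  let ?Q = "\<integral>\<^sup>+t\<in>{0<..<T}. ennreal \<bar>q t - r t\<bar> \<partial>lebesgue"
  obtain u v ro so L where u[measurable]: "u \<in> borel_measurable borel" and ur: "\<And>z. u z \<in> {0..1}" and u\<rho>: "AE z in lborel. z \<in> Om \<longrightarrow> \<rho> z = u z"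
    and v[measurable]: "v \<in> borel_measurable borel" and vr: "\<And>z. v z \<in> {0..1}" and v\<sigma>: "AE z in lborel. z \<in> Om \<longrightarrow> \<sigma> z = v z"
    and ro[measurable]: "ro \<in> borel_measurable borel" and ro\<rho>: "AE x in lborel. \<rho>\<^sub>o x = ro x"
    and so[measurable]: "so \<in> borel_measurable borel" and so\<sigma>: "AE x in lborel. \<sigma>\<^sub>o x = so x" and L: "(0::real) \<le> L"
    and est: "\<And>T k M. 0 < T \<Longrightarrow> 0 < k \<Longrightarrow> integrable lborel (\<lambda>x. \<bar>ro x - so x\<bar>) \<Longrightarrow>
      integrable lborel (\<lambda>z. indicator Om z * (\<bar>u z - v z\<bar> * (2 * k * bump (2 * k * (T - snd z) - 1)) * space_cutoff L M z)) \<and>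
      ennreal (\<integral>z. indicator Om z * (\<bar>u z - v z\<bar> * (2 * k * bump (2 * k * (T - snd z) - 1)) * space_cutoff L M z) \<partial>lborel)
        \<le> ennreal (\<integral>x. \<bar>ro x - so x\<bar> \<partial>lborel) + 2 * (\<integral>\<^sup>+t\<in>{0<..<T}. ennreal \<bar>q t - r t\<bar> \<partial>lebesgue)"
    by (rule contraction_estimate[OF adm init W q r sol], (rule that; assumption))
  have N: "(\<integral>\<^sup>+x. ennreal \<bar>\<rho>\<^sub>o x - \<sigma>\<^sub>o x\<bar> \<partial>lebesgue) = (\<integral>\<^sup>+x. ennreal \<bar>ro x - so x\<bar> \<partial>lborel)"
    unfolding nn_integral_completion
    by (rule nn_integral_cong_AE) (use ro\<rho> so\<sigma> in \<open>eventually_elim, simp\<close>)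
  show ?thesis
  \<comment> \<open>An infinite initial distance makes the claim trivial; otherwise the difference
    of the data is integrable, as the averaged estimate presupposes.\<close>
  proof (cases "(\<integral>\<^sup>+x. ennreal \<bar>ro x - so x\<bar> \<partial>lborel) = \<infinity>")
    case True
    then show ?thesis by (simp add: N)
  next
    case False
    have int: "integrable lborel (\<lambda>x. \<bar>ro x - so x\<bar>)"
      using False by (intro integrableI_nonneg) (auto simp: less_top)
    have N': "(\<integral>\<^sup>+x. ennreal \<bar>\<rho>\<^sub>o x - \<sigma>\<^sub>o x\<bar> \<partial>lebesgue) = ennreal (\<integral>x. \<bar>ro x - so x\<bar> \<partial>lborel)"
      unfolding N by (rule nn_integral_eq_integral[OF int]) simp
    define Z where "Z = ennreal (\<integral>x. \<bar>ro x - so x\<bar> \<partial>lborel) + 2 * ?Q"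
    have Ri: "set_integrable lebesgue {-M..M} (R t)" and Si: "set_integrable lebesgue {-M..M} (S t)"
      if "0 \<le> t" "0 < M" for t M
      using R S that unfolding time_continuous_rep_def by blast+
    have Rc: "((\<lambda>s. LINT x:{-M..M}|lebesgue. \<bar>R s x - R T x\<bar>) \<longlongrightarrow> 0) (at T within {0..})"
      and Sc: "((\<lambda>s. LINT x:{-M..M}|lebesgue. \<bar>S s x - S T x\<bar>) \<longlongrightarrow> 0) (at T within {0..})" if "0 < M" for M
      using R S T that unfolding time_continuous_rep_def by (meson less_imp_le)+
    have Ru: "AE t in lborel. t \<in> {0<..} \<longrightarrow> (AE x in lborel. R t x = u (x, t))"
    proof -
      have "AE t in lborel. t \<in> {0<..} \<longrightarrow> (AE x in lborel. R t x = \<rho> (x, t))"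
        using R unfolding time_continuous_rep_def by (simp add: AE_lebesgue_on_iff AE_completion_iff)
      with AE_sections[OF u\<rho>] show ?thesis
      proof eventually_elim
        case (elim t)
        show ?case
        proof
          assume t: "t \<in> {0<..}"
          then have "AE x in lborel. R t x = \<rho> (x, t)" using elim by blast
          with elim(1) show "AE x in lborel. R t x = u (x, t)"
            by eventually_elim (use t in \<open>auto simp: Om_def\<close>)
        qed
      qed
    qed
    have Sv: "AE t in lborel. t \<in> {0<..} \<longrightarrow> (AE x in lborel. S t x = v (x, t))"
    proof -
      have "AE t in lborel. t \<in> {0<..} \<longrightarrow> (AE x in lborel. S t x = \<sigma> (x, t))"
        using S unfolding time_continuous_rep_def by (simp add: AE_lebesgue_on_iff AE_completion_iff)
      with AE_sections[OF v\<sigma>] show ?thesis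
      proof eventually_elim
        case (elim t)
        show ?case
        proof
          assume t: "t \<in> {0<..}"
          then have "AE x in lborel. S t x = \<sigma> (x, t)" using elim by blast
          with elim(1) show "AE x in lborel. S t x = v (x, t)"
            by eventually_elim (use t in \<open>auto simp: Om_def\<close>)
        qed
      qed
    qed
    have loc: "ennreal (LINT x:{-M..M}|lebesgue. \<bar>R T x - S T x\<bar>) \<le> Z" if M: "0 < M" for M
    proof (rule ennreal_le_epsilon)
      fix \<epsilon> :: real assume \<epsilon>: "0 < \<epsilon>"
      define G where "G t = (LINT x:{-M..M}|lebesgue. \<bar>R t x - S t x\<bar>)" for t
      have "eventually (\<lambda>s. (LINT x:{-M..M}|lebesgue. \<bar>R s x - R T x\<bar>) < \<epsilon> / 2 \<and>
          (LINT x:{-M..M}|lebesgue. \<bar>S s x - S T x\<bar>) < \<epsilon> / 2) (at T within {0..})"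
        using order_tendstoD(2)[OF Rc[OF M], of "\<epsilon> / 2"] order_tendstoD(2)[OF Sc[OF M], of "\<epsilon> / 2"] \<epsilon>
        by (intro eventually_conj) auto
      then obtain \<delta> where \<delta>: "0 < \<delta>" and close: "\<And>s. 0 \<le> s \<Longrightarrow> s \<noteq> T \<Longrightarrow> dist s T < \<delta> \<Longrightarrow>
          (LINT x:{-M..M}|lebesgue. \<bar>R s x - R T x\<bar>) < \<epsilon> / 2 \<and> (LINT x:{-M..M}|lebesgue. \<bar>S s x - S T x\<bar>) < \<epsilon> / 2"
        unfolding eventually_at by auto
      \<comment> \<open>The averaging window (T - 1/k, T) then lies within \<delta> of
        \<open>T\<close> and in positive times.\<close>
      define k where "k = 1 / min \<delta> T"
      have k: "0 < k" using \<delta> T by (simp add: k_def)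
      have k1: "1 / k \<le> \<delta>" "1 / k \<le> T" by (auto simp: k_def)
      define b where "b t = 2 * k * bump (2 * k * (T - t) - 1)" for t
      have bm[measurable]: "b \<in> borel_measurable borel" unfolding b_def[abs_def] by measurable
      have bb: "bdd b" unfolding b_def[abs_def] by (intro bdd_intros bdd_comp[OF bdd_bump])
      have b_nonneg: "0 \<le> b t" for t unfolding b_def using k by (intro mult_nonneg_nonneg bump_nonneg) auto
      have b0: "b t = 0" if out: "t \<notin> {T - 1 / k<..<T}" for t
      proof -
        have "t \<le> T - 1 / k \<or> T \<le> t" using out by auto
        then consider "t \<le> T - 1 / k" | "T \<le> t" by blast
        then have "2 * k * (T - t) - 1 \<le> 0 \<or> 1 \<le> 2 * k * (T - t) - 1"
        proof cases
          case 1
          then have "k * (1 / k) \<le> k * (T - t)" using k by (intro mult_left_mono) auto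
          then show ?thesis using k by simp
        next
          case 2
          then have "k * (T - t) \<le> 0" using k by (intro mult_nonneg_nonpos) auto
          then show ?thesis by simp
        qed
        then have "bump (2 * k * (T - t) - 1) = 0" by (rule bump_eq_0)
        then show ?thesis by (simp add: b_def)
      qed
      have ib: "integrable lborel b"
        by (rule integrable_bdd[OF bm bb bounded_Ioo[of "T - 1 / k" T] b0])
      have b1: "(\<integral>t. b t \<partial>lborel) = 1"
      proof -
        have eq: "2 * k * (T - t) - 1 = (2 * k * T - 1) + (- 2 * k) * t" for t by (simp add: algebra_simps)
        have "(\<integral>t. bump t \<partial>lborel) = \<bar>- 2 * k\<bar> *\<^sub>R (\<integral>t. bump (2 * k * (T - t) - 1) \<partial>lborel)"
          unfolding eq using k by (intro lborel_integral_real_affine) simp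
        then show ?thesis using k by (simp add: b_def integral_bump)
      qed
      \<comment> \<open>The cone is wide enough for its cutoff to be 1 on [-M, M] at all times
        between 0 and \<open>T\<close>.\<close>
      define M' where "M' = M + L * T + 1"
      define I where "I x = indicat_real {-M..M} x" for x
      have Im[measurable]: "I \<in> borel_measurable borel" unfolding I_def[abs_def] by measurable
      let ?f = "\<lambda>z. b (snd z) * (I (fst z) * \<bar>u z - v z\<bar>)"
      let ?h = "\<lambda>z. indicator Om z * (\<bar>u z - v z\<bar> * (2 * k * bump (2 * k * (T - snd z) - 1)) * space_cutoff L M' z)"
      have ub: "bdd u" "bdd v" using ur vr by (auto intro!: bddI[of _ 1] simp: abs_le_iff)
      have Ib: "bdd I" unfolding I_def[abs_def] by (rule bdd_indicator)
      have i_f: "integrable lborel ?f"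
      proof (rule integrable_bdd[of _ "{-M..M} \<times> {T - 1 / k<..<T}"])
        show "bdd ?f" by (intro bdd_intros bdd_comp[OF bb] bdd_comp[OF Ib] ub)
        show "bounded ({-M..M} \<times> {T - 1 / k<..<T})" by (intro bounded_Times bounded_closed_interval bounded_Ioo)
        show "?f z = 0" if "z \<notin> {-M..M} \<times> {T - 1 / k<..<T}" for z
        proof (cases "snd z \<in> {T - 1 / k<..<T}")
          case True
          then have "fst z \<notin> {-M..M}" using that by (cases z) auto
          then show ?thesis by (simp add: I_def)
        qed (simp add: b0)
      qed measurable
      note e = est[OF T k int, of M']
      have fh: "(\<integral>z. ?f z \<partial>lborel) \<le> (\<integral>z. ?h z \<partial>lborel)"
      proof (rule integral_mono[OF i_f conjunct1[OF e]])
        fix z :: "real \<times> real"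
        obtain x t where z: "z = (x, t)" by (cases z)
        have hn: "0 \<le> ?h z"
          using b_nonneg[of "snd z"] space_cutoff_range[of L M' z] by (auto simp: b_def)
        show "?f z \<le> ?h z"
        proof (cases "t \<in> {T - 1 / k<..<T} \<and> x \<in> {-M..M}")
          case True
          then have t: "0 < t" "t < T" and x: "\<bar>x\<bar> \<le> M" using k1 by auto
          have "L * t \<le> L * T" using L t by (intro mult_left_mono) auto
          then have "space_cutoff L M' z = 1" using x by (intro space_cutoff_eq_1) (simp add: z M'_def)
          then show ?thesis using True t by (simp add: z Om_def I_def b_def)
        next
          case False
          then have "?f z = 0" using b0[of t] by (auto simp: z I_def)
          then show ?thesis using hn by linarith
        qed
      qed
      have F: "integrable (lborel \<Otimes>\<^sub>M lborel) (\<lambda>(x, t). ?f (x, t))"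
        using i_f unfolding lborel_prod case_prod_beta' prod.collapse .
      have sw: "(\<integral>z. ?f z \<partial>lborel) = (\<integral>t. (\<integral>x. ?f (x, t) \<partial>lborel) \<partial>lborel)"
        using lborel_pair.integral_snd[OF F] unfolding lborel_prod case_prod_beta' prod.collapse by (rule sym)
      \<comment> \<open>Fubini provides the slices of \<open>u\<close> and \<open>v\<close>; at
        almost every time these are the slices of \<open>R\<close> and \<open>S\<close>.\<close>
      have Gt: "AE t in lborel. t \<in> {0<..} \<longrightarrow> (\<integral>x. ?f (x, t) \<partial>lborel) = b t * G t"
        using Ru Sv
      proof eventually_elim
        case (elim t)
        show ?case
        proof
          assume "t \<in> {0<..}"
          then have a: "AE x in lborel. R t x = u (x, t)" "AE x in lborel. S t x = v (x, t)" using elim by auto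
          have [measurable]: "(\<lambda>x. (x, t)) \<in> borel_measurable borel"
            by (intro borel_measurable_continuous_onI continuous_intros)
          have "G t = (\<integral>x. I x * \<bar>u (x, t) - v (x, t)\<bar> \<partial>lborel)"
            unfolding G_def set_lebesgue_integral_def
          proof (rule lebesgue_integral_eq_lborel)
            show "(\<lambda>x. I x * \<bar>u (x, t) - v (x, t)\<bar>) \<in> borel_measurable borel" by measurable
            show "AE x in lborel. indicat_real {-M..M} x *\<^sub>R \<bar>R t x - S t x\<bar> = I x * \<bar>u (x, t) - v (x, t)\<bar>"
              using a by eventually_elim (simp add: I_def)
          qed
          then show "(\<integral>x. ?f (x, t) \<partial>lborel) = b t * G t" by (simp only: fst_conv snd_conv integral_mult_right_zero)
        qed
      qed
      have GT: "G T - \<epsilon> \<le> G t" if t: "t \<in> {T - 1 / k<..<T}" for t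
      proof -
        have t0: "0 \<le> t" "t \<noteq> T" "dist t T < \<delta>" using t k1 by (auto simp: dist_real_def)
        have "G T \<le> G t + (LINT x:{-M..M}|lebesgue. \<bar>R t x - R T x\<bar>) + (LINT x:{-M..M}|lebesgue. \<bar>S t x - S T x\<bar>)"
          unfolding G_def using T t0(1) by (intro set_integral_abs_triangle Ri Si M) auto
        then show ?thesis using close[OF t0] by linarith
      qed
      have "G T - \<epsilon> = (\<integral>t. b t * (G T - \<epsilon>) \<partial>lborel)" by (simp add: b1)
      also have "\<dots> \<le> (\<integral>t. (\<integral>x. ?f (x, t) \<partial>lborel) \<partial>lborel)"
      proof (rule integral_mono_AE)
        show "integrable lborel (\<lambda>t. b t * (G T - \<epsilon>))" using ib by simp
        show "integrable lborel (\<lambda>t. \<integral>x. ?f (x, t) \<partial>lborel)" using lborel_pair.integrable_snd[OF F] .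
        show "AE t in lborel. b t * (G T - \<epsilon>) \<le> (\<integral>x. ?f (x, t) \<partial>lborel)"
          using Gt
        proof eventually_elim
          case (elim t)
          show ?case
          proof (cases "t \<in> {T - 1 / k<..<T}")
            case True
            then have "t \<in> {0<..}" using k1 by auto
            then have e: "(\<integral>x. ?f (x, t) \<partial>lborel) = b t * G t" using elim by blast
            show ?thesis unfolding e using GT[OF True] b_nonneg by (intro mult_left_mono)
          next
            case False
            show ?thesis by (simp add: b0[OF False])
          qed
        qed
      qed
      also have "\<dots> \<le> (\<integral>z. ?h z \<partial>lborel)" using fh sw by simp
      finally have "G T \<le> (\<integral>z. ?h z \<partial>lborel) + \<epsilon>" by simp
      then have "ennreal (G T) \<le> ennreal ((\<integral>z. ?h z \<partial>lborel) + \<epsilon>)" by (rule ennreal_leI)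
      also have "\<dots> = ennreal (\<integral>z. ?h z \<partial>lborel) + ennreal \<epsilon>"
      proof (rule ennreal_plus)
        have "0 \<le> ?h z" for z
          using b_nonneg[of "snd z"] space_cutoff_range[of L M' z] by (auto simp: b_def)
        then show "0 \<le> (\<integral>z. ?h z \<partial>lborel)" by (rule Bochner_Integration.integral_nonneg)
      qed (use \<epsilon> in simp)
      also have "\<dots> \<le> Z + ennreal \<epsilon>" unfolding Z_def by (intro add_right_mono conjunct2[OF e])
      finally show "ennreal (LINT x:{-M..M}|lebesgue. \<bar>R T x - S T x\<bar>) \<le> Z + ennreal \<epsilon>"
        unfolding G_def .
    qed
    define J where "J n x = ennreal (indicat_real {-(real n + 1)..real n + 1} x * \<bar>R T x - S T x\<bar>)" for n x
    have Jint: "(\<integral>\<^sup>+x. J n x \<partial>lebesgue) \<le> Z" and Jm: "J n \<in> borel_measurable lebesgue" for n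
    proof -
      let ?A = "{-(real n + 1)..real n + 1}"
      have "set_integrable lebesgue ?A (\<lambda>x. \<bar>R T x - S T x\<bar>)"
        using T by (intro set_integrable_abs set_integral_diff(1) Ri Si) auto
      then have i: "integrable lebesgue (\<lambda>x. indicat_real ?A x * \<bar>R T x - S T x\<bar>)"
        by (simp add: set_integrable_def)
      have "(\<integral>\<^sup>+x. J n x \<partial>lebesgue) = ennreal (LINT x:?A|lebesgue. \<bar>R T x - S T x\<bar>)"
        unfolding J_def using nn_integral_eq_integral[OF i] by (simp add: set_lebesgue_integral_def)
      also have "\<dots> \<le> Z" by (rule loc) simp
      finally show "(\<integral>\<^sup>+x. J n x \<partial>lebesgue) \<le> Z" .
      show "J n \<in> borel_measurable lebesgue"
        unfolding J_def[abs_def] by (rule measurable_compose[OF borel_measurable_integrable[OF i]]) simp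
    qed
    have inc: "incseq J"
      unfolding incseq_def le_fun_def J_def by (auto intro!: ennreal_leI simp: indicator_def)
    have sup: "(SUP n. J n x) = ennreal \<bar>R T x - S T x\<bar>" for x
    proof (rule antisym)
      show "(SUP n. J n x) \<le> ennreal \<bar>R T x - S T x\<bar>"
        by (intro SUP_least) (auto simp: J_def indicator_def)
      obtain n :: nat where "\<bar>x\<bar> < real n" using reals_Archimedean2 by blast
      then have "J n x = ennreal \<bar>R T x - S T x\<bar>" by (auto simp: J_def indicator_def)
      then show "ennreal \<bar>R T x - S T x\<bar> \<le> (SUP n. J n x)" by (metis SUP_upper UNIV_I)
    qed
    have "(\<integral>\<^sup>+x. ennreal \<bar>R T x - S T x\<bar> \<partial>lebesgue) = (SUP n. \<integral>\<^sup>+x. J n x \<partial>lebesgue)"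
      using nn_integral_monotone_convergence_SUP[OF inc Jm] by (simp add: sup)
    also have "\<dots> \<le> Z" by (intro SUP_least Jint)
    finally show ?thesis unfolding Z_def N' .
  qed
qed

theorem theorem2p8:
  fixes f y dy q r \<rho>\<^sub>o \<sigma>\<^sub>o :: "real \<Rightarrow> real"
  assumes "admissible_flux f"
    and "Linf01 UNIV \<rho>\<^sub>o" and "Linf01 UNIV \<sigma>\<^sub>o"
    and "W1inf_loc y dy"
    and "Linf_loc q" and "Linf_loc r"
    and "cond_Q f dy q" and "cond_Q f dy r"
  shows
    "(\<forall>\<rho> \<sigma> :: real \<times> real \<Rightarrow> real.
        germ_entropy_solution f y dy q \<rho>\<^sub>o \<rho> \<and> germ_entropy_solution f y dy r \<sigma>\<^sub>o \<sigma> \<longrightarrow>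
        (\<forall>R S. time_continuous_rep \<rho> R \<and> time_continuous_rep \<sigma> S \<longrightarrow>
          (\<forall>T>0. (\<integral>\<^sup>+x. ennreal \<bar>R T x - S T x\<bar> \<partial>lebesgue)
                 \<le> (\<integral>\<^sup>+x. ennreal \<bar>\<rho>\<^sub>o x - \<sigma>\<^sub>o x\<bar> \<partial>lebesgue)
                   + 2 * (\<integral>\<^sup>+t\<in>{0<..<T}. ennreal \<bar>q t - r t\<bar> \<partial>lebesgue))))
     \<and> (\<forall>\<rho> \<rho>' :: real \<times> real \<Rightarrow> real.
        germ_entropy_solution f y dy q \<rho>\<^sub>o \<rho> \<and> germ_entropy_solution f y dy q \<rho>\<^sub>o \<rho>' \<longrightarrow>
        (AE z in lebesgue_on Om. \<rho> z = \<rho>' z))"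
proof (intro conjI allI impI; elim conjE)
  fix \<rho> \<sigma> :: "real \<times> real \<Rightarrow> real" and R S and T :: real
  assume "germ_entropy_solution f y dy q \<rho>\<^sub>o \<rho>" "germ_entropy_solution f y dy r \<sigma>\<^sub>o \<sigma>"
    "time_continuous_rep \<rho> R" "time_continuous_rep \<sigma> S" "0 < T"
  then show "(\<integral>\<^sup>+x. ennreal \<bar>R T x - S T x\<bar> \<partial>lebesgue)
      \<le> (\<integral>\<^sup>+x. ennreal \<bar>\<rho>\<^sub>o x - \<sigma>\<^sub>o x\<bar> \<partial>lebesgue) + 2 * (\<integral>\<^sup>+t\<in>{0<..<T}. ennreal \<bar>q t - r t\<bar> \<partial>lebesgue)"
    by (rule germ_entropy_solution_contraction[OF assms(1-6)])
next
  fix \<rho> \<rho>' :: "real \<times> real \<Rightarrow> real"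
  assume "germ_entropy_solution f y dy q \<rho>\<^sub>o \<rho>" "germ_entropy_solution f y dy q \<rho>\<^sub>o \<rho>'"
  then show "AE z in lebesgue_on Om. \<rho> z = \<rho>' z"
    by (rule germ_entropy_solution_unique[OF assms(1,2,4,5)])
qed

end
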